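(* There exists $\nu_0>0$ such that for every real $\nu\ge\nu_0$ the following hold. (i) The functions $J_\nu(z)$, $H^{(1)}_\nu(z)$ and $H^{(2)}_\nu(z)$ are, up to constant factors, the only three solutions (not identically zero) of the Bessel equation of order $\nu$ which do not have zeros with $\Re(z/\nu)\in(-1,1)$ both for $\Im z>0$ and for $\Im z<0$ simultaneously. That is, a nontrivial solution fails to have both a zero with $\Re(z/\nu)\in(-1,1)$, $\Im z>0$ and a zero with $\Re(z/\nu)\in(-1,1)$, $\Im z<0$ if and only if it is a constant multiple of one of these three functions. (ii) $J_\nu(z)$ has no zeros $z\neq0$ such that $\Re z\in(-\nu,\nu)$. (iii) $H^{(1)}_\nu(z)$ has zeros such that $\Re z\in(-\nu,\nu)$ and $\Im z<0$. (iv) $H^{(2)}_\nu(z)$ has zeros such that $\Re z\in(-\nu,\nu)$ and $\Im z>0$.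
   Context: The Bessel equation of order $\nu$ is $z^2w''(z)+zw'(z)+(z^2-\nu^2)w(z)=0$. $J_\nu$ is the Bessel function of the first kind, $Y_\nu$ that of the second kind, and $H^{(1)}_\nu=J_\nu+iY_\nu$, $H^{(2)}_\nu=J_\nu-iY_\nu$ are the Hankel functions. All solutions are considered on the principal Riemann sheet $\arg z\in(-\pi,\pi]$, $z\neq0$, with branch cut along the negative real axis. *)

theory Defs
  imports "HOL-Complex_Analysis.Complex_Analysis"
begin

(* Powers are principal (Im (Ln z) in (-pi, pi]), so on the negative real axis these functions
   take the value belonging to arg z = pi. Using the entire function rGamma = 1 / Gamma, the
   series is also correct for negative integer orders. *)
definition bessel_J :: "complex \<Rightarrow> complex \<Rightarrow> complex" where
  "bessel_J a z =
     (z / 2) powr a * (\<Sum>k. (-1) ^ k * rGamma (a + of_nat k + 1) / fact k * (z / 2) ^ (2 * k))"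

definition bessel_Y :: "complex \<Rightarrow> complex \<Rightarrow> complex" where
  "bessel_Y a z =
     (let q = (\<lambda>b. (bessel_J b z * cos (b * of_real pi) - bessel_J (- b) z) / sin (b * of_real pi))
      in if a \<in> \<int> then Lim (at a) q else q a)"

definition hankel_H1 :: "complex \<Rightarrow> complex \<Rightarrow> complex" where
  "hankel_H1 a z = bessel_J a z + \<i> * bessel_Y a z"

definition hankel_H2 :: "complex \<Rightarrow> complex \<Rightarrow> complex" where
  "hankel_H2 a z = bessel_J a z - \<i> * bessel_Y a z"

(* A solution on the principal sheet arg z in (-pi, pi], z \<noteq> 0. The second condition attaches the
   cut to the upper side (arg z = pi): there the solution is the continuous extension from
   Im z > 0. The value at 0 is irrelevant. *)
definition bessel_solution :: "complex \<Rightarrow> (complex \<Rightarrow> complex) \<Rightarrow> bool" where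
  "bessel_solution a w \<longleftrightarrow>
     w holomorphic_on (- \<real>\<^sub>\<le>\<^sub>0) \<and>
     continuous_on {z. Im z \<ge> 0 \<and> z \<noteq> 0} w \<and>
     (\<forall>z \<in> - \<real>\<^sub>\<le>\<^sub>0. z\<^sup>2 * deriv (deriv w) z + z * deriv w z + (z\<^sup>2 - a\<^sup>2) * w z = 0)"

definition nontrivial_bessel_solution :: "complex \<Rightarrow> (complex \<Rightarrow> complex) \<Rightarrow> bool" where
  "nontrivial_bessel_solution a w \<longleftrightarrow> bessel_solution a w \<and> (\<exists>z. z \<noteq> 0 \<and> w z \<noteq> 0)"

definition constant_multiple_of :: "(complex \<Rightarrow> complex) \<Rightarrow> (complex \<Rightarrow> complex) \<Rightarrow> bool" where
  "constant_multiple_of w f \<longleftrightarrow> (\<exists>c. \<forall>z. z \<noteq> 0 \<longrightarrow> w z = c * f z)"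

end

theory Submission
  imports Defs "HOL-Real_Asymp.Real_Asymp"
begin

text \<open>
  The substitution $z = i e^\<tau>$ turns Bessel's equation into
  $f'' = (\<nu>^2 + e^{2\<tau>}) f$, whose solutions are entire in \<open>\<tau>\<close>; the upper half plane is the
  strip $|\mathrm{Im}\,\<tau>| < \pi/2$. In this coordinate $J_\<nu>$ is a multiple of a function \<open>I\<close>
  (the modified Bessel function $I_\<nu>(e^\<tau>)$, \<open>logI\<close>) that is recessive for
  $\mathrm{Re}\,\<tau> \to -\infty$, and $H^{(1)}_\<nu>$ is a multiple of a function \<open>K\<close> ($K_\<nu>(e^\<tau>)$,
  \<open>logK\<close>) that is recessive for $\mathrm{Re}\,\<tau> \to +\infty$ inside the strip.

  On a horizontal line the quantity $\mathrm{Re}(\overline{f} f')$ and its relatives are monotone, because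
  the equation makes their derivative a sum of nonnegative terms, and they tend to zero at the recessive end.
  So they have a sign everywhere. This one idea gives all the zero-free regions: $J_\<nu>$ has no zero with
  $|\mathrm{Re}\,z| < \<nu>$ (\<open>bessel_J_nonzero_strip\<close>), and $H^{(1)}_\<nu>$ has none in the upper
  half plane (\<open>hankel_H1_nonzero_upper\<close>). Near the real axis of \<open>\<tau>\<close> it also gives the quantitative bounds $\mathrm{Re}(I'/I) \ge \<nu>$ and
  $\mathrm{Re}(K'/K) \le -e^{\mathrm{Re}\,\<tau>}/2$.

  By these bounds $\Psi = \log(I/K)$ satisfies $|\Psi'| \ge \<nu> + e^{\mathrm{Re}\,\<tau>}/2$. On the real axis
  $\mathrm{Re}\,\Psi$ runs through all real numbers, and the disc of radius $4/(\<nu> + e^a/4)$ around a real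
  point \<open>a\<close> is mapped onto a set that contains the disc of radius $4 > \pi$ around $\Psi(a)$. Hence
  $I/K$ takes every nonzero value, and it does so at points with $|\mathrm{Re}\,z| \le 32$,
  whatever \<open>\<nu>\<close> is (\<open>logI_div_logK_surj\<close>). Consequently every combination $A J_\<nu> + B H^{(1)}_\<nu>$ with $A, B \ne 0$
  has a zero in the upper half of the strip, and by complex conjugation every combination
  $A J_\<nu> + B H^{(2)}_\<nu>$ with $A, B \ne 0$ has one in the lower half.

  Any solution is $A J_\<nu> + B H^{(1)}_\<nu> = (A + 2B) J_\<nu> - B H^{(2)}_\<nu>$, so it has zeros in both halves
  unless $A = 0$, $B = 0$ or $A + 2B = 0$, which are the three exceptional cases. The zeros of the Hankel functions
  themselves come from $H^{(1)}_\<nu> = 2 J_\<nu> - H^{(2)}_\<nu>$ and the analogous formula for $H^{(2)}_\<nu>$.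

  What remains is to identify $H^{(1)}_\<nu>$, which is given through power series and, for integer
  orders, a limit, with a function that decays in the upper half plane. That function is the integral
  $K_b(\zeta) = \frac12 \int_{-\infty}^\infty e^{bt - \zeta \cosh t}\,dt$. Its contiguous relations and
  its behaviour at \<open>0\<close> pin down its expansion in $I_b$ and $I_{-b}$ for real non-integer \<open>b\<close>
  (\<open>besselK_int_connection\<close>), and integer orders follow by continuity in \<open>b\<close> (\<open>logK_eq_besselK_int\<close>).
\<close>

section \<open>The entire part of the Bessel series\<close>

text \<open>The regularised hypergeometric series ${}_0\tilde F_1(;b+1;w)$, so that $J_b(z) =
  (z/2)^b\,{}_0\tilde F_1(;b+1;-z^2/4)$. It is entire in both variables.\<close>

definition reg0F1 :: "complex \<Rightarrow> complex \<Rightarrow> complex" where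
  "reg0F1 b w = (\<Sum>k. rGamma (b + of_nat k + 1) / fact k * w ^ k)"

text \<open>For large \<open>k\<close> the recurrence divides by a number of modulus at least 1,
  so only finitely many shifts matter, and on a compact set each of those is bounded. The
  uniformity in \<open>b\<close> is what makes the series holomorphic in the order.\<close>

lemma rGamma_shift_bounded:
  fixes B :: real
  obtains C where "C > 0" "\<And>b k. norm b \<le> B \<Longrightarrow> norm (rGamma (b + of_nat k + 1 :: complex)) \<le> C"
proof -
  \<comment> \<open>Beyond this index every factor \<open>b + k + 1\<close> of the recurrence has
      modulus at least 1.\<close>
  define m where "m = nat \<lceil>B\<rceil> + 1"
  have mB: "real m \<ge> B + 1" unfolding m_def by linarith
  have "compact (rGamma ` cball (0::complex) (B + real m + 1))"
    by (intro compact_continuous_image continuous_intros holomorphic_on_imp_continuous_on holomorphic_rGamma) auto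
  then obtain C where C: "C > 0"
    and "\<forall>y \<in> rGamma ` cball (0::complex) (B + real m + 1). norm y \<le> C"
    by (meson bounded_pos compact_imp_bounded)
  then have C2: "norm (rGamma y) \<le> C" if "norm y \<le> B + real m + 1" for y :: complex
    using that by auto
  have "norm (rGamma (b + of_nat k + 1 :: complex)) \<le> C" if b: "norm b \<le> B" for b k
  proof (induction k)
    case 0
    have "norm (b + 1) \<le> B + 1" using norm_triangle_ineq[of b 1] b by simp
    then have "norm (b + 1) \<le> B + real m + 1" by linarith
    then show ?case by (intro C2) simp
  next
    case (Suc k)
    show ?case
    proof (cases "Suc k \<le> m")
      case True
      have "norm (b + of_nat (Suc k) + 1) \<le> norm b + norm (of_nat (Suc k) + 1 :: complex)"
        using norm_triangle_ineq[of b "of_nat (Suc k) + 1"] by (simp add: add.assoc)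
      also have "norm (of_nat (Suc k) + 1 :: complex) = real (Suc k) + 1"
        by (metis norm_of_nat of_nat_1 of_nat_add)
      finally have "norm (b + of_nat (Suc k) + 1) \<le> B + real m + 1" using b True by linarith
      then show ?thesis by (intro C2) simp
    next
      case False
      let ?z = "b + of_nat k + 1"
      have "real (k + 1) - norm b \<le> norm ?z"
        using norm_diff_ineq[of "of_nat (k + 1)" b] norm_of_nat[of "k + 1", where ?'a = complex]
        by (simp add: algebra_simps)
      then have 1: "norm ?z \<ge> 1" using False b mB by linarith
      have "rGamma ?z = ?z * rGamma (?z + 1)" by (simp only: rGamma_plus1)
      then have "norm (rGamma ?z) = norm ?z * norm (rGamma (?z + 1))" by (simp add: norm_mult)
      moreover have "1 * norm (rGamma (?z + 1)) \<le> norm ?z * norm (rGamma (?z + 1))"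
        by (intro mult_right_mono 1) auto
      ultimately have "norm (rGamma (?z + 1)) \<le> norm (rGamma ?z)" by simp
      then show ?thesis using Suc.IH by (simp add: algebra_simps)
    qed
  qed
  with C show ?thesis using that by blast
qed

lemma reg0F1_term_bound:
  assumes "\<And>k. norm (rGamma (b + of_nat k + 1 :: complex)) \<le> C" "norm w \<le> R"
  shows "norm (rGamma (b + of_nat k + 1) / fact k * w ^ k) \<le> C * (R ^ k / fact k)"
proof -
  have "C \<ge> 0" using assms(1)[of 0] norm_ge_zero order_trans by blast
  have "norm (rGamma (b + of_nat k + 1)) * (norm w ^ k / fact k) \<le> C * (R ^ k / fact k)"
    by (intro mult_mono divide_right_mono power_mono assms) (auto simp: \<open>C \<ge> 0\<close>)
  then show ?thesis by (simp add: norm_mult norm_divide norm_power)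
qed

lemma summable_exp_bound: "summable (\<lambda>k. C * (R ^ k / fact k :: real))"
  using summable_exp[of R] by (intro summable_mult) (simp add: field_simps)

lemma suminf_exp_bound: "(\<Sum>k. C * (R ^ k / fact k :: real)) = C * exp R"
  using summable_exp[of R] by (subst suminf_mult) (simp_all add: exp_def field_simps scaleR_conv_of_real)

lemma summable_reg0F1: "summable (\<lambda>k. rGamma (b + of_nat k + 1) / fact k * w ^ k :: complex)"
proof -
  obtain C where C: "C > 0" "\<And>c k. norm c \<le> norm b \<Longrightarrow> norm (rGamma (c + of_nat k + 1 :: complex)) \<le> C"
    using rGamma_shift_bounded by blast
  show ?thesis
    by (rule summable_comparison_test'[OF summable_exp_bound[of C "norm w"], of 0])
       (use reg0F1_term_bound[of b C w "norm w"] C in auto)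
qed

lemma reg0F1_bounded:
  obtains M where "\<And>b w. norm b \<le> B \<Longrightarrow> norm w \<le> R \<Longrightarrow> norm (reg0F1 b w) \<le> M"
proof -
  obtain C where C: "C > 0" "\<And>c k. norm c \<le> B \<Longrightarrow> norm (rGamma (c + of_nat k + 1 :: complex)) \<le> C"
    using rGamma_shift_bounded by blast
  have "norm (reg0F1 b w) \<le> C * exp R" if "norm b \<le> B" "norm w \<le> R" for b w
  proof -
    have *: "norm (rGamma (b + of_nat k + 1) / fact k * w ^ k) \<le> C * (R ^ k / fact k)" for k
      using reg0F1_term_bound[of b C w R] C that by auto
    have sm: "summable (\<lambda>k. norm (rGamma (b + of_nat k + 1) / fact k * w ^ k))"
      by (rule summable_comparison_test'[OF summable_exp_bound[of C R], of 0]) (use * in auto)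
    have "norm (reg0F1 b w) \<le> (\<Sum>k. norm (rGamma (b + of_nat k + 1) / fact k * w ^ k))"
      unfolding reg0F1_def by (rule summable_norm[OF sm])
    also have "\<dots> \<le> (\<Sum>k. C * (R ^ k / fact k))"
      by (rule suminf_le) (rule * sm summable_exp_bound)+
    finally show ?thesis unfolding suminf_exp_bound .
  qed
  then show ?thesis using that by blast
qed

lemma has_field_derivative_reg0F1:
  "(reg0F1 b has_field_derivative reg0F1 (b + 1) w) (at w)"
proof -
  have "((\<lambda>x. \<Sum>k. rGamma (b + of_nat k + 1) / fact k * x ^ k) has_field_derivative
        (\<Sum>k. diffs (\<lambda>k. rGamma (b + of_nat k + 1) / fact k) k * w ^ k)) (at w)"
    by (rule termdiffs_strong[where K = "of_real (norm w + 1)"]) (use summable_reg0F1 in auto)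
  moreover have "diffs (\<lambda>k. rGamma (b + of_nat k + 1) / fact k) k = rGamma (b + 1 + of_nat k + 1) / fact k" for k
    by (simp add: diffs_def add_ac divide_simps del: of_nat_Suc) (simp add: algebra_simps)
  ultimately show ?thesis unfolding reg0F1_def[abs_def] by simp
qed

lemma has_field_derivative_reg0F1_chain [derivative_intros]:
  assumes "(f has_field_derivative f') (at z within A)"
  shows "((\<lambda>z. reg0F1 b (f z)) has_field_derivative reg0F1 (b + 1) (f z) * f') (at z within A)"
  using DERIV_chain2[OF has_field_derivative_reg0F1 assms] .

text \<open>Compare coefficients, using $(b+k)/\Gamma(b+k+1) = 1/\Gamma(b+k)$. Together with the
  derivative formula this encodes the whole differential equation.\<close>

lemma reg0F1_contiguous: "reg0F1 (b - 1) w = b * reg0F1 b w + w * reg0F1 (b + 1) w"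
proof -
  let ?a = "\<lambda>k. rGamma (b + of_nat k + 1) / fact k * w ^ k"
  let ?d = "\<lambda>k. of_nat k * ?a k"
  have d_Suc: "?d (Suc k) = w * (rGamma (b + 1 + of_nat k + 1) / fact k * w ^ k)" for k
    using of_nat_neq_0[of k, where ?'a = complex] by (simp add: divide_simps add_ac)
  have "(\<lambda>k. ?d (Suc k)) sums (w * reg0F1 (b + 1) w)"
    unfolding d_Suc reg0F1_def by (intro sums_mult summable_sums summable_reg0F1)
  then have d: "?d sums (w * reg0F1 (b + 1) w)" by (subst (asm) sums_Suc_iff) simp
  have "(\<lambda>k. b * ?a k + ?d k) sums (b * reg0F1 b w + w * reg0F1 (b + 1) w)"
    unfolding reg0F1_def[of b] by (intro sums_add sums_mult summable_sums summable_reg0F1 d)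
  moreover have "b * ?a k + ?d k = rGamma (b - 1 + of_nat k + 1) / fact k * w ^ k" for k
  proof -
    have "b * ?a k + ?d k = ((b + of_nat k) * rGamma (b + of_nat k + 1)) / fact k * w ^ k"
      by (simp add: algebra_simps add_divide_distrib)
    also have "(b + of_nat k) * rGamma (b + of_nat k + 1) = rGamma (b - 1 + of_nat k + 1)"
      using rGamma_plus1[of "b + of_nat k"] by simp
    finally show ?thesis .
  qed
  ultimately show ?thesis unfolding reg0F1_def[of "b - 1"] by (simp add: sums_iff)
qed

lemma reg0F1_0 [simp]: "reg0F1 b 0 = rGamma (b + 1)"
  unfolding reg0F1_def by (subst powser_zero[where f = "\<lambda>k. rGamma (b + of_nat k + 1) / fact k"]) simp

lemma holomorphic_reg0F1_param: "(\<lambda>b. reg0F1 b w) holomorphic_on UNIV"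
proof (rule holomorphic_uniform_sequence)
  let ?f = "\<lambda>n b. \<Sum>k<n. rGamma (b + of_nat k + 1) / fact k * w ^ k"
  show "?f n holomorphic_on UNIV" for n by (intro holomorphic_intros) auto
  fix x :: complex
  obtain C where C: "C > 0" "\<And>c k. norm c \<le> norm x + 1 \<Longrightarrow> norm (rGamma (c + of_nat k + 1 :: complex)) \<le> C"
    using rGamma_shift_bounded by blast
  have "uniform_limit (cball x 1) ?f (\<lambda>b. reg0F1 b w) sequentially"
    unfolding reg0F1_def
  proof (rule Weierstrass_m_test[OF _ summable_exp_bound[of C "norm w"]])
    fix n b assume "b \<in> cball x 1"
    then have "norm b \<le> norm x + 1" using norm_triangle_ineq4[of x b] norm_triangle_sub[of b x]
      by (simp add: dist_norm norm_minus_commute)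
    then show "norm (rGamma (b + of_nat n + 1) / fact n * w ^ n) \<le> C * (norm w ^ n / fact n)"
      using reg0F1_term_bound[of b C w "norm w"] C by auto
  qed
  then show "\<exists>d>0. cball x d \<subseteq> UNIV \<and> uniform_limit (cball x d) ?f (\<lambda>b. reg0F1 b w) sequentially"
    by (intro exI[of _ 1]) auto
qed auto

text \<open>At a negative integer order the first \<open>n\<close> coefficients vanish, and the
  rest is the series of the opposite order. This is the coincidence $J_{-n} = (-1)^n J_n$ that
  makes the quotient defining $Y_n$ indeterminate.\<close>

lemma reg0F1_minus_nat: "reg0F1 (- of_nat n) w = w ^ n * reg0F1 (of_nat n) w"
proof -
  let ?f = "\<lambda>k. rGamma (- of_nat n + of_nat k + 1) / fact k * w ^ k :: complex"
  have *: "?f (k + n) = w ^ n * (rGamma (of_nat n + of_nat k + 1) / fact k * w ^ k)" for k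
  proof -
    have 1: "rGamma (of_nat k + 1 :: complex) = inverse (fact k)"
      using Gamma_fact[of k, where ?'a = complex] by (simp add: rGamma_inverse_Gamma add.commute)
    have 2: "rGamma (of_nat n + of_nat k + 1 :: complex) = inverse (fact (k + n))"
      using Gamma_fact[of "k + n", where ?'a = complex] by (simp add: rGamma_inverse_Gamma add_ac)
    show ?thesis using 1 2 by (simp add: power_add divide_simps add_ac)
  qed
  have z: "?f k = 0" if "k < n" for k
  proof -
    have "- of_nat n + of_nat k + 1 = (- of_nat (n - Suc k) :: complex)"
      using that by (simp add: of_nat_diff)
    then have "- of_nat n + of_nat k + 1 \<in> (\<int>\<^sub>\<le>\<^sub>0 :: complex set)" by simp
    then show ?thesis by (simp add: rGamma_eq_zero_iff)
  qed
  have "reg0F1 (- of_nat n) w = (\<Sum>k. ?f (k + n)) + (\<Sum>k<n. ?f k)"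
    unfolding reg0F1_def by (rule suminf_split_initial_segment[OF summable_reg0F1])
  also have "(\<Sum>k<n. ?f k) = 0" by (intro sum.neutral) (use z in auto)
  also have "(\<Sum>k. ?f (k + n)) = w ^ n * reg0F1 (of_nat n) w"
    unfolding * reg0F1_def by (intro suminf_mult summable_reg0F1)
  finally show ?thesis by simp
qed

lemma cnj_reg0F1: "cnj (reg0F1 b w) = reg0F1 (cnj b) (cnj w)"
proof -
  have "(\<lambda>k. cnj (rGamma (b + of_nat k + 1) / fact k * w ^ k)) sums cnj (reg0F1 b w)"
    unfolding sums_cnj reg0F1_def by (intro summable_sums summable_reg0F1)
  then show ?thesis by (simp add: reg0F1_def sums_iff cnj_rGamma)
qed

section \<open>Modified Bessel functions in the logarithmic variable\<close>

text \<open>The modified Bessel function $I_b(e^\<tau>)$. With \<open>\<tau>\<close> as variable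
  the branch of the power disappears.\<close>

definition logI :: "complex \<Rightarrow> complex \<Rightarrow> complex" where
  "logI b \<tau> = exp (b * (\<tau> - of_real (ln 2))) * reg0F1 b (exp (2 * \<tau>) / 4)"

lemma exp_log2_shift:
  "exp ((b + 1) * (\<tau> - of_real (ln 2))) = exp (b * (\<tau> - of_real (ln 2))) * exp \<tau> / (2::complex)"
proof -
  have "exp ((b + 1) * (\<tau> - of_real (ln 2))) = exp (b * (\<tau> - of_real (ln 2))) * (exp \<tau> * exp (- of_real (ln 2)))"
    by (simp add: algebra_simps flip: exp_add)
  also have "exp (- of_real (ln 2) :: complex) = 1 / 2"
    by (simp add: exp_minus exp_of_real)
  finally show ?thesis by simp
qed

lemma exp_double_mult: "exp (2 * \<tau>) = exp \<tau> * exp (\<tau>::complex)"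
  by (metis exp_add mult_2)

lemma logI_contiguous: "exp \<tau> * logI (b - 1) \<tau> = 2 * b * logI b \<tau> + exp \<tau> * logI (b + 1) \<tau>"
proof -
  define L e e' r0 r1 where "L = exp \<tau>" and "e = exp (b * (\<tau> - of_real (ln 2)))"
    and "e' = exp ((b - 1) * (\<tau> - of_real (ln 2)))"
    and "r0 = reg0F1 b (exp (2 * \<tau>) / 4)" and "r1 = reg0F1 (b + 1) (exp (2 * \<tau>) / 4)"
  note defs = this
  have 1: "logI (b + 1) \<tau> = e * L / 2 * r1" unfolding logI_def exp_log2_shift defs ..
  have 2: "e = e' * L / 2" using exp_log2_shift[of "b - 1" \<tau>] by (simp add: defs)
  have 3: "logI (b - 1) \<tau> = e' * (b * r0 + L * L / 4 * r1)"
    unfolding logI_def reg0F1_contiguous defs exp_double_mult ..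
  have 4: "logI b \<tau> = e * r0" unfolding logI_def defs ..
  show ?thesis unfolding 1 3 4 2 L_def[symmetric] by (simp add: algebra_simps)
qed

lemma has_field_derivative_logI:
  "(logI b has_field_derivative b * logI b \<tau> + exp \<tau> * logI (b + 1) \<tau>) (at \<tau>)"
proof -
  let ?l = "of_real (ln 2) :: complex"
  have 1: "((\<lambda>\<tau>. exp (b * (\<tau> - ?l))) has_field_derivative exp (b * (\<tau> - ?l)) * b) (at \<tau>)"
    by (rule derivative_eq_intros refl | simp)+
  have 2: "((\<lambda>\<tau>. exp (2 * \<tau>) / 4) has_field_derivative exp (2 * \<tau>) / 2) (at \<tau>)"
    by (rule derivative_eq_intros refl | simp)+
  have "((\<lambda>\<tau>. exp (b * (\<tau> - ?l)) * reg0F1 b (exp (2 * \<tau>) / 4)) has_field_derivative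
      exp (b * (\<tau> - ?l)) * b * reg0F1 b (exp (2 * \<tau>) / 4) +
      reg0F1 (b + 1) (exp (2 * \<tau>) / 4) * (exp (2 * \<tau>) / 2) * exp (b * (\<tau> - ?l))) (at \<tau>)"
    by (intro DERIV_mult 1 has_field_derivative_reg0F1_chain 2)
  moreover have "exp (b * (\<tau> - ?l)) * b * reg0F1 b (exp (2 * \<tau>) / 4) +
      reg0F1 (b + 1) (exp (2 * \<tau>) / 4) * (exp (2 * \<tau>) / 2) * exp (b * (\<tau> - ?l))
      = b * logI b \<tau> + exp \<tau> * logI (b + 1) \<tau>"
  proof -
    define L e r0 r1 where "L = exp \<tau>" and "e = exp (b * (\<tau> - ?l))"
      and "r0 = reg0F1 b (exp (2 * \<tau>) / 4)" and "r1 = reg0F1 (b + 1) (exp (2 * \<tau>) / 4)"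
    note defs = this
    have 1: "logI (b + 1) \<tau> = e * L / 2 * r1" unfolding logI_def exp_log2_shift defs ..
    have 2: "logI b \<tau> = e * r0" unfolding logI_def defs ..
    have 3: "exp (2 * \<tau>) = L * L" unfolding L_def by (rule exp_double_mult)
    show ?thesis unfolding 1 2 r0_def[symmetric] r1_def[symmetric] e_def[symmetric]
      unfolding 3 L_def[symmetric]
      by (simp add: algebra_simps)
  qed
  moreover have "logI b = (\<lambda>\<tau>. exp (b * (\<tau> - ?l)) * reg0F1 b (exp (2 * \<tau>) / 4))"
    by (simp add: fun_eq_iff logI_def)
  ultimately show ?thesis by metis
qed

lemma holomorphic_logI: "logI b holomorphic_on A"
  using has_field_derivative_logI holomorphic_on_subset[of _ UNIV A]
  by (metis UNIV_I field_differentiable_def holomorphic_on_def field_differentiable_at_within)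

lemma deriv_logI: "deriv (logI b) \<tau> = b * logI b \<tau> + exp \<tau> * logI (b + 1) \<tau>"
  by (rule DERIV_imp_deriv[OF has_field_derivative_logI])

lemma deriv2_logI: "deriv (deriv (logI b)) \<tau> = (b\<^sup>2 + exp (2 * \<tau>)) * logI b \<tau>"
proof -
  have "deriv (logI b) = (\<lambda>\<tau>. b * logI b \<tau> + exp \<tau> * logI (b + 1) \<tau>)"
    by (intro ext deriv_logI)
  moreover have "((\<lambda>\<tau>. b * logI b \<tau> + exp \<tau> * logI (b + 1) \<tau>) has_field_derivative
     (b\<^sup>2 + exp (2 * \<tau>)) * logI b \<tau>) (at \<tau>)"
  proof -
    have d: "((\<lambda>\<tau>. b * logI b \<tau> + exp \<tau> * logI (b + 1) \<tau>) has_field_derivative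
       b * (b * logI b \<tau> + exp \<tau> * logI (b + 1) \<tau>) + (exp \<tau> * logI (b + 1) \<tau>
        + ((b + 1) * logI (b + 1) \<tau> + exp \<tau> * logI (b + 1 + 1) \<tau>) * exp \<tau>)) (at \<tau>)"
      by (intro DERIV_add DERIV_cmult DERIV_mult DERIV_exp has_field_derivative_logI)
    have c: "exp \<tau> * logI (b + 1 + 1) \<tau> = exp \<tau> * logI b \<tau> - 2 * (b + 1) * logI (b + 1) \<tau>"
      using logI_contiguous[of \<tau> "b + 1"] by simp
    show ?thesis
      using d unfolding c exp_double_mult by (simp add: algebra_simps power2_eq_square)
  qed
  ultimately show ?thesis by (simp add: DERIV_imp_deriv)
qed

lemma holomorphic_logI_param: "(\<lambda>b. logI b \<tau>) holomorphic_on A"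
proof -
  have "(\<lambda>b. logI b \<tau>) holomorphic_on UNIV"
    unfolding logI_def by (intro holomorphic_intros holomorphic_reg0F1_param)
  then show ?thesis by (rule holomorphic_on_subset) auto
qed

lemma logI_bounded:
  obtains M where "\<And>b \<tau>. norm b \<le> B \<Longrightarrow> norm \<tau> \<le> R \<Longrightarrow> norm (logI b \<tau>) \<le> M"
proof -
  obtain M where M: "\<And>b w. norm b \<le> B \<Longrightarrow> norm w \<le> exp (2 * R) \<Longrightarrow> norm (reg0F1 b w) \<le> M"
    using reg0F1_bounded by blast
  have "norm (logI b \<tau>) \<le> exp (B * (R + 1)) * M" if b: "norm b \<le> B" "norm \<tau> \<le> R" for b \<tau>
  proof -
    have "norm (\<tau> - of_real (ln 2)) \<le> norm \<tau> + norm (of_real (ln 2) :: complex)" by (rule norm_triangle_ineq4)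
    also have "norm (of_real (ln 2) :: complex) \<le> 1" using ln_le_minus_one[of 2] by simp
    finally have "norm (\<tau> - of_real (ln 2)) \<le> R + 1" using b by simp
    then have "norm (b * (\<tau> - of_real (ln 2))) \<le> B * (R + 1)"
      unfolding norm_mult using b by (intro mult_mono) (auto intro: order_trans[OF norm_ge_zero])
    then have 1: "norm (exp (b * (\<tau> - of_real (ln 2)))) \<le> exp (B * (R + 1))"
      by (meson exp_le_cancel_iff norm_exp order_trans)
    have "norm (exp (2 * \<tau>)) \<le> exp (norm (2 * \<tau>))" by (rule norm_exp)
    also have "\<dots> \<le> exp (2 * R)" using b by (simp add: norm_mult)
    finally have "norm (exp (2 * \<tau>)) / 4 \<le> exp (2 * R)" using exp_gt_zero[of "2 * R"] by linarith
    then have "norm (exp (2 * \<tau>) / 4) \<le> exp (2 * R)" by (simp only: norm_divide norm_numeral)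
    then have 2: "norm (reg0F1 b (exp (2 * \<tau>) / 4)) \<le> M" by (intro M b)
    show ?thesis unfolding logI_def norm_mult
      by (intro mult_mono 1 2) auto
  qed
  then show ?thesis using that by blast
qed

lemma logI_minus_nat: "logI (- of_nat n) \<tau> = logI (of_nat n) \<tau>"
proof -
  have "exp (- of_nat n * (\<tau> - of_real (ln 2))) * (exp (2 * \<tau>) / 4) ^ n
      = exp (- of_nat n * (\<tau> - of_real (ln 2))) * exp (of_nat n * (2 * (\<tau> - of_real (ln 2))))"
  proof -
    have "exp (2 * (\<tau> - of_real (ln 2))) = exp (2 * \<tau>) / 4"
    proof -
      have "exp (2 * of_real (ln 2)) = (4::complex)"
        unfolding exp_double_mult by (simp add: exp_of_real)
      then show ?thesis by (simp add: right_diff_distrib exp_diff)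
    qed
    then show ?thesis by (simp only: exp_of_nat_mult)
  qed
  also have "\<dots> = exp (of_nat n * (\<tau> - of_real (ln 2)))"
    unfolding exp_add[symmetric] by (rule arg_cong[of _ _ exp]) (simp add: algebra_simps)
  finally show ?thesis by (simp add: logI_def reg0F1_minus_nat mult.assoc flip: mult.assoc)
qed

text \<open>The left-hand side is constant in \<open>w\<close>, since the contiguous relations
  make its derivative cancel; at \<open>w = 0\<close> it is the reflection formula of the Gamma
  function.\<close>

lemma reg0F1_wronskian:
  "2 * (reg0F1 b w * reg0F1 (- b - 1) w - w * reg0F1 (b + 1) w * reg0F1 (- b) w) =
     - 2 * sin (of_real pi * b) / of_real pi"
proof -
  let ?k = "\<lambda>w. reg0F1 b w * reg0F1 (- b - 1) w - w * reg0F1 (b + 1) w * reg0F1 (- b) w"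
  have "(?k has_field_derivative 0) (at w)" for w
  proof -
    have c1: "w * reg0F1 (b + 1 + 1) w = reg0F1 b w - (b + 1) * reg0F1 (b + 1) w"
      using reg0F1_contiguous[of "b + 1" w] by simp
    have c2: "w * reg0F1 (1 - b) w = reg0F1 (- b - 1) w + b * reg0F1 (- b) w"
      using reg0F1_contiguous[of "- b" w] by simp
    have "(?k has_field_derivative
        reg0F1 (b + 1) w * reg0F1 (- b - 1) w + reg0F1 b w * reg0F1 (- b) w
      - (reg0F1 (b + 1) w * reg0F1 (- b) w + (w * reg0F1 (b + 1 + 1) w) * reg0F1 (- b) w
         + reg0F1 (b + 1) w * (w * reg0F1 (1 - b) w))) (at w)"
      by (rule derivative_eq_intros refl | simp)+ (simp add: algebra_simps)
    also have "(reg0F1 (b + 1) w * reg0F1 (- b - 1) w + reg0F1 b w * reg0F1 (- b) w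
      - (reg0F1 (b + 1) w * reg0F1 (- b) w + (w * reg0F1 (b + 1 + 1) w) * reg0F1 (- b) w
         + reg0F1 (b + 1) w * (w * reg0F1 (1 - b) w))) = 0"
      unfolding c1 c2 by (simp add: algebra_simps)
    finally show ?thesis .
  qed
  then have "\<exists>c. \<forall>w\<in>UNIV. ?k w = c"
    by (intro has_field_derivative_zero_constant) auto
  then obtain c where c: "\<And>w. ?k w = c" by blast
  have "?k w = ?k 0" by (rule trans[OF c c[symmetric]])
  also have "?k 0 = rGamma (- b) * rGamma (1 - (- b))" by (simp add: add.commute)
  also have "\<dots> = - sin (of_real pi * b) / of_real pi" unfolding rGamma_reflection_complex by simp
  finally show ?thesis by simp
qed

text \<open>The left-hand side is the Wronskian of $I_b$ and $I_{-b}$ after derivatives are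
  eliminated by the contiguous relations.\<close>

lemma logI_wronskian:
  "exp \<tau> * (logI b \<tau> * logI (- b - 1) \<tau> - logI (b + 1) \<tau> * logI (- b) \<tau>) =
     - 2 * sin (of_real pi * b) / of_real pi"
proof -
  let ?E = "\<lambda>b. exp (b * (\<tau> - of_real (ln 2)))"
  have 1: "?E (b + 1) = ?E b * exp \<tau> / 2" by (rule exp_log2_shift)
  have 2: "?E (- b) = ?E (- b - 1) * exp \<tau> / 2" using exp_log2_shift[of "- b - 1" \<tau>] by simp
  have 4: "?E b * ?E (- b) = 1" by (simp flip: exp_add)
  have 5: "exp \<tau> * ?E (- b - 1) = 2 * ?E (- b)" unfolding 2 by (simp only: mult_ac) simp
  have "exp \<tau> * (logI b \<tau> * logI (- b - 1) \<tau> - logI (b + 1) \<tau> * logI (- b) \<tau>)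
     = ?E b * (exp \<tau> * ?E (- b - 1)) * (reg0F1 b (exp (2 * \<tau>) / 4) * reg0F1 (- b - 1) (exp (2 * \<tau>) / 4))
     - ?E b * ?E (- b) * (exp \<tau> * exp \<tau> / 2) * (reg0F1 (b + 1) (exp (2 * \<tau>) / 4) * reg0F1 (- b) (exp (2 * \<tau>) / 4))"
    unfolding logI_def 1 by (simp add: algebra_simps)
  also have "\<dots> = 2 * (?E b * ?E (- b)) * (reg0F1 b (exp (2 * \<tau>) / 4) * reg0F1 (- b - 1) (exp (2 * \<tau>) / 4)
     - (exp (2 * \<tau>) / 4) * reg0F1 (b + 1) (exp (2 * \<tau>) / 4) * reg0F1 (- b) (exp (2 * \<tau>) / 4))"
    unfolding 5 exp_double_mult by (simp add: algebra_simps)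
  also have "\<dots> = - 2 * sin (of_real pi * b) / of_real pi"
    unfolding 4 using reg0F1_wronskian[of b "exp (2 * \<tau>) / 4"] by simp
  finally show ?thesis .
qed

section \<open>The integral representation of the recessive solution\<close>

text \<open>Euler's integral after the substitution $y = e^s$.\<close>

lemma has_bochner_integral_Gamma_exp:
  fixes b :: real
  assumes "b > 0"
  shows "has_bochner_integral lborel (\<lambda>s. exp (b * s - exp s)) (Gamma b)"
proof -
  let ?f = "\<lambda>y::real. y powr (b - 1) / exp y"
  have "(?f has_integral Gamma b) {0..}" by (rule Gamma_integral_real[OF assms])
  then have f: "(?f has_integral Gamma b) {0<..}"
    by (subst has_integral_spike_set_eq[where T = "{0..}"]) (auto intro: negligible_subset[of "{0}"])
  have "?f absolutely_integrable_on {0<..}"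
    by (rule nonnegative_absolutely_integrable_1) (use f in \<open>auto simp: integrable_on_def\<close>)
  moreover have "integral {0<..} ?f = Gamma b" using f by (rule integral_unique)
  moreover have "range exp = {0::real<..}"
    by (auto simp: image_iff) (metis exp_ln)
  ultimately have "?f absolutely_integrable_on (exp ` UNIV) \<and> integral (exp ` UNIV) ?f = Gamma b"
    by simp
  then have *: "(\<lambda>x. \<bar>exp x\<bar> * ?f (exp x)) absolutely_integrable_on UNIV \<and>
      integral UNIV (\<lambda>x. \<bar>exp x\<bar> * ?f (exp x)) = Gamma b"
    using has_absolute_integral_change_of_variables_1'[of UNIV exp exp ?f "Gamma b"]
    by (auto simp: DERIV_exp inj_on_def)
  have eq: "\<bar>exp x\<bar> * ?f (exp x) = exp (b * x - exp x)" for x :: real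
  proof -
    have "exp x powr (b - 1) = exp (b * x) / exp x"
      by (simp add: powr_def algebra_simps exp_diff)
    then show ?thesis by (simp add: exp_diff)
  qed
  have "integrable lebesgue (\<lambda>x. exp (b * x - exp x))"
    using * unfolding eq by (simp add: set_integrable_def)
  then have 1: "integrable lborel (\<lambda>x. exp (b * x - exp x))"
    by (subst (asm) integrable_completion) (auto intro!: borel_measurable_continuous_onI continuous_intros)
  with integral_lborel[OF 1] * show ?thesis
    unfolding eq by (simp add: has_bochner_integral_iff)
qed

lemma integrable_exp_cosh:
  fixes b x :: real
  assumes "x > 0"
  shows "integrable lborel (\<lambda>t. exp (b * t - x * cosh t))"
proof -
  have cosh: "cosh t = (exp t + exp (- t)) / 2" for t :: real by (simp add: cosh_field_def)
  have meas: "(\<lambda>t. exp (b * t - x * cosh t)) \<in> borel_measurable lborel" for b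
    by (simp, intro borel_measurable_continuous_onI continuous_intros)
  have pos: "integrable lborel (\<lambda>t. exp (b * t - x * cosh t))" if "b > 0" for b
  proof -
    have "integrable lborel (\<lambda>t. exp (b * (ln (x / 2) + 1 * t) - exp (ln (x / 2) + 1 * t)))"
      by (rule lborel_integrable_real_affine)
         (use has_bochner_integral_Gamma_exp[OF that] in \<open>auto simp: has_bochner_integral_iff\<close>)
    then have "integrable lborel (\<lambda>t. exp (- b * ln (x / 2)) * exp (b * (ln (x / 2) + 1 * t) - exp (ln (x / 2) + 1 * t)))"
      by (rule integrable_mult_right)
    also have "(\<lambda>t. exp (- b * ln (x / 2)) * exp (b * (ln (x / 2) + 1 * t) - exp (ln (x / 2) + 1 * t)))
        = (\<lambda>t. exp (b * t - x / 2 * exp t))"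
    proof (rule ext)
      fix t
      have "exp (ln (x / 2) + 1 * t) = x / 2 * exp t" using assms by (simp add: exp_add)
      then show "exp (- b * ln (x / 2)) * exp (b * (ln (x / 2) + 1 * t) - exp (ln (x / 2) + 1 * t)) = exp (b * t - x / 2 * exp t)"
        by (simp only:) (simp add: algebra_simps flip: exp_add)
    qed
    finally show ?thesis
    proof (rule Bochner_Integration.integrable_bound[OF _ meas], intro AE_I2)
      fix t :: real
      have "x / 2 * exp t \<le> x * cosh t" using assms by (simp add: cosh)
      then show "norm (exp (b * t - x * cosh t)) \<le> norm (exp (b * t - x / 2 * exp t))" by simp
    qed
  qed
  \<comment> \<open>A general order is dominated by a positive one and its mirror image.\<close>
  let ?c = "\<bar>b\<bar> + 1"
  have i1: "integrable lborel (\<lambda>t. exp (?c * t - x * cosh t))" by (rule pos) auto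
  have i2: "integrable lborel (\<lambda>t. exp (?c * (0 + (-1) * t) - x * cosh (0 + (-1) * t)))"
    by (rule lborel_integrable_real_affine[OF i1]) auto
  show ?thesis
  proof (rule Bochner_Integration.integrable_bound[OF Bochner_Integration.integrable_add[OF i1 i2] meas], intro AE_I2)
    fix t :: real
    have "b * t \<le> ?c * t \<or> b * t \<le> ?c * (- t)"
    proof (cases "t \<ge> 0")
      case True
      then have "b * t \<le> ?c * t" by (intro mult_right_mono) auto
      then show ?thesis ..
    next
      case False
      then have "(- b) * (- t) \<le> ?c * (- t)" by (intro mult_right_mono) auto
      then show ?thesis by simp
    qed
    then have "exp (b * t - x * cosh t) \<le> exp (?c * t - x * cosh t) + exp (?c * (- t) - x * cosh t)"
    proof
      assume "b * t \<le> ?c * t"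
      then have "exp (b * t - x * cosh t) \<le> exp (?c * t - x * cosh t)" by simp
      then show ?thesis using exp_ge_zero[of "?c * (- t) - x * cosh t"] by linarith
    next
      assume "b * t \<le> ?c * (- t)"
      then have "exp (b * t - x * cosh t) \<le> exp (?c * (- t) - x * cosh t)" by simp
      then show ?thesis using exp_ge_zero[of "?c * t - x * cosh t"] by linarith
    qed
    then show "norm (exp (b * t - x * cosh t)) \<le>
        norm (exp (?c * t - x * cosh t) + exp (?c * (0 + (-1) * t) - x * cosh (0 + (-1) * t)))"
      by simp
  qed
qed

definition besselK_kernel :: "real \<Rightarrow> complex \<Rightarrow> real \<Rightarrow> complex" where
  "besselK_kernel b \<zeta> t = exp (of_real (b * t) - \<zeta> * of_real (cosh t))"

text \<open>Integrating over the whole real line, rather than half of it with \<open>cosh (b *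
  t)\<close>, makes multiplication by $e^{\pm t}$ a shift of the order. Then every moment that
  occurs is again an integral of this family.\<close>

definition besselK_int :: "real \<Rightarrow> complex \<Rightarrow> complex" where
  "besselK_int b \<zeta> = (LINT t|lborel. besselK_kernel b \<zeta> t) / 2"

lemma norm_besselK_kernel: "norm (besselK_kernel b \<zeta> t) = exp (b * t - Re \<zeta> * cosh t)"
  by (simp add: besselK_kernel_def)

lemma continuous_besselK_kernel: "continuous_on A (besselK_kernel b \<zeta>)"
  unfolding besselK_kernel_def[abs_def] by (intro continuous_intros)

lemma integrable_besselK_kernel: 
  assumes "Re \<zeta> > 0"
  shows "integrable lborel (besselK_kernel b \<zeta>)"
proof (rule Bochner_Integration.integrable_bound[OF integrable_exp_cosh[OF assms, of b]])
  show "besselK_kernel b \<zeta> \<in> borel_measurable lborel"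
    using borel_measurable_continuous_onI[OF continuous_besselK_kernel] by simp
qed (simp add: norm_besselK_kernel)

lemma besselK_kernel_shift:
  "of_real (exp t) * besselK_kernel b \<zeta> t = besselK_kernel (b + 1) \<zeta> t"
  "of_real (exp (- t)) * besselK_kernel b \<zeta> t = besselK_kernel (b - 1) \<zeta> t"
  by (simp_all add: besselK_kernel_def exp_of_real[symmetric] algebra_simps flip: exp_add)

lemma besselK_int_minus: "besselK_int (- b) \<zeta> = besselK_int b \<zeta>"
  unfolding besselK_int_def
  by (subst lborel_integral_real_affine[where c = "-1" and t = 0]) (simp_all add: besselK_kernel_def[abs_def])

lemma exp_remainder_le: "norm (exp u - 1 - u :: complex) \<le> (norm u)\<^sup>2 * exp (norm u)"
proof -
  have "norm (exp u - (\<Sum>i\<le>1. u ^ i / fact i)) \<le> exp \<bar>Re u\<bar> * (norm u) ^ Suc 1 / fact 1"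
    by (rule Taylor_exp)
  also have "\<dots> \<le> exp (norm u) * (norm u) ^ Suc 1 / fact 1"
    using abs_Re_le_cmod by (intro divide_right_mono mult_right_mono) auto
  finally show ?thesis by (simp add: power2_eq_square algebra_simps)
qed

lemma has_field_derivativeI_quadratic:
  fixes f :: "complex \<Rightarrow> complex"
  assumes "\<delta> > 0" "\<And>h. norm h \<le> \<delta> \<Longrightarrow> norm (f (z + h) - f z - h * D) \<le> M * (norm h)\<^sup>2"
  shows "(f has_field_derivative D) (at z)"
  unfolding DERIV_def
proof (rule LIM_zero_cancel, rule Lim_null_comparison)
  have "\<forall>\<^sub>F h in at (0::complex). norm h < \<delta> \<and> h \<noteq> 0"
    using eventually_at_ball[OF assms(1), of 0 UNIV] eventually_neq_at_within[of 0 0 UNIV]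
    by eventually_elim (auto simp: dist_norm)
  then show "\<forall>\<^sub>F h in at 0. norm ((f (z + h) - f z) / h - D) \<le> M * norm h"
  proof eventually_elim
    case (elim h)
    have "(f (z + h) - f z) / h - D = (f (z + h) - f z - h * D) / h"
      using elim by (simp add: field_simps)
    then show ?case using assms(2)[of h] elim
      by (simp add: norm_divide divide_le_eq power2_eq_square mult.assoc)
  qed
  show "((\<lambda>h. M * norm h) \<longlongrightarrow> 0) (at (0::complex))"
    by (rule tendsto_eq_intros refl | simp)+
qed

lemma cosh_square_le: "(cosh t)\<^sup>2 \<le> exp (2 * t) + exp (- (2 * t :: real))"
proof -
  have "exp (2 * t) = exp t * exp t" "exp (- (2 * t)) = exp (- t) * exp (- t)" "exp t * exp (- t) = 1"
    by (simp_all flip: exp_add)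
  moreover have "(exp t - exp (- t))\<^sup>2 \<ge> 0" by simp
  ultimately show ?thesis by (simp add: cosh_field_def power2_eq_square field_simps)
qed

text \<open>Differentiation under the integral sign, with an explicit majorant \<open>G\<close> of
  the second-order remainder of the exponential.\<close>

lemma has_field_derivative_besselK_int:
  assumes "Re \<zeta> > 0"
  shows "(besselK_int b has_field_derivative - (besselK_int (b + 1) \<zeta> + besselK_int (b - 1) \<zeta>) / 2) (at \<zeta>)"
proof -
  define x where "x = Re \<zeta>"
  define G where "G = (\<lambda>t. exp ((b + 2) * t - x / 2 * cosh t) + exp ((b - 2) * t - x / 2 * cosh t))"
  have "x > 0" using assms by (simp add: x_def)
  have iG: "integrable lborel G"
    unfolding G_def using \<open>x > 0\<close> by (intro Bochner_Integration.integrable_add integrable_exp_cosh) auto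
  let ?D = "- (besselK_int (b + 1) \<zeta> + besselK_int (b - 1) \<zeta>) / 2"
  show ?thesis
  proof (rule has_field_derivativeI_quadratic[where \<delta> = "x / 2" and M = "(LINT t|lborel. G t) / 2"])
    show "x / 2 > 0" using \<open>x > 0\<close> by simp
    fix h :: complex assume h: "norm h \<le> x / 2"
    have x': "Re (\<zeta> + h) > 0"
      using abs_Re_le_cmod[of h] h \<open>x > 0\<close> by (simp add: x_def)
    let ?k = besselK_kernel
    let ?r = "\<lambda>t. ?k b (\<zeta> + h) t - ?k b \<zeta> t - h * (- (?k (b + 1) \<zeta> t + ?k (b - 1) \<zeta> t) / 2)"
    note int = integrable_besselK_kernel[OF assms] integrable_besselK_kernel[OF x']
    have eq: "besselK_int b (\<zeta> + h) - besselK_int b \<zeta> - h * ?D = (LINT t|lborel. ?r t) / 2"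
      unfolding besselK_int_def using int
      by (simp add: Bochner_Integration.integral_diff Bochner_Integration.integral_add)
    have le: "norm (LINT t|lborel. ?r t) \<le> (LINT t|lborel. (norm h)\<^sup>2 * G t)"
    proof (rule Bochner_Integration.integral_norm_bound_integral)
      show "integrable lborel ?r" using int
        by (intro Bochner_Integration.integrable_diff Bochner_Integration.integrable_add
             integrable_mult_right integrable_divide Bochner_Integration.integrable_minus) auto
      show "integrable lborel (\<lambda>t. (norm h)\<^sup>2 * G t)" using iG by simp
      fix t :: real
      let ?c = "cosh t"
      have 1: "?k (b + 1) \<zeta> t + ?k (b - 1) \<zeta> t = 2 * of_real ?c * ?k b \<zeta> t"
        unfolding besselK_kernel_shift[symmetric] cosh_field_def by (simp add: field_simps)
      have "?k b (\<zeta> + h) t = ?k b \<zeta> t * exp (- h * of_real ?c)"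
        unfolding besselK_kernel_def by (simp add: algebra_simps flip: exp_add)
      then have "?r t = ?k b \<zeta> t * (exp (- h * of_real ?c) - 1 - (- h * of_real ?c))"
        unfolding 1 by (simp add: algebra_simps)
      then have "norm (?r t) = exp (b * t - x * ?c) * norm (exp (- h * of_real ?c) - 1 - (- h * of_real ?c))"
        by (simp only: norm_mult norm_besselK_kernel x_def)
      also have "\<dots> \<le> exp (b * t - x * ?c) * ((norm (- h * of_real ?c))\<^sup>2 * exp (norm (- h * of_real ?c)))"
        by (intro mult_left_mono exp_remainder_le) auto
      also have "norm (- h * of_real ?c) = norm h * ?c" by (simp add: norm_mult)
      also have "exp (b * t - x * ?c) * ((norm h * ?c)\<^sup>2 * exp (norm h * ?c))
               = (norm h)\<^sup>2 * (?c\<^sup>2 * exp (b * t - (x - norm h) * ?c))"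
        by (simp add: power_mult_distrib algebra_simps flip: exp_add)
      also have "\<dots> \<le> (norm h)\<^sup>2 * ((exp (2 * t) + exp (- (2 * t))) * exp (b * t - x / 2 * ?c))"
      proof (intro mult_left_mono mult_mono cosh_square_le)
        have "x / 2 * ?c \<le> (x - norm h) * ?c" using h by (intro mult_right_mono) auto
        then show "exp (b * t - (x - norm h) * ?c) \<le> exp (b * t - x / 2 * ?c)" by simp
      qed auto
      also have "\<dots> = (norm h)\<^sup>2 * G t"
        unfolding G_def by (simp add: algebra_simps flip: exp_add)
      finally show "norm (?r t) \<le> (norm h)\<^sup>2 * G t" .
    qed
    have "(LINT t|lborel. (norm h)\<^sup>2 * G t) = (LINT t|lborel. G t) * (norm h)\<^sup>2"
      by simp
    then show "norm (besselK_int b (\<zeta> + h) - besselK_int b \<zeta> - h * ?D)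
         \<le> (LINT t|lborel. G t) / 2 * (norm h)\<^sup>2"
      unfolding eq norm_divide using le by (simp add: mult.commute)
  qed
qed

text \<open>The integral of the \<open>t\<close>-derivative of the kernel vanishes.\<close>

lemma besselK_int_contiguous:
  assumes "Re \<zeta> > 0"
  shows "\<zeta> * besselK_int (b + 1) \<zeta> = 2 * of_real b * besselK_int b \<zeta> + \<zeta> * besselK_int (b - 1) \<zeta>"
proof -
  let ?k = besselK_kernel
  let ?F' = "\<lambda>t. of_real b * ?k b \<zeta> t - \<zeta> * ((?k (b + 1) \<zeta> t - ?k (b - 1) \<zeta> t) / 2)"
  have int: "integrable lborel (?k c \<zeta>)" for c by (rule integrable_besselK_kernel[OF assms])
  have intF: "integrable lborel ?F'"
    by (intro Bochner_Integration.integrable_diff integrable_mult_right integrable_divide int)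
  have der: "(?k b \<zeta> has_vector_derivative ?F' t) (at t)" for t
  proof -
    have "((\<lambda>t. of_real (b * t) - \<zeta> * of_real (cosh t)) has_vector_derivative
           of_real b - \<zeta> * of_real (sinh t)) (at t)"
      by (auto intro!: derivative_eq_intros has_vector_derivative_of_real)
    then have "(exp \<circ> (\<lambda>t. of_real (b * t) - \<zeta> * of_real (cosh t)) has_vector_derivative
           (of_real b - \<zeta> * of_real (sinh t)) * exp (of_real (b * t) - \<zeta> * of_real (cosh t))) (at t)"
      by (rule field_vector_diff_chain_at) (rule DERIV_exp)
    moreover have "?k (b + 1) \<zeta> t - ?k (b - 1) \<zeta> t = 2 * of_real (sinh t) * ?k b \<zeta> t"
      unfolding besselK_kernel_shift[symmetric] sinh_field_def by (simp add: field_simps)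
    ultimately show ?thesis
      by (simp add: besselK_kernel_def[abs_def] o_def algebra_simps)
  qed
  have lim0: "(\<lambda>t. norm (?k b \<zeta> t)) = (\<lambda>t. exp (b * t - Re \<zeta> * ((exp t + exp (- t)) / 2)))"
    by (simp add: fun_eq_iff norm_besselK_kernel cosh_field_def)
  have "((\<lambda>t. norm (?k b \<zeta> t)) \<longlongrightarrow> 0) at_top"
    unfolding lim0 using assms by real_asymp
  then have top: "(?k b \<zeta> \<longlongrightarrow> 0) at_top" by (rule tendsto_norm_zero_cancel)
  have "((\<lambda>t. norm (?k b \<zeta> t)) \<longlongrightarrow> 0) at_bot"
    unfolding lim0 using assms by real_asymp
  then have bot: "(?k b \<zeta> \<longlongrightarrow> 0) at_bot" by (rule tendsto_norm_zero_cancel)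
  have "(LBINT t=-\<infinity>..\<infinity>. ?F' t) = 0 - 0"
  proof (rule interval_integral_FTC_integrable)
    show "isCont ?F' t" for t
      using continuous_besselK_kernel[of UNIV] 
      by (intro continuous_intros) (auto simp: continuous_on_eq_continuous_at)
    show "((?k b \<zeta> \<circ> real_of_ereal) \<longlongrightarrow> 0) (at_right (-\<infinity>))"
      using bot by (simp add: ereal_tendsto_simps)
    show "((?k b \<zeta> \<circ> real_of_ereal) \<longlongrightarrow> 0) (at_left \<infinity>)"
      using top by (simp add: ereal_tendsto_simps)
  qed (use der intF in \<open>auto simp: set_integrable_def\<close>)
  then have "(LINT t|lborel. ?F' t) = 0"
    by (simp add: interval_lebesgue_integral_def set_lebesgue_integral_def)
  also have "(LINT t|lborel. ?F' t) = of_real b * (2 * besselK_int b \<zeta>) - \<zeta> * (besselK_int (b + 1) \<zeta> - besselK_int (b - 1) \<zeta>)"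
    unfolding besselK_int_def using int by (simp add: Bochner_Integration.integral_diff diff_divide_distrib)
  finally show ?thesis by (simp add: algebra_simps)
qed

text \<open>Since $\cosh t \ge 1$, the integral decays exponentially in \<open>Re \<zeta>\<close>,
  uniformly in \<open>Im \<zeta>\<close>.\<close>

lemma norm_besselK_int_le:
  assumes "Re \<zeta> \<ge> 1"
  shows "norm (besselK_int b \<zeta>) \<le> exp (1 - Re \<zeta>) * (LINT t|lborel. exp (b * t - cosh t))"
proof -
  have "norm (LINT t|lborel. besselK_kernel b \<zeta> t) \<le> (LINT t|lborel. exp (1 - Re \<zeta>) * exp (b * t - cosh t))"
  proof (rule Bochner_Integration.integral_norm_bound_integral)
    show "integrable lborel (besselK_kernel b \<zeta>)" by (rule integrable_besselK_kernel) (use assms in auto)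
    show "integrable lborel (\<lambda>t. exp (1 - Re \<zeta>) * exp (b * t - cosh t))"
      using integrable_exp_cosh[of 1 b] by simp
    fix t :: real
    have "(Re \<zeta> - 1) * 1 \<le> (Re \<zeta> - 1) * cosh t"
      using assms by (intro mult_left_mono cosh_real_ge_1) auto
    then show "norm (besselK_kernel b \<zeta> t) \<le> exp (1 - Re \<zeta>) * exp (b * t - cosh t)"
      unfolding norm_besselK_kernel exp_add[symmetric] by (simp add: algebra_simps)
  qed
  moreover have "(LINT t|lborel. exp (b * t - cosh t)) \<ge> 0" by simp
  then have "exp (1 - Re \<zeta>) * (LINT t|lborel. exp (b * t - cosh t)) \<ge> 0" by (intro mult_nonneg_nonneg) auto
  ultimately have "norm (LINT t|lborel. besselK_kernel b \<zeta> t) / 2 \<le> exp (1 - Re \<zeta>) * (LINT t|lborel. exp (b * t - cosh t))"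
    unfolding integral_mult_right_zero by linarith
  then show ?thesis unfolding besselK_int_def norm_divide by simp
qed

lemma tendsto_besselK_int_order:
  assumes "Re \<zeta> > 0" "c \<longlonglongrightarrow> b" "\<And>k. \<bar>c k - b\<bar> \<le> 1"
  shows "(\<lambda>k. besselK_int (c k) \<zeta>) \<longlonglongrightarrow> besselK_int b \<zeta>"
proof -
  have "(\<lambda>k. LINT t|lborel. besselK_kernel (c k) \<zeta> t) \<longlonglongrightarrow> (LINT t|lborel. besselK_kernel b \<zeta> t)"
  proof (rule integral_dominated_convergence)
    let ?w = "\<lambda>t. exp ((b + 1) * t - Re \<zeta> * cosh t) + exp ((b - 1) * t - Re \<zeta> * cosh t)"
    show "integrable lborel ?w"
      using assms(1) by (intro Bochner_Integration.integrable_add integrable_exp_cosh)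
    show "besselK_kernel b \<zeta> \<in> borel_measurable lborel" "besselK_kernel (c k) \<zeta> \<in> borel_measurable lborel" for k
      using integrable_besselK_kernel[OF assms(1)] by (auto intro: borel_measurable_integrable)
    show "AE t in lborel. (\<lambda>k. besselK_kernel (c k) \<zeta> t) \<longlonglongrightarrow> besselK_kernel b \<zeta> t"
      unfolding besselK_kernel_def by (intro AE_I2 tendsto_intros assms(2))
    show "AE t in lborel. norm (besselK_kernel (c k) \<zeta> t) \<le> ?w t" for k
    proof (intro AE_I2)
      fix t :: real
      have "c k * t \<le> (b + 1) * t \<or> c k * t \<le> (b - 1) * t"
        using assms(3)[of k] mult_right_mono[of "c k" "b + 1" t] mult_right_mono_neg[of "b - 1" "c k" t]
        by (cases "t \<ge> 0") (auto simp: abs_le_iff)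
      then have "exp (c k * t - Re \<zeta> * cosh t) \<le> exp ((b + 1) * t - Re \<zeta> * cosh t) \<or>
         exp (c k * t - Re \<zeta> * cosh t) \<le> exp ((b - 1) * t - Re \<zeta> * cosh t)" by auto
      then show "norm (besselK_kernel (c k) \<zeta> t) \<le> ?w t"
        unfolding norm_besselK_kernel 
        using exp_ge_zero[of "(b + 1) * t - Re \<zeta> * cosh t"] exp_ge_zero[of "(b - 1) * t - Re \<zeta> * cosh t"]
        by linarith
    qed
  qed
  then show ?thesis unfolding besselK_int_def by (intro tendsto_intros) auto
qed

text \<open>The translation $t = s - \ln(x/2)$ moves the singular behaviour at $x = 0$ into the
  factor $(x/2)^b$.\<close>

lemma besselK_int_scaled:
  assumes "x > 0"
  shows "of_real ((x / 2) powr b) * besselK_int b (of_real x) =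
    of_real ((LINT s|lborel. exp (b * s - exp s - x\<^sup>2 / 4 * exp (- s))) / 2)"
proof -
  define l where "l = ln (x / 2)"
  have el: "exp l = x / 2" "exp (- l) = 2 / x" using assms by (simp_all add: l_def exp_minus)
  have "(LINT t|lborel. besselK_kernel b (of_real x) t) = of_real (LINT t|lborel. exp (b * t - x * cosh t))"
    unfolding integral_complex_of_real[symmetric] besselK_kernel_def
    by (intro Bochner_Integration.integral_cong) (simp_all add: exp_of_real[symmetric])
  also have "(LINT t|lborel. exp (b * t - x * cosh t)) = (LINT s|lborel. exp (b * (- l + 1 * s) - x * cosh (- l + 1 * s)))"
    by (subst lborel_integral_real_affine[where c = 1 and t = "- l"]) simp_all
  also have "\<dots> = (LINT s|lborel. exp (- b * l) * exp (b * s - exp s - x\<^sup>2 / 4 * exp (- s)))"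
  proof (intro Bochner_Integration.integral_cong refl)
    fix s :: real
    have "x * cosh (- l + 1 * s) = x / 2 * (exp (- l) * exp s + exp l * exp (- s))"
      by (simp add: cosh_field_def flip: exp_add)
    also have "\<dots> = exp s + x\<^sup>2 / 4 * exp (- s)"
      unfolding el using assms by (simp add: field_simps power2_eq_square)
    finally show "exp (b * (- l + 1 * s) - x * cosh (- l + 1 * s)) = exp (- b * l) * exp (b * s - exp s - x\<^sup>2 / 4 * exp (- s))"
      by (simp add: algebra_simps flip: exp_add)
  qed
  also have "\<dots> = exp (- b * l) * (LINT s|lborel. exp (b * s - exp s - x\<^sup>2 / 4 * exp (- s)))" by simp
  finally have "besselK_int b (of_real x) = of_real (exp (- b * l) * (LINT s|lborel. exp (b * s - exp s - x\<^sup>2 / 4 * exp (- s))) / 2)"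
    unfolding besselK_int_def by simp
  moreover have "(x / 2) powr b * exp (- b * l) = 1"
    using assms by (simp add: powr_def l_def flip: exp_add)
  ultimately show ?thesis by (simp only: of_real_mult[symmetric] times_divide_eq_right mult.assoc[symmetric] mult_1)
qed

text \<open>Squeeze the integrand by $1 - y \le e^{-y} \le 1$; the assumption \<open>b > 1\<close>
  keeps the Gamma integral of the lower bound convergent.\<close>

lemma tendsto_besselK_int_0:
  assumes "b > 1"
  shows "((\<lambda>x. of_real ((x / 2) powr b) * besselK_int b (of_real x)) \<longlongrightarrow> of_real (Gamma b / 2)) (at_right 0)"
proof -
  let ?J = "\<lambda>x. LINT s|lborel. exp (b * s - exp s - x\<^sup>2 / 4 * exp (- s))"
  have g: "integrable lborel (\<lambda>s. exp (c * s - exp s))" "(LINT s|lborel. exp (c * s - exp s)) = Gamma c" if "c > 0" for c :: real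
    using has_bochner_integral_Gamma_exp[OF that] by (auto simp: has_bochner_integral_iff)
  have bounds: "Gamma b - x\<^sup>2 / 4 * Gamma (b - 1) \<le> ?J x \<and> ?J x \<le> Gamma b" for x
  proof -
    have iJ: "integrable lborel (\<lambda>s. exp (b * s - exp s - x\<^sup>2 / 4 * exp (- s)))"
      by (rule Bochner_Integration.integrable_bound[OF g(1)[of b]])
         (use assms in \<open>auto intro!: borel_measurable_continuous_onI continuous_intros\<close>)
    have "?J x \<le> (LINT s|lborel. exp (b * s - exp s))"
      by (rule integral_mono[OF iJ g(1)]) (use assms in auto)
    moreover have "(LINT s|lborel. exp (b * s - exp s) - x\<^sup>2 / 4 * exp ((b - 1) * s - exp s)) \<le> ?J x"
    proof (rule integral_mono[OF _ iJ])
      show "integrable lborel (\<lambda>s. exp (b * s - exp s) - x\<^sup>2 / 4 * exp ((b - 1) * s - exp s))"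
        using assms by (intro Bochner_Integration.integrable_diff integrable_mult_right g) auto
      fix s :: real
      have *: "exp (b * s - exp s) * (1 + (- (x\<^sup>2 / 4 * exp (- s)))) \<le> exp (b * s - exp s) * exp (- (x\<^sup>2 / 4 * exp (- s)))"
        by (intro mult_left_mono exp_ge_add_one_self) auto
      show "exp (b * s - exp s) - x\<^sup>2 / 4 * exp ((b - 1) * s - exp s) \<le> exp (b * s - exp s - x\<^sup>2 / 4 * exp (- s))"
      proof -
        have "exp ((b - 1) * s - exp s) = exp (b * s - exp s) * exp (- s)"
          and "exp (b * s - exp s - x\<^sup>2 / 4 * exp (- s)) = exp (b * s - exp s) * exp (- (x\<^sup>2 / 4 * exp (- s)))"
          by (simp_all add: algebra_simps flip: exp_add)
        then show ?thesis using * by (simp only:) (simp add: algebra_simps)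
      qed
    qed
    moreover have "(LINT s|lborel. exp (b * s - exp s) - x\<^sup>2 / 4 * exp ((b - 1) * s - exp s)) = Gamma b - x\<^sup>2 / 4 * Gamma (b - 1)"
      using assms g[of b] g[of "b - 1"] by (simp add: Bochner_Integration.integral_diff)
    ultimately show ?thesis using g(2)[of b] assms by auto
  qed
  have "(?J \<longlongrightarrow> Gamma b) (at_right 0)"
  proof (rule tendsto_sandwich[where f = "\<lambda>x. Gamma b - x\<^sup>2 / 4 * Gamma (b - 1)" and h = "\<lambda>_. Gamma b"])
    show "((\<lambda>x. Gamma b - x\<^sup>2 / 4 * Gamma (b - 1)) \<longlongrightarrow> Gamma b) (at_right 0)"
      by (rule tendsto_eq_intros refl | simp)+
  qed (use bounds in auto)
  then have "((\<lambda>x. complex_of_real (?J x / 2)) \<longlongrightarrow> of_real (Gamma b / 2)) (at_right 0)"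
    by (intro tendsto_intros) auto
  moreover have "\<forall>\<^sub>F x in at_right 0. complex_of_real (?J x / 2) = of_real ((x / 2) powr b) * besselK_int b (of_real x)"
    using eventually_at_right_less[of 0] by eventually_elim (use besselK_int_scaled[of _ b] in simp)
  ultimately show ?thesis by (rule Lim_transform_eventually)
qed

section \<open>The connection formula\<close>

text \<open>The image of the upper half plane under the logarithmic coordinate. There \<open>exp
  \<tau>\<close> has positive real part, so the integral converges.\<close>

definition right_strip :: "complex set" where
  "right_strip = {\<tau>. \<bar>Im \<tau>\<bar> < pi / 2}"

lemma right_strip_eq: "right_strip = {\<tau>. Im \<tau> < pi / 2} \<inter> {\<tau>. Im \<tau> > - (pi / 2)}"
  by (auto simp: right_strip_def)

lemma convex_right_strip: "convex right_strip"
  unfolding right_strip_eq by (intro convex_Int convex_halfspace_Im_lt convex_halfspace_Im_gt)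

lemma open_right_strip: "open right_strip"
  unfolding right_strip_eq by (intro open_Int open_halfspace_Im_lt open_halfspace_Im_gt)

lemma Re_exp_right_strip: "\<tau> \<in> right_strip \<Longrightarrow> Re (exp \<tau>) > 0"
  unfolding right_strip_def Re_exp by (auto intro!: mult_pos_pos cos_gt_zero_pi)

lemma of_real_right_strip [simp]: "of_real t \<in> right_strip"
  by (simp add: right_strip_def)

lemma has_field_derivative_besselK_exp:
  assumes "\<tau> \<in> right_strip"
  shows "((\<lambda>\<tau>. besselK_int b (exp \<tau>)) has_field_derivative
            of_real b * besselK_int b (exp \<tau>) - exp \<tau> * besselK_int (b + 1) (exp \<tau>)) (at \<tau>)"
    and "((\<lambda>\<tau>. besselK_int b (exp \<tau>)) has_field_derivative
            - of_real b * besselK_int b (exp \<tau>) - exp \<tau> * besselK_int (b - 1) (exp \<tau>)) (at \<tau>)"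
proof -
  note r = Re_exp_right_strip[OF assms]
  have d: "((\<lambda>\<tau>. besselK_int b (exp \<tau>)) has_field_derivative
      - (besselK_int (b + 1) (exp \<tau>) + besselK_int (b - 1) (exp \<tau>)) / 2 * exp \<tau>) (at \<tau>)"
    by (rule DERIV_chain2[OF has_field_derivative_besselK_int[OF r] DERIV_exp])
  have c: "exp \<tau> * besselK_int (b + 1) (exp \<tau>) =
      2 * of_real b * besselK_int b (exp \<tau>) + exp \<tau> * besselK_int (b - 1) (exp \<tau>)"
    by (rule besselK_int_contiguous[OF r])
  have 1: "- (besselK_int (b + 1) (exp \<tau>) + besselK_int (b - 1) (exp \<tau>)) / 2 * exp \<tau>
        = of_real b * besselK_int b (exp \<tau>) - exp \<tau> * besselK_int (b + 1) (exp \<tau>)"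
    using c by (simp add: field_simps) 
  have 2: "of_real b * besselK_int b (exp \<tau>) - exp \<tau> * besselK_int (b + 1) (exp \<tau>)
        = - of_real b * besselK_int b (exp \<tau>) - exp \<tau> * besselK_int (b - 1) (exp \<tau>)"
    unfolding c by (simp add: algebra_simps)
  show "((\<lambda>\<tau>. besselK_int b (exp \<tau>)) has_field_derivative
            of_real b * besselK_int b (exp \<tau>) - exp \<tau> * besselK_int (b + 1) (exp \<tau>)) (at \<tau>)"
    using d unfolding 1 .
  then show "((\<lambda>\<tau>. besselK_int b (exp \<tau>)) has_field_derivative
            - of_real b * besselK_int b (exp \<tau>) - exp \<tau> * besselK_int (b - 1) (exp \<tau>)) (at \<tau>)"
    unfolding 2 .
qed

text \<open>The Wronskian of $K_b$ and $I_b$ after derivatives are eliminated by the contiguous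
  relations. In this form it can be compared for different orders \<open>b\<close>.\<close>

definition IK_cross :: "real \<Rightarrow> complex \<Rightarrow> complex" where
  "IK_cross b \<tau> = exp \<tau> * (besselK_int b (exp \<tau>) * logI (of_real (b + 1)) \<tau>
                          + besselK_int (b + 1) (exp \<tau>) * logI (of_real b) \<tau>)"

lemma has_field_derivative_logI_down:
  "(logI b has_field_derivative - b * logI b \<tau> + exp \<tau> * logI (b - 1) \<tau>) (at \<tau>)"
  using has_field_derivative_logI[of b \<tau>] logI_contiguous[of \<tau> b] by (simp add: algebra_simps)

lemma has_field_derivative_IK_cross:
  assumes "\<tau> \<in> right_strip"
  shows "(IK_cross b has_field_derivative 0) (at \<tau>)"
proof -
  let ?h = "\<lambda>b. besselK_int b (exp \<tau>)" and ?I = "\<lambda>b. logI (of_real b) \<tau>"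
  have h0: "((\<lambda>\<tau>. besselK_int b (exp \<tau>)) has_field_derivative of_real b * ?h b - exp \<tau> * ?h (b + 1)) (at \<tau>)"
    by (rule has_field_derivative_besselK_exp(1)[OF assms])
  have h1: "((\<lambda>\<tau>. besselK_int (b + 1) (exp \<tau>)) has_field_derivative - of_real (b + 1) * ?h (b + 1) - exp \<tau> * ?h b) (at \<tau>)"
    using has_field_derivative_besselK_exp(2)[OF assms, of "b + 1"] by simp
  have I0: "(logI (of_real b) has_field_derivative of_real b * ?I b + exp \<tau> * ?I (b + 1)) (at \<tau>)"
    using has_field_derivative_logI[of "of_real b" \<tau>] by simp
  have I1: "(logI (of_real (b + 1)) has_field_derivative - of_real (b + 1) * ?I (b + 1) + exp \<tau> * ?I b) (at \<tau>)"
    using has_field_derivative_logI_down[of "of_real (b + 1)" \<tau>] by simp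
  have "(IK_cross b has_field_derivative
     exp \<tau> * (?h b * ?I (b + 1) + ?h (b + 1) * ?I b) +
     ((of_real b * ?h b - exp \<tau> * ?h (b + 1)) * ?I (b + 1) + (- of_real (b + 1) * ?I (b + 1) + exp \<tau> * ?I b) * ?h b
      + ((- of_real (b + 1) * ?h (b + 1) - exp \<tau> * ?h b) * ?I b + (of_real b * ?I b + exp \<tau> * ?I (b + 1)) * ?h (b + 1))) * exp \<tau>)
     (at \<tau>)"
    unfolding IK_cross_def[abs_def]
    by (intro DERIV_mult DERIV_add DERIV_exp h0 h1 I0 I1)
  then show ?thesis by (simp add: algebra_simps)
qed

text \<open>Both families satisfy the same three-term relation up to sign, so the cross product
  has period 1 in the order. This transports the value found for large orders to all real orders,
  in particular to negative ones.\<close>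

lemma IK_cross_periodic:
  assumes "\<tau> \<in> right_strip"
  shows "IK_cross (b - 1) \<tau> = IK_cross b \<tau>"
proof -
  define e where "e = exp \<tau>"
  have c: "e * besselK_int (b + 1) e = 2 * of_real b * besselK_int b e + e * besselK_int (b - 1) e"
    unfolding e_def by (rule besselK_int_contiguous[OF Re_exp_right_strip[OF assms]])
  have d: "e * logI (of_real (b - 1)) \<tau> = 2 * of_real b * logI (of_real b) \<tau> + e * logI (of_real (b + 1)) \<tau>"
    using logI_contiguous[of \<tau> "of_real b"] by (simp add: e_def)
  have "IK_cross (b - 1) \<tau> = (e * besselK_int (b - 1) e) * logI (of_real b) \<tau> + besselK_int b e * (e * logI (of_real (b - 1)) \<tau>)"
    unfolding IK_cross_def e_def[symmetric] by (simp add: algebra_simps)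
  also have "\<dots> = (e * besselK_int (b + 1) e) * logI (of_real b) \<tau> + besselK_int b e * (e * logI (of_real (b + 1)) \<tau>)"
    unfolding c d by (simp add: algebra_simps)
  also have "\<dots> = IK_cross b \<tau>"
    unfolding IK_cross_def e_def[symmetric] by (simp add: algebra_simps)
  finally show ?thesis .
qed

lemma logI_of_real_ln:
  assumes "x > 0"
  shows "logI (of_real b) (of_real (ln x)) = of_real ((x / 2) powr b) * reg0F1 (of_real b) (of_real (x\<^sup>2 / 4))"
proof -
  have "exp (of_real b * (of_real (ln x) - of_real (ln 2))) = complex_of_real ((x / 2) powr b)"
    using assms by (simp add: powr_def ln_div exp_of_real[symmetric] mult.commute)
  moreover have "exp (2 * complex_of_real (ln x)) = of_real (x\<^sup>2)"
    unfolding exp_double_mult using assms by (simp add: exp_of_real power2_eq_square)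
  ultimately show ?thesis unfolding logI_def by simp
qed

text \<open>As $e^\<tau> = x \to 0$ the first product vanishes and the second one tends to
  $\Gamma(b+1) \cdot 1/\Gamma(b+1)$.\<close>

lemma tendsto_IK_cross:
  assumes "b > 1"
  shows "((\<lambda>x. IK_cross b (of_real (ln x))) \<longlongrightarrow> 1) (at_right 0)"
proof -
  let ?S = "\<lambda>b x. reg0F1 (of_real b) (of_real (x\<^sup>2 / 4))"
  let ?g = "\<lambda>b x. of_real ((x / 2) powr b) * besselK_int b (of_real x)"
  have S: "((\<lambda>x. ?S c x) \<longlongrightarrow> rGamma (of_real c + 1)) (at_right 0)" for c
  proof -
    have "isCont (reg0F1 (of_real c)) 0"
      by (rule DERIV_isCont[OF has_field_derivative_reg0F1])
    moreover have "((\<lambda>x. complex_of_real (x\<^sup>2 / 4)) \<longlongrightarrow> 0) (at_right 0)"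
      by (rule tendsto_eq_intros refl | simp)+
    ultimately show ?thesis using isCont_tendsto_compose by fastforce
  qed
  have g: "(?g c \<longlongrightarrow> of_real (Gamma c / 2)) (at_right 0)" if "c > 1" for c
    by (rule tendsto_besselK_int_0[OF that])
  have x: "((\<lambda>x. complex_of_real x) \<longlongrightarrow> 0) (at_right 0)"
    by (rule tendsto_eq_intros refl | simp)+
  \<comment> \<open>Here $x = e^\<tau>$, and the powers of \<open>x / 2\<close> in the two factors
      of each product have been combined.\<close>
  have "((\<lambda>x. of_real x * of_real x / 2 * ?g b x * ?S (b + 1) x + 2 * ?g (b + 1) x * ?S b x) \<longlongrightarrow>
        0 * 0 / 2 * of_real (Gamma b / 2) * rGamma (of_real (b + 1) + 1) + 2 * of_real (Gamma (b + 1) / 2) * rGamma (of_real b + 1)) (at_right 0)"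
    using assms by (intro tendsto_add tendsto_mult tendsto_const tendsto_divide S g x) auto
  also have "0 * 0 / 2 * of_real (Gamma b / 2) * rGamma (of_real (b + 1) + 1) + 2 * of_real (Gamma (b + 1) / 2) * rGamma (of_real b + 1) = (1::complex)"
  proof -
    have "b + 1 \<notin> \<int>\<^sub>\<le>\<^sub>0" using assms by (auto elim!: nonpos_Ints_cases)
    then have "Gamma (b + 1) * rGamma (b + 1) = 1"
      by (simp add: rGamma_inverse_Gamma Gamma_eq_zero_iff)
    moreover have "rGamma (of_real b + 1 :: complex) = of_real (rGamma (b + 1))"
      using rGamma_complex_of_real[of "b + 1"] by simp
    ultimately show ?thesis by (simp flip: of_real_mult)
  qed
  finally show ?thesis
  proof (rule Lim_transform_eventually)
    show "\<forall>\<^sub>F x in at_right 0. of_real x * of_real x / 2 * ?g b x * ?S (b + 1) x + 2 * ?g (b + 1) x * ?S b x = IK_cross b (of_real (ln x))"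
      using eventually_at_right_less[of 0]
    proof eventually_elim
      case (elim x)
      have e: "exp (complex_of_real (ln x)) = of_real x" using elim by (simp add: exp_of_real)
      have p: "(x / 2) powr (b + 1) = (x / 2) powr b * (x / 2)" using elim by (simp add: powr_add)
      show ?case
        unfolding IK_cross_def e logI_of_real_ln[OF elim] p by (simp add: algebra_simps)
    qed
  qed
qed

lemma IK_cross_eq_1:
  assumes "\<tau> \<in> right_strip"
  shows "IK_cross b \<tau> = 1"
proof -
  have large: "IK_cross c \<tau> = 1" if c: "c > 1" for c
  proof -
    have "\<exists>k. \<forall>\<tau>\<in>right_strip. IK_cross c \<tau> = k"
      by (intro has_field_derivative_zero_constant convex_right_strip)
         (auto intro: has_field_derivative_at_within has_field_derivative_IK_cross)
    then obtain k where k: "\<And>\<tau>. \<tau> \<in> right_strip \<Longrightarrow> IK_cross c \<tau> = k" by blast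
    have "((\<lambda>x::real. k) \<longlongrightarrow> 1) (at_right 0)"
      using tendsto_IK_cross[OF c] k by simp
    then have "k = 1" using tendsto_unique[OF _ tendsto_const] by force
    with k assms show ?thesis by simp
  qed
  have shift: "IK_cross b \<tau> = IK_cross (b + real m) \<tau>" for m
  proof (induction m)
    case (Suc m)
    then show ?case using IK_cross_periodic[OF assms, of "b + real (Suc m)"] by (simp add: algebra_simps)
  qed simp
  obtain m where "real m > 1 - b" using reals_Archimedean2 by blast
  then show ?thesis using shift[of m] large[of "b + real m"] by simp
qed

text \<open>Eliminate $K_{b+1}$ from the two identities \<open>IK_cross b \<tau> = 1\<close> and
  \<open>IK_cross (- b - 1) \<tau> = 1\<close>, the second one rewritten by the evenness of $K$ in
  the order. What is left is the Wronskian of $I_b$ and $I_{-b}$. Multiplying out by the sine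
  keeps the formula valid at integer orders, where it reduces to $I_{-b} = I_b$.\<close>

lemma besselK_int_connection:
  assumes "\<tau> \<in> right_strip"
  shows "besselK_int b (exp \<tau>) * (2 * sin (of_real pi * of_real b) / of_real pi) =
           logI (- of_real b) \<tau> - logI (of_real b) \<tau>"
proof -
  let ?e = "exp \<tau>" and ?h = "\<lambda>b. besselK_int b (exp \<tau>)" and ?I = "\<lambda>b. logI (of_real b) \<tau>"
  have 1: "?e * (?h b * ?I (b + 1) + ?h (b + 1) * ?I b) = 1"
    using IK_cross_eq_1[OF assms, of b] by (simp only: IK_cross_def)
  have h1: "?h (- b - 1) = ?h (b + 1)" 
    using besselK_int_minus[of "b + 1" ?e] by (simp only: minus_add_distrib minus_diff_commute diff_conv_add_uminus)
  have 2: "?e * (?h (b + 1) * ?I (- b) + ?h b * ?I (- b - 1)) = 1"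
    using IK_cross_eq_1[OF assms, of "- b - 1"] by (simp add: IK_cross_def h1 besselK_int_minus)
  have "?I b - ?I (- b) = ?I b * (?e * (?h (b + 1) * ?I (- b) + ?h b * ?I (- b - 1))) - ?I (- b) * (?e * (?h b * ?I (b + 1) + ?h (b + 1) * ?I b))"
    unfolding 1 2 by simp
  also have "\<dots> = ?h b * (?e * (?I b * ?I (- b - 1) - ?I (b + 1) * ?I (- b)))"
    by (simp add: algebra_simps)
  also have "?e * (?I b * ?I (- b - 1) - ?I (b + 1) * ?I (- b)) = - 2 * sin (of_real pi * of_real b) / of_real pi"
    using logI_wronskian[of \<tau> "of_real b"] by simp
  finally show ?thesis by (simp add: algebra_simps)
qed

section \<open>The second solution for all orders\<close>

text \<open>The equation for solutions of order \<open>b\<close> in the variable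
  \<open>\<tau>\<close>, phrased with both derivatives at once so that membership can be checked
  without computing \<open>deriv (deriv f)\<close>.\<close>

definition log_solution :: "complex set \<Rightarrow> complex \<Rightarrow> (complex \<Rightarrow> complex) \<Rightarrow> bool" where
  "log_solution T b f \<longleftrightarrow> (\<exists>f'. \<forall>\<tau>\<in>T. (f has_field_derivative f' \<tau>) (at \<tau>) \<and>
      (f' has_field_derivative (b\<^sup>2 + exp (2 * \<tau>)) * f \<tau>) (at \<tau>))"

lemma log_solutionI:
  assumes "\<And>\<tau>. \<tau> \<in> T \<Longrightarrow> (f has_field_derivative f' \<tau>) (at \<tau>)"
    and "\<And>\<tau>. \<tau> \<in> T \<Longrightarrow> (f' has_field_derivative (b\<^sup>2 + exp (2 * \<tau>)) * f \<tau>) (at \<tau>)"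
  shows "log_solution T b f"
  using assms unfolding log_solution_def by blast

lemma log_solution_derivs:
  assumes "log_solution T b f" "open T" "\<tau> \<in> T"
  shows "(f has_field_derivative deriv f \<tau>) (at \<tau>)"
    and "(deriv f has_field_derivative (b\<^sup>2 + exp (2 * \<tau>)) * f \<tau>) (at \<tau>)"
proof -
  obtain f' where f': "\<And>\<tau>. \<tau> \<in> T \<Longrightarrow> (f has_field_derivative f' \<tau>) (at \<tau>)"
    "\<And>\<tau>. \<tau> \<in> T \<Longrightarrow> (f' has_field_derivative (b\<^sup>2 + exp (2 * \<tau>)) * f \<tau>) (at \<tau>)"
    using assms(1) unfolding log_solution_def by blast
  have eq: "deriv f t = f' t" if "t \<in> T" for t using f'(1)[OF that] by (rule DERIV_imp_deriv)
  show "(f has_field_derivative deriv f \<tau>) (at \<tau>)" using f'(1) assms(3) eq by simp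
  show "(deriv f has_field_derivative (b\<^sup>2 + exp (2 * \<tau>)) * f \<tau>) (at \<tau>)"
    using f'(2)[OF assms(3)]
    by (rule has_field_derivative_transform_within_open[OF _ assms(2,3)]) (simp add: eq)
qed

lemma log_solution_holomorphic:
  assumes "log_solution T b f" "open T" shows "f holomorphic_on T"
  using log_solution_derivs(1)[OF assms] assms(2) by (auto simp: holomorphic_on_open)

lemma log_solution_lincomb:
  assumes "log_solution T b f" "log_solution T b g" "open T"
  shows "log_solution T b (\<lambda>\<tau>. p * f \<tau> + q * g \<tau>)"
proof (rule log_solutionI[where f' = "\<lambda>\<tau>. p * deriv f \<tau> + q * deriv g \<tau>"])
  fix \<tau> assume "\<tau> \<in> T"
  note f = log_solution_derivs[OF assms(1,3) this] and g = log_solution_derivs[OF assms(2,3) this]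
  show "((\<lambda>\<tau>. p * f \<tau> + q * g \<tau>) has_field_derivative p * deriv f \<tau> + q * deriv g \<tau>) (at \<tau>)"
    by (intro DERIV_add DERIV_cmult f g)
  have "((\<lambda>\<tau>. p * deriv f \<tau> + q * deriv g \<tau>) has_field_derivative
      p * ((b\<^sup>2 + exp (2 * \<tau>)) * f \<tau>) + q * ((b\<^sup>2 + exp (2 * \<tau>)) * g \<tau>)) (at \<tau>)"
    by (intro DERIV_add DERIV_cmult f g)
  then show "((\<lambda>\<tau>. p * deriv f \<tau> + q * deriv g \<tau>) has_field_derivative
      (b\<^sup>2 + exp (2 * \<tau>)) * (p * f \<tau> + q * g \<tau>)) (at \<tau>)"
    by (simp add: algebra_simps)
qed

lemma log_solution_subset: "log_solution T b f \<Longrightarrow> S \<subseteq> T \<Longrightarrow> log_solution S b f"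
  unfolding log_solution_def by blast

lemma log_solution_deriv2I:
  assumes "f holomorphic_on T" "open T" "\<And>\<tau>. \<tau> \<in> T \<Longrightarrow> deriv (deriv f) \<tau> = (b\<^sup>2 + exp (2 * \<tau>)) * f \<tau>"
  shows "log_solution T b f"
proof (rule log_solutionI[where f' = "deriv f"])
  fix \<tau> assume t: "\<tau> \<in> T"
  show "(f has_field_derivative deriv f \<tau>) (at \<tau>)"
    using assms(1,2) t by (rule holomorphic_derivI)
  have "deriv f holomorphic_on T" using assms(1,2) by (rule holomorphic_deriv)
  then show "(deriv f has_field_derivative (b\<^sup>2 + exp (2 * \<tau>)) * f \<tau>) (at \<tau>)"
    using holomorphic_derivI[OF _ assms(2) t] assms(3)[OF t] by metis
qed

lemma log_solution_deriv2:
  assumes "log_solution T b f" "open T" "\<tau> \<in> T"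
  shows "deriv (deriv f) \<tau> = (b\<^sup>2 + exp (2 * \<tau>)) * f \<tau>"
  by (rule DERIV_imp_deriv[OF log_solution_derivs(2)[OF assms]])

lemma log_solution_logI: "log_solution T b (logI b)"
  by (rule log_solution_subset[OF log_solution_deriv2I[of _ UNIV]])
     (auto intro: holomorphic_logI simp: deriv2_logI)

text \<open>Taylor's formula in the parameter \<open>b\<close>, with the second derivative
  controlled by Cauchy's inequality. The error is uniform in \<open>\<tau>\<close> because the
  bound \<open>M\<close> is.\<close>

lemma uniform_limit_difference_quotient:
  fixes N :: "complex \<Rightarrow> complex \<Rightarrow> complex"
  assumes hol: "\<And>\<tau>. (\<lambda>b. N b \<tau>) holomorphic_on UNIV"
    and bd: "\<And>b \<tau>. norm (b - b0) \<le> 2 \<Longrightarrow> \<tau> \<in> A \<Longrightarrow> norm (N b \<tau>) \<le> M"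
    and zero: "\<And>\<tau>. N b0 \<tau> = 0"
    and c: "c \<longlonglongrightarrow> b0" "\<And>k. c k \<noteq> b0" "\<And>k. norm (c k - b0) \<le> 1"
  shows "uniform_limit A (\<lambda>k \<tau>. N (c k) \<tau> / (c k - b0)) (\<lambda>\<tau>. deriv (\<lambda>b. N b \<tau>) b0) sequentially"
proof (rule uniform_limitI)
  fix e :: real assume "e > 0"
  have taylor: "norm (N b \<tau> - (b - b0) * deriv (\<lambda>b. N b \<tau>) b0) \<le> 2 * M * (norm (b - b0))\<^sup>2"
    if "\<tau> \<in> A" "norm (b - b0) \<le> 1" for b \<tau>
  proof -
    let ?f = "\<lambda>i. (deriv ^^ i) (\<lambda>b. N b \<tau>)"
    have "norm (?f 0 b - (\<Sum>i\<le>1. ?f i b0 * (b - b0) ^ i / fact i)) \<le> (2 * M) * norm (b - b0) ^ Suc 1 / fact 1"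
    proof (rule complex_Taylor[where S = "cball b0 1"])
      show "(?f i has_field_derivative ?f (Suc i) x) (at x within cball b0 1)" for i x
      proof -
        have "?f i holomorphic_on UNIV" by (intro holomorphic_higher_deriv hol) auto
        then have "(?f i has_field_derivative deriv (?f i) x) (at x)"
          by (rule holomorphic_derivI) auto
        then show ?thesis by (simp add: has_field_derivative_at_within)
      qed
      show "norm (?f (Suc 1) x) \<le> 2 * M" if x: "x \<in> cball b0 1" for x
      proof -
        have "norm ((deriv ^^ 2) (\<lambda>b. N b \<tau>) x) \<le> fact 2 * M / 1 ^ 2"
        proof (rule Cauchy_inequality)
          show "(\<lambda>b. N b \<tau>) holomorphic_on ball x 1" by (rule holomorphic_on_subset[OF hol]) auto
          show "continuous_on (cball x 1) (\<lambda>b. N b \<tau>)"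
            by (rule holomorphic_on_imp_continuous_on, rule holomorphic_on_subset[OF hol]) auto
          show "norm (N y \<tau>) \<le> M" if y: "norm (x - y) = 1" for y
          proof (rule bd[OF _ \<open>\<tau> \<in> A\<close>])
            have "norm (y - b0) \<le> norm (x - y) + norm (x - b0)"
              by (metis norm_minus_commute norm_triangle_ineq add_diff_eq diff_add_cancel)
            then show "norm (y - b0) \<le> 2" using x y by (simp add: dist_norm norm_minus_commute)
          qed
        qed auto
        then show ?thesis by (simp add: numeral_2_eq_2)
      qed
    qed (use that in \<open>auto simp: dist_norm norm_minus_commute\<close>)
    then show ?thesis by (simp add: zero power2_eq_square mult_ac)
  qed
  have "(\<lambda>k. 2 * M * norm (c k - b0)) \<longlonglongrightarrow> 0"
    using c(1) by (auto intro!: tendsto_eq_intros simp: LIM_zero_iff)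
  then have "\<forall>\<^sub>F k in sequentially. 2 * M * norm (c k - b0) < e"
    using \<open>e > 0\<close> by (rule order_tendstoD)
  then show "\<forall>\<^sub>F k in sequentially. \<forall>\<tau>\<in>A. dist (N (c k) \<tau> / (c k - b0)) (deriv (\<lambda>b. N b \<tau>) b0) < e"
  proof eventually_elim
    case (elim k)
    show ?case
    proof
      fix \<tau> assume \<tau>: "\<tau> \<in> A"
      let ?d = "c k - b0"
      have d: "?d \<noteq> 0" using c(2)[of k] by simp
      have "N (c k) \<tau> / ?d - deriv (\<lambda>b. N b \<tau>) b0 = (N (c k) \<tau> - ?d * deriv (\<lambda>b. N b \<tau>) b0) / ?d"
        using d by (simp add: diff_divide_distrib)
      then have "dist (N (c k) \<tau> / ?d) (deriv (\<lambda>b. N b \<tau>) b0) = norm (N (c k) \<tau> - ?d * deriv (\<lambda>b. N b \<tau>) b0) / norm ?d"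
        by (simp only: dist_norm norm_divide)
      also have "\<dots> \<le> 2 * M * (norm ?d)\<^sup>2 / norm ?d"
        by (intro divide_right_mono taylor \<tau> c(3)) auto
      also have "\<dots> = 2 * M * norm ?d" using d by (simp add: power2_eq_square)
      finally show "dist (N (c k) \<tau> / ?d) (deriv (\<lambda>b. N b \<tau>) b0) < e" using elim by linarith
    qed
  qed
qed

definition logI_gap :: "complex \<Rightarrow> complex \<Rightarrow> complex" where
  "logI_gap b \<tau> = logI (- b) \<tau> - logI b \<tau>"

lemma log_solution_logI_gap: "log_solution UNIV b (logI_gap b)"
proof -
  have "log_solution UNIV b (logI (- b))" using log_solution_logI[of UNIV "- b"] by (simp add: log_solution_def)
  from log_solution_lincomb[OF this log_solution_logI[of UNIV b], of 1 "- 1"]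
  show ?thesis by (simp add: logI_gap_def[abs_def])
qed

lemma holomorphic_logI_gap_param: "(\<lambda>b. logI_gap b \<tau>) holomorphic_on A"
proof -
  have "((\<lambda>b. logI b \<tau>) \<circ> uminus) holomorphic_on A"
    by (intro holomorphic_on_compose holomorphic_logI_param holomorphic_intros)
  then have "(\<lambda>b. logI (- b) \<tau> - logI b \<tau>) holomorphic_on A"
    by (intro holomorphic_on_diff holomorphic_logI_param) (simp add: o_def)
  then show ?thesis by (simp add: logI_gap_def)
qed

lemma logI_gap_int: assumes "b \<in> \<int>" shows "logI_gap b \<tau> = 0"
proof -
  obtain m :: int where m: "b = of_int m" using assms by (elim Ints_cases)
  show ?thesis
  proof (cases "m \<ge> 0")
    case True
    then have "b = of_nat (nat m)" by (simp add: m)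
    then show ?thesis by (simp add: logI_gap_def logI_minus_nat)
  next
    case False
    then have "b = - of_nat (nat (- m))" by (simp add: m)
    then show ?thesis by (simp add: logI_gap_def logI_minus_nat)
  qed
qed

text \<open>The function $K_b(e^\<tau>)$, entire in \<open>\<tau>\<close> for every order. At
  integers the quotient is replaced by the quotient of the derivatives with respect to the order;
  the factor \<open>pi\<close> from the derivative of the sine cancels.\<close>

definition logK :: "complex \<Rightarrow> complex \<Rightarrow> complex" where
  "logK b \<tau> = (if b \<in> \<int> then deriv (\<lambda>c. logI_gap c \<tau>) b / (2 * cos (of_real pi * b))
               else of_real pi * logI_gap b \<tau> / (2 * sin (of_real pi * b)))"

lemma sin_pi_nonzero: "b \<notin> \<int> \<Longrightarrow> sin (of_real pi * b :: complex) \<noteq> 0"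
  by (auto simp: sin_eq_0 mult.commute)

lemma cos_pi_nonzero: assumes "b \<in> \<int>" shows "cos (of_real pi * b :: complex) \<noteq> 0"
proof
  assume "cos (of_real pi * b) = 0"
  moreover have "sin (of_real pi * b) = 0" using assms by (auto simp: sin_eq_0 mult.commute elim!: Ints_cases)
  ultimately show False using sin_cos_squared_add[of "of_real pi * b"] by simp
qed

lemma tendsto_logK_int:
  assumes "b \<in> \<int>"
  shows "((\<lambda>c. of_real pi * logI_gap c \<tau> / (2 * sin (of_real pi * c))) \<longlongrightarrow> logK b \<tau>) (at b)"
proof -
  have 1: "((\<lambda>c. logI_gap c \<tau>) has_field_derivative deriv (\<lambda>c. logI_gap c \<tau>) b) (at b)"
    by (rule holomorphic_derivI[OF holomorphic_logI_gap_param[of _ UNIV]]) auto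
  have 2: "((\<lambda>c. sin (of_real pi * c)) has_field_derivative cos (of_real pi * b) * of_real pi) (at b)"
    by (rule derivative_eq_intros refl | simp)+
  have s: "sin (of_real pi * b) = 0" using assms by (auto simp: sin_eq_0 mult.commute elim!: Ints_cases)
  have "((\<lambda>c. of_real pi * ((logI_gap c \<tau> - logI_gap b \<tau>) / (c - b)) / (2 * ((sin (of_real pi * c) - sin (of_real pi * b)) / (c - b))))
      \<longlongrightarrow> of_real pi * deriv (\<lambda>c. logI_gap c \<tau>) b / (2 * (cos (of_real pi * b) * of_real pi))) (at b)"
    using 1 2 cos_pi_nonzero[OF assms]
    by (intro tendsto_intros) (auto simp: has_field_derivative_iff)
  also have "of_real pi * deriv (\<lambda>c. logI_gap c \<tau>) b / (2 * (cos (of_real pi * b) * of_real pi)) = logK b \<tau>"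
    using assms by (simp add: logK_def)
  finally show ?thesis
    by (rule Lim_transform_eventually)
       (use eventually_neq_at_within[of b b UNIV] in eventually_elim,
        simp add: s logI_gap_int[OF assms])
qed

lemma harmonic_shift_sequence:
  fixes n :: int
  defines "c \<equiv> \<lambda>k. real_of_int n + 1 / (real k + 2)"
  shows "c \<longlonglongrightarrow> real_of_int n" "\<And>k. c k \<notin> \<int>" "\<And>k. \<bar>c k - real_of_int n\<bar> \<le> 1" "\<And>k. c k \<noteq> real_of_int n"
proof -
  have "(\<lambda>k. 1 / (real k + 2)) \<longlonglongrightarrow> 0" by real_asymp
  from tendsto_add[OF tendsto_const this] show "c \<longlonglongrightarrow> real_of_int n" unfolding c_def by simp
  show nonint: "c k \<notin> \<int>" for k
  proof
    assume "c k \<in> \<int>"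
    then obtain m where "real_of_int n + 1 / (real k + 2) = real_of_int m" unfolding c_def by (elim Ints_cases)
    then have *: "real_of_int (m - n) = 1 / (real k + 2)" by simp
    have "0 < 1 / (real k + 2)" "1 / (real k + 2) < 1" by auto
    then have "0 < real_of_int (m - n)" "real_of_int (m - n) < 1" using * by linarith+
    then have "0 < m - n" "m - n < 1" by (simp_all only: of_int_0_less_iff of_int_less_1_iff)
    then show False by linarith
  qed
  show "c k \<noteq> real_of_int n" for k using nonint[of k] Ints_of_int by metis
  show "\<bar>c k - real_of_int n\<bar> \<le> 1" for k by (simp add: c_def)
qed

text \<open>At an integer order the function is a locally uniform limit of solutions of nearby
  orders. Uniform convergence carries over to second derivatives, so the equation passes to the
  limit.\<close>

lemma log_solution_logK: "log_solution UNIV b (logK b)"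
proof (cases "b \<in> \<int>")
  case False
  have "logK b = (\<lambda>\<tau>. (of_real pi / (2 * sin (of_real pi * b))) * logI_gap b \<tau> + 0 * logI_gap b \<tau>)"
    using False by (simp add: logK_def fun_eq_iff)
  then show ?thesis
    using log_solution_lincomb[OF log_solution_logI_gap log_solution_logI_gap,
            of b "of_real pi / (2 * sin (of_real pi * b))" 0] by simp
next
  case True
  then obtain n where n: "b = of_int n" by (elim Ints_cases)
  define c where "c = (\<lambda>k. complex_of_real (real_of_int n + 1 / (real k + 2)))"
  note hs = harmonic_shift_sequence[of n]
  have c1: "c \<longlonglongrightarrow> b" using tendsto_of_real[OF hs(1), where ?'a = complex] by (simp add: c_def n)
  have c2: "c k \<noteq> b" for k using hs(4)[of k] unfolding c_def n by (metis of_real_eq_iff of_real_of_int_eq)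
  have c3: "norm (c k - b) \<le> 1" for k
  proof -
    have "c k - b = of_real (real_of_int n + 1 / (real k + 2) - real_of_int n)" by (simp add: c_def n)
    then show ?thesis using hs(3)[of k] by (simp only: norm_of_real)
  qed
  let ?D = "\<lambda>k \<tau>. logI_gap (c k) \<tau> / (c k - b)" and ?G = "\<lambda>\<tau>. deriv (\<lambda>c. logI_gap c \<tau>) b"
  have solD: "log_solution UNIV (c k) (?D k)" for k
    using log_solution_lincomb[OF log_solution_logI_gap log_solution_logI_gap, of "c k" "1 / (c k - b)" 0] by simp
  have unif: "uniform_limit (ball 0 R) ?D ?G sequentially" for R
  proof -
    obtain M where M: "\<And>a \<tau>. norm a \<le> norm b + 2 \<Longrightarrow> norm \<tau> \<le> R \<Longrightarrow> norm (logI a \<tau>) \<le> M"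
      using logI_bounded[of "norm b + 2" R] by blast
    show ?thesis
    proof (rule uniform_limit_difference_quotient[where M = "M + M"])
      fix a \<tau> assume a: "norm (a - b) \<le> 2" "\<tau> \<in> ball (0::complex) R"
      have "norm a \<le> norm b + 2" using norm_triangle_sub[of a b] a(1) by linarith
      then have "norm (logI (- a) \<tau>) \<le> M" "norm (logI a \<tau>) \<le> M" using a(2) by (auto intro!: M)
      then show "norm (logI_gap a \<tau>) \<le> M + M"
        unfolding logI_gap_def using norm_triangle_ineq4[of "logI (- a) \<tau>" "logI a \<tau>"] by linarith
    qed (use c1 c2 c3 in \<open>auto intro: holomorphic_logI_gap_param logI_gap_int[OF True]\<close>)
  qed
  have holD: "?D k holomorphic_on UNIV" for k by (rule log_solution_holomorphic[OF solD]) auto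
  have holG: "?G holomorphic_on UNIV"
  proof (rule holomorphic_uniform_sequence[OF _ holD])
    fix x :: complex
    have "uniform_limit (cball x 1) ?D ?G sequentially"
    proof (rule uniform_limit_on_subset[OF unif])
      show "cball x 1 \<subseteq> ball 0 (norm x + 2)"
        using norm_triangle_sub[of _ x] by (auto simp: dist_norm norm_minus_commute) (smt (verit))
    qed
    then show "\<exists>d>0. cball x d \<subseteq> UNIV \<and> uniform_limit (cball x d) ?D ?G sequentially"
      by (intro exI[of _ 1]) auto
  qed auto
  have "deriv (deriv ?G) \<tau> = (b\<^sup>2 + exp (2 * \<tau>)) * ?G \<tau>" for \<tau>
  proof (rule LIMSEQ_unique)
    have "(\<lambda>k. (deriv ^^ 2) (?D k) \<tau>) \<longlonglongrightarrow> (deriv ^^ 2) ?G \<tau>"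
      by (rule higher_deriv_complex_uniform_limit[OF unif[of "norm \<tau> + 1"]])
         (auto intro!: always_eventually intro: holomorphic_on_subset[OF holD])
    moreover have "(deriv ^^ 2) (?D k) \<tau> = ((c k)\<^sup>2 + exp (2 * \<tau>)) * ?D k \<tau>" for k
      using log_solution_deriv2[OF solD, of \<tau> k] by (simp add: numeral_2_eq_2)
    ultimately show "(\<lambda>k. ((c k)\<^sup>2 + exp (2 * \<tau>)) * ?D k \<tau>) \<longlonglongrightarrow> deriv (deriv ?G) \<tau>"
      by (simp add: numeral_2_eq_2)
    have "(\<lambda>k. ?D k \<tau>) \<longlonglongrightarrow> ?G \<tau>"
      by (rule tendsto_uniform_limitI[OF unif[of "norm \<tau> + 1"]]) auto
    then show "(\<lambda>k. ((c k)\<^sup>2 + exp (2 * \<tau>)) * ?D k \<tau>) \<longlonglongrightarrow> (b\<^sup>2 + exp (2 * \<tau>)) * ?G \<tau>"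
      by (intro tendsto_intros c1)
  qed
  then have solG: "log_solution UNIV b ?G" by (intro log_solution_deriv2I holG) auto
  have "logK b = (\<lambda>\<tau>. (1 / (2 * cos (of_real pi * b))) * ?G \<tau> + 0 * ?G \<tau>)"
    using True by (simp add: logK_def fun_eq_iff)
  then show ?thesis
    using log_solution_lincomb[OF solG solG, of "1 / (2 * cos (of_real pi * b))" 0] by simp
qed

text \<open>At non-integer orders this is the connection formula; at integers both sides are
  limits along non-integer orders, the right one by dominated convergence.\<close>

lemma logK_eq_besselK_int:
  assumes "\<tau> \<in> right_strip"
  shows "logK (of_real b) \<tau> = besselK_int b (exp \<tau>)"
proof -
  have nonint: "of_real pi * logI_gap (of_real c) \<tau> / (2 * sin (of_real pi * of_real c)) = besselK_int c (exp \<tau>)"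
    if c: "c \<notin> \<int>" for c
  proof -
    have "of_real c \<notin> (\<int> :: complex set)"
      using c by (metis Ints_cases Ints_of_int of_real_eq_iff of_real_of_int_eq)
    then have "sin (of_real pi * of_real c :: complex) \<noteq> 0" by (rule sin_pi_nonzero)
    then show ?thesis using besselK_int_connection[OF assms, of c]
      by (simp add: logI_gap_def field_simps)
  qed
  show ?thesis
  proof (cases "b \<in> \<int>")
    case False
    then have "of_real b \<notin> (\<int> :: complex set)"
      by (metis Ints_cases Ints_of_int of_real_eq_iff of_real_of_int_eq)
    then show ?thesis using nonint[OF False] by (simp add: logK_def)
  next
    case True
    then obtain n where n: "b = real_of_int n" by (elim Ints_cases)
    let ?c = "\<lambda>k. real_of_int n + 1 / (real k + 2)"
    note hs = harmonic_shift_sequence[of n]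
    let ?q = "\<lambda>c. of_real pi * logI_gap c \<tau> / (2 * sin (of_real pi * c))"
    have "complex_of_real (?c k) \<noteq> of_real b" for k
      using hs(4)[of k] unfolding n of_real_eq_iff .
    moreover have "(\<lambda>k. complex_of_real (?c k)) \<longlonglongrightarrow> of_real b"
      unfolding n by (rule tendsto_of_real[OF hs(1)])
    ultimately have "filterlim (\<lambda>k. complex_of_real (?c k)) (at (of_real b)) sequentially"
      by (intro filterlim_atI always_eventually allI)
    with tendsto_logK_int[of "of_real b" \<tau>]
    have "(\<lambda>k. ?q (of_real (?c k))) \<longlonglongrightarrow> logK (of_real b) \<tau>"
      by (rule filterlim_compose) (simp add: n)
    moreover have "(\<lambda>k. besselK_int (?c k) (exp \<tau>)) \<longlonglongrightarrow> besselK_int b (exp \<tau>)"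
      by (rule tendsto_besselK_int_order[OF Re_exp_right_strip[OF assms]]) (use hs(1,3) in \<open>auto simp: n\<close>)
    ultimately show ?thesis using LIMSEQ_unique nonint[OF hs(2)] by simp
  qed
qed

section \<open>Energy estimates on horizontal lines\<close>

lemma log_solution_wronskian_constant:
  assumes f: "log_solution T b f" and g: "log_solution T b g" and T: "open T" "convex T"
  obtains c where "\<And>\<tau>. \<tau> \<in> T \<Longrightarrow> f \<tau> * deriv g \<tau> - deriv f \<tau> * g \<tau> = c"
proof -
  have "((\<lambda>\<tau>. f \<tau> * deriv g \<tau> - deriv f \<tau> * g \<tau>) has_field_derivative 0) (at \<tau>)" if "\<tau> \<in> T" for \<tau>
  proof -
    note f = log_solution_derivs[OF f T(1) that] and g = log_solution_derivs[OF g T(1) that]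
    have "((\<lambda>\<tau>. f \<tau> * deriv g \<tau> - deriv f \<tau> * g \<tau>) has_field_derivative
      (deriv f \<tau> * deriv g \<tau> + ((b\<^sup>2 + exp (2 * \<tau>)) * g \<tau>) * f \<tau>) -
      (((b\<^sup>2 + exp (2 * \<tau>)) * f \<tau>) * g \<tau> + deriv g \<tau> * deriv f \<tau>)) (at \<tau>)"
      by (intro DERIV_diff DERIV_mult f g)
    then show ?thesis by (simp add: algebra_simps)
  qed
  then have "\<exists>c. \<forall>\<tau>\<in>T. f \<tau> * deriv g \<tau> - deriv f \<tau> * g \<tau> = c"
    by (intro has_field_derivative_zero_constant T) (auto intro: has_field_derivative_at_within)
  then show ?thesis using that by blast
qed

lemma deriv_logK_right_strip:
  assumes "\<tau> \<in> right_strip"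
  shows "deriv (logK (of_real b)) \<tau> = of_real b * besselK_int b (exp \<tau>) - exp \<tau> * besselK_int (b + 1) (exp \<tau>)"
proof (rule DERIV_imp_deriv)
  show "(logK (of_real b) has_field_derivative of_real b * besselK_int b (exp \<tau>) - exp \<tau> * besselK_int (b + 1) (exp \<tau>)) (at \<tau>)"
    by (rule has_field_derivative_transform_within_open[OF has_field_derivative_besselK_exp(1)[OF assms] open_right_strip assms])
       (simp add: logK_eq_besselK_int)
qed

lemma logK_logI_wronskian:
  "logK (of_real b) \<tau> * deriv (logI (of_real b)) \<tau> - deriv (logK (of_real b)) \<tau> * logI (of_real b) \<tau> = 1"
proof -
  obtain c where c: "\<And>\<tau>. logK (of_real b) \<tau> * deriv (logI (of_real b)) \<tau> - deriv (logK (of_real b)) \<tau> * logI (of_real b) \<tau> = c"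
    using log_solution_wronskian_constant[OF log_solution_logK log_solution_logI, of "of_real b"] by auto
  have s: "0 \<in> right_strip" by (simp add: right_strip_def)
  have "c = IK_cross b 0"
    using c[of 0] unfolding deriv_logK_right_strip[OF s] deriv_logI logK_eq_besselK_int[OF s] IK_cross_def
    by (simp add: algebra_simps)
  also have "\<dots> = 1" by (rule IK_cross_eq_1[OF s])
  finally show ?thesis using c by simp
qed

text \<open>The horizontal line at height \<open>\<theta>\<close>; in the variable
  \<open>z\<close> it is a ray from the origin.\<close>

definition on_line :: "real \<Rightarrow> real \<Rightarrow> complex" where "on_line \<theta> t = of_real t + \<i> * of_real \<theta>"

lemma Im_on_line [simp]: "Im (on_line \<theta> t) = \<theta>" and Re_on_line [simp]: "Re (on_line \<theta> t) = t"
  by (simp_all add: on_line_def)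

lemma on_line_Re_Im: "on_line (Im \<tau>) (Re \<tau>) = \<tau>"
  by (simp add: on_line_def complex_eq_iff)

lemma exp_on_line: "exp (on_line \<theta> t) = of_real (exp t) * cis \<theta>"
  by (simp add: on_line_def exp_add exp_of_real cis_conv_exp)

lemma exp_2_on_line: "exp (2 * on_line \<theta> t) = of_real (exp (2 * t)) * cis (2 * \<theta>)"
proof -
  have "cis (2 * \<theta>) = cis \<theta> * cis \<theta>" "exp (2 * t) = exp t * exp t"
    by (simp_all only: cis_mult mult_2 exp_add)
  then show ?thesis unfolding exp_double_mult exp_on_line by (simp only: of_real_mult mult_ac)
qed

lemma log_solution_line:
  assumes "log_solution UNIV b f"
  shows "((\<lambda>t. f (on_line \<theta> t)) has_vector_derivative deriv f (on_line \<theta> t)) (at t)"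
    and "((\<lambda>t. deriv f (on_line \<theta> t)) has_vector_derivative (b\<^sup>2 + exp (2 * on_line \<theta> t)) * f (on_line \<theta> t)) (at t)"
proof -
  have l: "(on_line \<theta> has_vector_derivative 1) (at t)"
    unfolding on_line_def[abs_def] by (auto intro!: derivative_eq_intros has_vector_derivative_of_real)
  note d = log_solution_derivs[OF assms open_UNIV UNIV_I]
  show "((\<lambda>t. f (on_line \<theta> t)) has_vector_derivative deriv f (on_line \<theta> t)) (at t)"
    using field_vector_diff_chain_at[OF l d(1)] by (simp add: o_def)
  show "((\<lambda>t. deriv f (on_line \<theta> t)) has_vector_derivative (b\<^sup>2 + exp (2 * on_line \<theta> t)) * f (on_line \<theta> t)) (at t)"
    using field_vector_diff_chain_at[OF l d(2)] by (simp add: o_def)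
qed

text \<open>The source of all monotonicity: the equation replaces the second derivative, and the
  derivative of $\mathrm{Re}(a \overline{f} f')$ involves only $|f|^2$ and $|f'|^2$. The constant
  \<open>a\<close> rotates the potential so that its real part can be made positive.\<close>

lemma has_real_derivative_energy:
  assumes "log_solution UNIV b f"
  shows "((\<lambda>t. Re (a * (cnj (f (on_line \<theta> t)) * deriv f (on_line \<theta> t)))) has_real_derivative
     Re (a * (of_real ((norm (deriv f (on_line \<theta> t)))\<^sup>2)
            + (b\<^sup>2 + exp (2 * on_line \<theta> t)) * of_real ((norm (f (on_line \<theta> t)))\<^sup>2)))) (at t)"
proof -
  note d = log_solution_line[OF assms, of \<theta> t]
  have "((\<lambda>t. cnj (f (on_line \<theta> t))) has_vector_derivative cnj (deriv f (on_line \<theta> t))) (at t)"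
    by (rule bounded_linear.has_vector_derivative[OF bounded_linear_cnj d(1)])
  from has_vector_derivative_mult[OF this d(2)]
  have "((\<lambda>t. a * (cnj (f (on_line \<theta> t)) * deriv f (on_line \<theta> t))) has_vector_derivative
     a * (cnj (f (on_line \<theta> t)) * ((b\<^sup>2 + exp (2 * on_line \<theta> t)) * f (on_line \<theta> t))
       + cnj (deriv f (on_line \<theta> t)) * deriv f (on_line \<theta> t))) (at t)"
    by (intro has_vector_derivative_mult_right)
  from bounded_linear.has_vector_derivative[OF bounded_linear_Re this]
  show ?thesis
    unfolding has_real_derivative_iff_has_vector_derivative complex_norm_square
    by (simp only: mult_ac add_ac)
qed

lemma has_real_derivative_norm_square:
  assumes "log_solution UNIV b f"
  shows "((\<lambda>t. (norm (f (on_line \<theta> t)))\<^sup>2) has_real_derivative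
     2 * Re (cnj (f (on_line \<theta> t)) * deriv f (on_line \<theta> t))) (at t)"
proof -
  note d = log_solution_line(1)[OF assms, of \<theta> t]
  have "((\<lambda>t. cnj (f (on_line \<theta> t))) has_vector_derivative cnj (deriv f (on_line \<theta> t))) (at t)"
    by (rule bounded_linear.has_vector_derivative[OF bounded_linear_cnj d])
  moreover have "(\<lambda>t. (norm (f (on_line \<theta> t)))\<^sup>2) = (\<lambda>t. Re (cnj (f (on_line \<theta> t)) * f (on_line \<theta> t)))"
    by (simp add: fun_eq_iff cmod_power2) (simp add: power2_eq_square)
  ultimately show ?thesis
    using bounded_linear.has_vector_derivative[OF bounded_linear_Re has_vector_derivative_mult[OF _ d]]
    unfolding has_real_derivative_iff_has_vector_derivative
    by (fastforce simp: algebra_simps)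
qed

lemma nonneg_if_deriv_nonneg_at_bot:
  fixes E E' :: "real \<Rightarrow> real"
  assumes "\<And>s. s \<le> t \<Longrightarrow> (E has_real_derivative E' s) (at s)" "\<And>s. s \<le> t \<Longrightarrow> E' s \<ge> 0"
    and "(E \<longlongrightarrow> 0) at_bot"
  shows "E t \<ge> 0"
proof (rule tendsto_upperbound[OF assms(3)])
  show "\<forall>\<^sub>F s in at_bot. E s \<le> E t"
    using eventually_le_at_bot[of t]
  proof eventually_elim
    case (elim s)
    then show ?case by (rule DERIV_nonneg_imp_nondecreasing) (use assms(1,2) in blast)
  qed
qed auto

lemma nonpos_if_deriv_nonneg_at_top:
  fixes E E' :: "real \<Rightarrow> real"
  assumes "\<And>s. (E has_real_derivative E' s) (at s)" "\<And>s. E' s \<ge> 0"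
    and "(E \<longlongrightarrow> 0) at_top"
  shows "E t \<le> 0"
proof (rule tendsto_lowerbound[OF assms(3)])
  show "\<forall>\<^sub>F s in at_top. E t \<le> E s"
    using eventually_ge_at_top[of t]
  proof eventually_elim
    case (elim s)
    then show ?case by (rule DERIV_nonneg_imp_nondecreasing) (use assms(1,2) in blast)
  qed
qed auto

lemma tendsto_logI_at_bot:
  assumes "\<nu> > 0"
  shows "((\<lambda>t. logI (of_real \<nu>) (on_line \<theta> t)) \<longlongrightarrow> 0) at_bot"
proof -
  obtain M where M: "\<And>b w. norm b \<le> \<nu> \<Longrightarrow> norm w \<le> 1 \<Longrightarrow> norm (reg0F1 b w) \<le> M"
    using reg0F1_bounded by blast
  have "\<forall>\<^sub>F t in at_bot. norm (logI (of_real \<nu>) (on_line \<theta> t)) \<le> exp (\<nu> * (t - ln 2)) * M"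
    using eventually_le_at_bot[of 0]
  proof eventually_elim
    case (elim t)
    have "norm (exp (2 * on_line \<theta> t) / 4) \<le> 1"
    proof -
      have "exp (2 * t) \<le> 1" using elim by simp
      then have "exp (2 * t) \<le> 4" by linarith
      then show ?thesis by (simp add: norm_divide)
    qed
    then have "norm (reg0F1 (of_real \<nu>) (exp (2 * on_line \<theta> t) / 4)) \<le> M" using assms by (intro M) auto
    moreover have "norm (exp (of_real \<nu> * (on_line \<theta> t - of_real (ln 2)))) = exp (\<nu> * (t - ln 2))"
      by simp
    ultimately show ?case unfolding logI_def norm_mult by (simp add: mult_left_mono)
  qed
  moreover have "((\<lambda>t. exp (\<nu> * (t - ln 2)) * M) \<longlongrightarrow> 0) at_bot"
    using assms by real_asymp
  ultimately show ?thesis by (rule Lim_null_comparison)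
qed

lemma tendsto_deriv_logI_at_bot:
  assumes "\<nu> > 0"
  shows "((\<lambda>t. deriv (logI (of_real \<nu>)) (on_line \<theta> t)) \<longlongrightarrow> 0) at_bot"
proof -
  have e: "((\<lambda>t. exp (on_line \<theta> t)) \<longlongrightarrow> 0) at_bot"
  proof (rule Lim_null_comparison)
    show "\<forall>\<^sub>F t in at_bot. norm (exp (on_line \<theta> t)) \<le> exp t" by simp
    show "(exp \<longlongrightarrow> (0::real)) at_bot" by (rule exp_at_bot)
  qed
  have "((\<lambda>t. of_real \<nu> * logI (of_real \<nu>) (on_line \<theta> t) + exp (on_line \<theta> t) * logI (of_real (\<nu> + 1)) (on_line \<theta> t))
     \<longlongrightarrow> of_real \<nu> * 0 + 0 * 0) at_bot"
    using assms by (intro tendsto_intros e tendsto_logI_at_bot) auto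
  then show ?thesis unfolding deriv_logI by simp
qed

lemma eventually_logI_nonzero:
  assumes "\<nu> > 0"
  shows "\<forall>\<^sub>F t in at_bot. logI (of_real \<nu>) (on_line \<theta> t) \<noteq> 0"
proof -
  have "((\<lambda>t. exp (2 * on_line \<theta> t) / 4) \<longlongrightarrow> 0) at_bot"
  proof (rule Lim_null_comparison)
    show "\<forall>\<^sub>F t in at_bot. norm (exp (2 * on_line \<theta> t) / 4) \<le> exp (2 * t)"
      by (intro always_eventually allI) (simp add: norm_divide)
    show "((\<lambda>t::real. exp (2 * t)) \<longlongrightarrow> 0) at_bot" by real_asymp
  qed
  moreover have "isCont (reg0F1 (of_real \<nu>)) 0" by (rule DERIV_isCont[OF has_field_derivative_reg0F1])
  ultimately have "((\<lambda>t. reg0F1 (of_real \<nu>) (exp (2 * on_line \<theta> t) / 4)) \<longlongrightarrow> reg0F1 (of_real \<nu>) 0) at_bot"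
    by (rule isCont_tendsto_compose[rotated])
  moreover have "reg0F1 (of_real \<nu>) 0 \<noteq> 0"
  proof -
    have "\<nu> + 1 \<notin> \<int>\<^sub>\<le>\<^sub>0" using assms by (auto elim!: nonpos_Ints_cases)
    then have "rGamma (\<nu> + 1) \<noteq> 0" by (simp add: rGamma_eq_zero_iff)
    then show ?thesis using rGamma_complex_of_real[of "\<nu> + 1"] by simp
  qed
  ultimately have "\<forall>\<^sub>F t in at_bot. reg0F1 (of_real \<nu>) (exp (2 * on_line \<theta> t) / 4) \<noteq> 0"
    by (rule tendsto_imp_eventually_ne)
  then show ?thesis by eventually_elim (simp add: logI_def)
qed

lemma Re_potential: "Re ((of_real \<nu>)\<^sup>2 + exp (2 * on_line \<theta> t)) = \<nu>\<^sup>2 + exp (2 * t) * cos (2 * \<theta>)"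
  unfolding exp_2_on_line by (simp add: Re_power2)

text \<open>The sign condition propagates to the left along the line, so $\mathrm{Re}(\overline{f}
  f')$ increases from its limit 0 at $-\infty$ and is nonnegative. Hence $|f|$ is nondecreasing up
  to \<open>\<tau>\<close>, and a zero at \<open>\<tau>\<close> would force \<open>f\<close> to
  vanish on the whole half line.\<close>

lemma logI_nonzero:
  assumes "\<nu> > 0" and pos: "\<nu>\<^sup>2 + exp (2 * Re \<tau>) * cos (2 * Im \<tau>) \<ge> 0"
  shows "logI (of_real \<nu>) \<tau> \<noteq> 0"
proof
  assume zero: "logI (of_real \<nu>) \<tau> = 0"
  define \<theta> t where "\<theta> = Im \<tau>" and "t = Re \<tau>"
  let ?u = "\<lambda>t. logI (of_real \<nu>) (on_line \<theta> t)" and ?u' = "\<lambda>t. deriv (logI (of_real \<nu>)) (on_line \<theta> t)"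
  note sol = log_solution_logI[of UNIV "of_real \<nu>"]
  have pos': "\<nu>\<^sup>2 + exp (2 * s) * cos (2 * \<theta>) \<ge> 0" if "s \<le> t" for s
  proof (cases "cos (2 * \<theta>) \<ge> 0")
    case False
    then have "exp (2 * t) * cos (2 * \<theta>) \<le> exp (2 * s) * cos (2 * \<theta>)"
      using that by (intro mult_right_mono_neg) auto
    then show ?thesis using pos by (simp add: \<theta>_def t_def)
  qed simp
  have E: "Re (cnj (?u s) * ?u' s) \<ge> 0" if "s \<le> t" for s
  proof (rule nonneg_if_deriv_nonneg_at_bot[where t = s and E = "\<lambda>t. Re (cnj (?u t) * ?u' t)"])
    show "((\<lambda>t. Re (cnj (?u t) * ?u' t)) has_real_derivative (norm (?u' r))\<^sup>2 +
        (\<nu>\<^sup>2 + exp (2 * r) * cos (2 * \<theta>)) * (norm (?u r))\<^sup>2) (at r)" for r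
      using has_real_derivative_energy[OF sol, of 1 \<theta> r] Re_potential[of \<nu> \<theta> r] by simp
    show "(norm (?u' r))\<^sup>2 + (\<nu>\<^sup>2 + exp (2 * r) * cos (2 * \<theta>)) * (norm (?u r))\<^sup>2 \<ge> 0" if "r \<le> s" for r
      using pos'[of r] that \<open>s \<le> t\<close> by simp
    have "((\<lambda>t. Re (cnj (?u t) * ?u' t)) \<longlongrightarrow> Re (cnj 0 * 0)) at_bot"
      using assms(1) by (intro tendsto_intros tendsto_logI_at_bot tendsto_deriv_logI_at_bot)
    then show "((\<lambda>t. Re (cnj (?u t) * ?u' t)) \<longlongrightarrow> 0) at_bot" by simp
  qed
  obtain s where s: "?u s \<noteq> 0" "s \<le> t"
    using eventually_happens'[OF trivial_limit_at_bot_linorder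
        eventually_conj[OF eventually_logI_nonzero[OF assms(1), of \<theta>] eventually_le_at_bot[of t]]]
    by blast
  have "(norm (?u s))\<^sup>2 \<le> (norm (?u t))\<^sup>2"
    using s(2)
  proof (rule DERIV_nonneg_imp_nondecreasing)
    fix r assume "s \<le> r" "r \<le> t"
    then show "\<exists>y. ((\<lambda>t. (norm (?u t))\<^sup>2) has_real_derivative y) (at r) \<and> 0 \<le> y"
      using has_real_derivative_norm_square[OF sol, of \<theta> r] E[of r]
      by (metis mult_nonneg_nonneg zero_le_numeral)
  qed
  moreover have "?u t = 0" using zero by (simp add: \<theta>_def t_def on_line_Re_Im)
  ultimately show False using s(1) by simp
qed

lemma norm_shift_square: "(norm (v + of_real c * u))\<^sup>2 = (norm v)\<^sup>2 + 2 * c * Re (cnj u * v) + c\<^sup>2 * (norm u)\<^sup>2"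
  for u v :: complex
  unfolding cmod_power2 by (simp add: power2_eq_square algebra_simps)

text \<open>The derivative of $\mathrm{Re}(\overline{f} f') - \<nu> |f|^2$ is $|f' - \<nu> f|^2 +
  e^{2t} \cos(2\<theta>) |f|^2$, by completing the square.\<close>

lemma Re_logderiv_logI_ge:
  assumes "\<nu> > 0" "cos (2 * Im \<tau>) \<ge> 0"
  shows "Re (deriv (logI (of_real \<nu>)) \<tau> / logI (of_real \<nu>) \<tau>) \<ge> \<nu>"
proof -
  define \<theta> t where "\<theta> = Im \<tau>" and "t = Re \<tau>"
  let ?u = "\<lambda>t. logI (of_real \<nu>) (on_line \<theta> t)" and ?u' = "\<lambda>t. deriv (logI (of_real \<nu>)) (on_line \<theta> t)"
  note sol = log_solution_logI[of UNIV "of_real \<nu>"]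
  have "Re (cnj (?u t) * ?u' t) - \<nu> * (norm (?u t))\<^sup>2 \<ge> 0"
  proof (rule nonneg_if_deriv_nonneg_at_bot[where t = t
        and E = "\<lambda>t. Re (cnj (?u t) * ?u' t) - \<nu> * (norm (?u t))\<^sup>2"])
    let ?E' = "\<lambda>r. ((norm (?u' r))\<^sup>2 + (\<nu>\<^sup>2 + exp (2 * r) * cos (2 * \<theta>)) * (norm (?u r))\<^sup>2)
        - \<nu> * (2 * Re (cnj (?u r) * ?u' r))"
    show "((\<lambda>t. Re (cnj (?u t) * ?u' t) - \<nu> * (norm (?u t))\<^sup>2) has_real_derivative ?E' r) (at r)" for r
      using has_real_derivative_energy[OF sol, of 1 \<theta> r] Re_potential[of \<nu> \<theta> r]
      by (intro DERIV_diff DERIV_cmult has_real_derivative_norm_square[OF sol]) simp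
    show "?E' r \<ge> 0" for r
    proof -
      have "?E' r = (norm (?u' r + of_real (- \<nu>) * ?u r))\<^sup>2 + exp (2 * r) * cos (2 * \<theta>) * (norm (?u r))\<^sup>2"
        unfolding norm_shift_square by (simp add: algebra_simps)
      also have "\<dots> \<ge> 0" using assms(2) by (simp add: \<theta>_def)
      finally show ?thesis .
    qed
    have "((\<lambda>t. Re (cnj (?u t) * ?u' t) - \<nu> * (norm (?u t))\<^sup>2) \<longlongrightarrow> Re (cnj 0 * 0) - \<nu> * (norm (0::complex))\<^sup>2) at_bot"
      using assms(1) by (intro tendsto_intros tendsto_logI_at_bot tendsto_deriv_logI_at_bot)
    then show "((\<lambda>t. Re (cnj (?u t) * ?u' t) - \<nu> * (norm (?u t))\<^sup>2) \<longlongrightarrow> 0) at_bot" by simp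
  qed
  moreover have "?u t \<noteq> 0"
    using assms by (simp add: \<theta>_def t_def on_line_Re_Im) (intro logI_nonzero, auto)
  moreover have "Re (v / u) = Re (cnj u * v) / (norm u)\<^sup>2" for u v :: complex
    by (simp add: Re_divide cmod_power2 mult.commute)
  ultimately show ?thesis
    by (simp add: \<theta>_def t_def on_line_Re_Im le_divide_eq)
qed

lemma besselK_int_decay:
  assumes "\<bar>\<theta>\<bar> < pi / 2"
  obtains C where "\<forall>\<^sub>F t in at_top. norm (besselK_int b (exp (on_line \<theta> t))) \<le> C * exp (- exp t * cos \<theta>)"
proof -
  have c: "cos \<theta> > 0" using assms by (intro cos_gt_zero_pi) auto
  have "filterlim (\<lambda>t. exp t * cos \<theta>) at_top at_top" using c by real_asymp
  then have "\<forall>\<^sub>F t in at_top. exp t * cos \<theta> \<ge> 1" by (simp add: filterlim_at_top)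
  then have "\<forall>\<^sub>F t in at_top. norm (besselK_int b (exp (on_line \<theta> t))) \<le>
      (exp 1 * (LINT t|lborel. exp (b * t - cosh t))) * exp (- exp t * cos \<theta>)"
  proof eventually_elim
    case (elim t)
    have "Re (exp (on_line \<theta> t)) = exp t * cos \<theta>" by (simp add: Re_exp)
    then show ?case using norm_besselK_int_le[of "exp (on_line \<theta> t)" b] elim
      by (simp add: exp_diff exp_minus divide_inverse mult_ac)
  qed
  then show ?thesis using that by blast
qed

lemma on_line_right_strip: "\<bar>\<theta>\<bar> < pi / 2 \<Longrightarrow> on_line \<theta> t \<in> right_strip"
  by (simp add: right_strip_def)

lemma tendsto_logK_at_top:
  assumes "\<bar>\<theta>\<bar> < pi / 2"
  shows "((\<lambda>t. of_real (exp t) * logK (of_real \<nu>) (on_line \<theta> t)) \<longlongrightarrow> 0) at_top"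
    and "((\<lambda>t. logK (of_real \<nu>) (on_line \<theta> t)) \<longlongrightarrow> 0) at_top"
    and "((\<lambda>t. deriv (logK (of_real \<nu>)) (on_line \<theta> t)) \<longlongrightarrow> 0) at_top"
proof -
  have c: "cos \<theta> > 0" using assms by (intro cos_gt_zero_pi) auto
  have 1: "((\<lambda>t. of_real (exp t) * besselK_int b (exp (on_line \<theta> t))) \<longlongrightarrow> 0) at_top" for b
  proof -
    obtain C where C: "\<forall>\<^sub>F t in at_top. norm (besselK_int b (exp (on_line \<theta> t))) \<le> C * exp (- exp t * cos \<theta>)"
      using besselK_int_decay[OF assms] by blast
    show ?thesis
    proof (rule Lim_null_comparison)
      show "\<forall>\<^sub>F t in at_top. norm (of_real (exp t) * besselK_int b (exp (on_line \<theta> t))) \<le> exp t * (C * exp (- exp t * cos \<theta>))"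
        using C by eventually_elim (simp add: norm_mult mult_left_mono)
      show "((\<lambda>t. exp t * (C * exp (- exp t * cos \<theta>))) \<longlongrightarrow> 0) at_top" using c by real_asymp
    qed
  qed
  have 2: "((\<lambda>t. besselK_int b (exp (on_line \<theta> t))) \<longlongrightarrow> 0) at_top" for b
  proof -
    have "((\<lambda>t::real. complex_of_real (exp (- t))) \<longlongrightarrow> of_real 0) at_top"
      by (intro tendsto_of_real) real_asymp
    from tendsto_mult[OF this 1[of b]]
    have "((\<lambda>t. of_real (exp (- t)) * (of_real (exp t) * besselK_int b (exp (on_line \<theta> t)))) \<longlongrightarrow> 0) at_top"
      by (simp only: of_real_0 mult_zero_left)
    moreover have "complex_of_real (exp (- t)) * (of_real (exp t) * z) = z" for t z
      by (simp add: exp_minus)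
    ultimately show ?thesis by (simp only:)
  qed
  note r = on_line_right_strip[OF assms]
  show "((\<lambda>t. of_real (exp t) * logK (of_real \<nu>) (on_line \<theta> t)) \<longlongrightarrow> 0) at_top"
    unfolding logK_eq_besselK_int[OF r] by (rule 1)
  show "((\<lambda>t. logK (of_real \<nu>) (on_line \<theta> t)) \<longlongrightarrow> 0) at_top"
    unfolding logK_eq_besselK_int[OF r] by (rule 2)
  have "((\<lambda>t. of_real \<nu> * besselK_int \<nu> (exp (on_line \<theta> t)) - cis \<theta> * (of_real (exp t) * besselK_int (\<nu> + 1) (exp (on_line \<theta> t))))
    \<longlongrightarrow> of_real \<nu> * 0 - cis \<theta> * 0) at_top"
    by (intro tendsto_intros 1 2)
  then show "((\<lambda>t. deriv (logK (of_real \<nu>)) (on_line \<theta> t)) \<longlongrightarrow> 0) at_top"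
    unfolding deriv_logK_right_strip[OF r] by (simp add: exp_on_line mult_ac)
qed

text \<open>The rotation by $e^{-i\<theta>}$ makes the real part of the rotated potential equal to
  $\cos\<theta>\,(\<nu>^2 + e^{2t})$, which is positive in the whole strip. The energy increases
  to its limit 0 at $+\infty$ and is therefore nonpositive. At a zero of \<open>f\<close> it would
  vanish and have positive derivative, since $f' \ne 0$ by the Wronskian; so it would become
  positive.\<close>

lemma logK_nonzero:
  assumes "\<tau> \<in> right_strip"
  shows "logK (of_real \<nu>) \<tau> \<noteq> 0"
proof
  assume zero: "logK (of_real \<nu>) \<tau> = 0"
  define \<theta> t where "\<theta> = Im \<tau>" and "t = Re \<tau>"
  have \<theta>: "\<bar>\<theta>\<bar> < pi / 2" using assms by (simp add: right_strip_def \<theta>_def)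
  then have c: "cos \<theta> > 0" by (intro cos_gt_zero_pi) auto
  let ?u = "\<lambda>t. logK (of_real \<nu>) (on_line \<theta> t)" and ?u' = "\<lambda>t. deriv (logK (of_real \<nu>)) (on_line \<theta> t)"
  note sol = log_solution_logK[of "of_real \<nu>"]
  let ?E = "\<lambda>t. Re (cis (- \<theta>) * (cnj (?u t) * ?u' t))"
  let ?E' = "\<lambda>t. cos \<theta> * ((norm (?u' t))\<^sup>2 + (\<nu>\<^sup>2 + exp (2 * t)) * (norm (?u t))\<^sup>2)"
  have E': "(?E has_real_derivative ?E' r) (at r)" for r
  proof -
    have "cis (- \<theta>) * exp (2 * on_line \<theta> r) = of_real (exp (2 * r)) * cis \<theta>"
      unfolding exp_2_on_line by (simp add: cis_mult mult.left_commute)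
    then have "cis (- \<theta>) * (of_real ((norm (?u' r))\<^sup>2) + ((of_real \<nu>)\<^sup>2 + exp (2 * on_line \<theta> r)) * of_real ((norm (?u r))\<^sup>2))
        = cis (- \<theta>) * of_real ((norm (?u' r))\<^sup>2 + \<nu>\<^sup>2 * (norm (?u r))\<^sup>2) + of_real (exp (2 * r)) * cis \<theta> * of_real ((norm (?u r))\<^sup>2)"
      by (simp add: algebra_simps)
    then have "Re (cis (- \<theta>) * (of_real ((norm (?u' r))\<^sup>2) + ((of_real \<nu>)\<^sup>2 + exp (2 * on_line \<theta> r)) * of_real ((norm (?u r))\<^sup>2)))
        = ?E' r"
      by (simp add: algebra_simps del: of_real_power)
    then show ?thesis using has_real_derivative_energy[OF sol, of "cis (- \<theta>)" \<theta> r] by simp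
  qed
  have "(?E \<longlongrightarrow> Re (cis (- \<theta>) * (cnj 0 * 0))) at_top"
    by (intro tendsto_intros tendsto_logK_at_top \<theta>)
  then have lim: "(?E \<longlongrightarrow> 0) at_top" by simp
  \<comment> \<open>The energy increases towards its limit 0.\<close>
  have nonpos: "?E s \<le> 0" for s
    by (rule nonpos_if_deriv_nonneg_at_top[OF E' _ lim]) (use c in auto)
  have u0: "?u t = 0" using zero by (simp add: \<theta>_def t_def on_line_Re_Im)
  have "?u' t \<noteq> 0"
    using logK_logI_wronskian[of \<nu> "on_line \<theta> t"] u0 by auto
  then have "?E' t > 0" using c u0 by simp
  from DERIV_pos_inc_right[OF E' this] obtain d where "d > 0" "\<And>h. h > 0 \<Longrightarrow> h < d \<Longrightarrow> ?E t < ?E (t + h)"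
    by blast
  then have "?E t < ?E (t + d / 2)" by simp
  moreover have "?E t = 0" by (simp add: u0)
  ultimately show False using nonpos[of "t + d / 2"] by linarith
qed

text \<open>As for the first solution, but from the right end: the derivative of
  $\mathrm{Re}(\overline{f} f') + \frac12 e^t |f|^2$ is $|f' + \frac12 e^t f|^2$ plus a
  nonnegative multiple of $|f|^2$ as soon as $\cos(2\<theta>) \ge 1/4$.\<close>

lemma Re_logderiv_logK_le:
  assumes "\<tau> \<in> right_strip" "cos (2 * Im \<tau>) \<ge> 1 / 4"
  shows "Re (deriv (logK (of_real \<nu>)) \<tau> / logK (of_real \<nu>) \<tau>) \<le> - exp (Re \<tau>) / 2"
proof -
  define \<theta> t where "\<theta> = Im \<tau>" and "t = Re \<tau>"
  have \<theta>: "\<bar>\<theta>\<bar> < pi / 2" using assms by (simp add: right_strip_def \<theta>_def)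
  let ?u = "\<lambda>t. logK (of_real \<nu>) (on_line \<theta> t)" and ?u' = "\<lambda>t. deriv (logK (of_real \<nu>)) (on_line \<theta> t)"
  note sol = log_solution_logK[of "of_real \<nu>"]
  have "Re (cnj (?u t) * ?u' t) + exp t / 2 * (norm (?u t))\<^sup>2 \<le> 0"
  proof (rule nonpos_if_deriv_nonneg_at_top[where t = t
        and E = "\<lambda>t. Re (cnj (?u t) * ?u' t) + exp t / 2 * (norm (?u t))\<^sup>2"])
    let ?E' = "\<lambda>r. ((norm (?u' r))\<^sup>2 + (\<nu>\<^sup>2 + exp (2 * r) * cos (2 * \<theta>)) * (norm (?u r))\<^sup>2)
        + (exp r / 2 * (norm (?u r))\<^sup>2 + (2 * Re (cnj (?u r) * ?u' r)) * (exp r / 2))"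
    show "((\<lambda>t. Re (cnj (?u t) * ?u' t) + exp t / 2 * (norm (?u t))\<^sup>2) has_real_derivative ?E' r) (at r)" for r
      using has_real_derivative_energy[OF sol, of 1 \<theta> r] Re_potential[of \<nu> \<theta> r]
      by (intro DERIV_add DERIV_mult DERIV_cdivide DERIV_exp has_real_derivative_norm_square[OF sol]) simp
    show "?E' r \<ge> 0" for r
    proof -
      have e: "exp (2 * r) = exp r * exp r" by (simp only: mult_2 exp_add)
      have "?E' r = (norm (?u' r + of_real (exp r / 2) * ?u r))\<^sup>2
          + (\<nu>\<^sup>2 + exp (2 * r) * (cos (2 * \<theta>) - 1 / 4) + exp r / 2) * (norm (?u r))\<^sup>2"
        unfolding norm_shift_square e by (simp add: algebra_simps power2_eq_square)
      also have "\<dots> \<ge> 0" using assms(2) by (simp add: \<theta>_def)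
      finally show ?thesis .
    qed
    have "((\<lambda>t. Re (cnj (?u t) * ?u' t) + norm (of_real (exp t) * ?u t) * norm (?u t) / 2) \<longlongrightarrow>
        Re (cnj 0 * 0) + norm (0::complex) * norm (0::complex) / 2) at_top"
      by (intro tendsto_intros tendsto_logK_at_top \<theta>) auto
    then show "((\<lambda>t. Re (cnj (?u t) * ?u' t) + exp t / 2 * (norm (?u t))\<^sup>2) \<longlongrightarrow> 0) at_top"
      by (simp add: norm_mult power2_eq_square mult_ac)
  qed
  moreover have "?u t \<noteq> 0"
    using assms by (simp add: \<theta>_def t_def on_line_Re_Im logK_nonzero)
  moreover have "Re (v / u) = Re (cnj u * v) / (norm u)\<^sup>2" for u v :: complex
    by (simp add: Re_divide cmod_power2 mult.commute)
  ultimately show ?thesis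
    by (simp add: \<theta>_def t_def on_line_Re_Im divide_le_eq)
qed

section \<open>Values of the quotient of the two solutions\<close>

text \<open>Minimise the penalised distance $|f(z) - w| + m |z - a|$ over the closed disc. The
  value at the centre is less than $m r$, so the minimum is not on the boundary. If $f(z) \ne w$
  at the minimum, a small step in the direction that decreases $|f - w|$ would gain at the rate
  $|f'| > m$ and lose only at the rate \<open>m\<close>.\<close>

lemma ball_subset_image_if_deriv_large:
  fixes f :: "complex \<Rightarrow> complex"
  assumes f: "\<And>z. z \<in> cball a r \<Longrightarrow> (f has_field_derivative f' z) (at z)"
    and big: "\<And>z. z \<in> cball a r \<Longrightarrow> m < norm (f' z)"
    and "0 \<le> m" and w: "norm (f a - w) < m * r"
  shows "\<exists>z\<in>ball a r. f z = w"
proof -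
  have "m * r > 0" using w norm_ge_zero[of "f a - w"] by linarith
  then have "m > 0" "r > 0" using \<open>0 \<le> m\<close> by (auto simp: zero_less_mult_iff)
  let ?g = "\<lambda>z. norm (f z - w) + m * norm (z - a)"
  have "continuous_on (cball a r) f"
    using f by (intro continuous_at_imp_continuous_on ballI) (auto intro: DERIV_isCont)
  then have "continuous_on (cball a r) ?g" by (intro continuous_intros)
  then obtain z0 where z0: "z0 \<in> cball a r" and min: "\<And>z. z \<in> cball a r \<Longrightarrow> ?g z0 \<le> ?g z"
    using continuous_attains_inf[of "cball a r" ?g] \<open>r > 0\<close> by auto
  have "?g z0 \<le> norm (f a - w)" using min[of a] \<open>r > 0\<close> by simp
  then have "m * norm (z0 - a) < m * r" using w norm_ge_zero[of "f z0 - w"] by linarith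
  then have in_ball: "norm (z0 - a) < r" using \<open>m > 0\<close> by simp
  have "f z0 = w"
  proof (rule ccontr)
    assume "f z0 \<noteq> w"
    define v D where "v = f z0 - w" and "D = f' z0"
    define \<kappa> where "\<kappa> = (norm D - m) / 2"
    have v: "v \<noteq> 0" using \<open>f z0 \<noteq> w\<close> by (simp add: v_def)
    have D: "m < norm D" using big[OF z0] by (simp add: D_def)
    then have "\<kappa> > 0" and D0: "norm D > 0" using \<open>m > 0\<close> by (auto simp: \<kappa>_def)
    from f[OF z0] have "(f has_derivative (*) D) (at z0)" by (simp add: has_field_derivative_def D_def)
    then obtain \<delta> where \<delta>: "\<delta> > 0"
      "\<And>y. norm (y - z0) < \<delta> \<Longrightarrow> norm (f y - f z0 - D * (y - z0)) \<le> \<kappa> * norm (y - z0)"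
      using \<open>\<kappa> > 0\<close> unfolding has_derivative_at_alt by blast
    define q where "q = norm v / norm D"
    have "q > 0" using v D0 by (simp add: q_def)
    define s where "s = min (min \<delta> (r - norm (z0 - a))) q / 2"
    have s: "s > 0" "s < \<delta>" "s < r - norm (z0 - a)" "s < norm v / norm D"
      using \<delta>(1) in_ball \<open>q > 0\<close> unfolding q_def[symmetric] s_def by (auto simp: min_def)
    define \<epsilon> where "\<epsilon> = s * norm D / norm v"
    have \<epsilon>: "0 \<le> \<epsilon>" "\<epsilon> \<le> 1" using s v D0 by (auto simp: \<epsilon>_def field_simps)
    define h where "h = - of_real \<epsilon> * v / D"
    have h: "norm h = s" using \<epsilon> s v D0 by (simp add: h_def norm_mult norm_divide) (simp add: \<epsilon>_def)
    have "norm (f (z0 + h) - w) \<le> norm (v + D * h) + norm (f (z0 + h) - f z0 - D * h)"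
      using norm_triangle_ineq[of "v + D * h" "f (z0 + h) - f z0 - D * h"] by (simp add: v_def)
    also have "v + D * h = of_real (1 - \<epsilon>) * v" using D0 by (auto simp: h_def algebra_simps)
    also have "norm \<dots> = (1 - \<epsilon>) * norm v" using \<epsilon> by (simp add: norm_mult del: of_real_diff)
    also have "norm (f (z0 + h) - f z0 - D * h) \<le> \<kappa> * s" using \<delta>(2)[of "z0 + h"] s h by simp
    also have "(1 - \<epsilon>) * norm v = norm v - norm D * s"
      using v by (simp add: \<epsilon>_def algebra_simps)
    finally have 1: "norm (f (z0 + h) - w) \<le> norm v - norm D * s + \<kappa> * s" by simp
    have "norm (z0 + h - a) \<le> norm (z0 - a) + norm h"
      using norm_triangle_ineq[of "z0 - a" h] by (simp add: algebra_simps)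
    then have 2: "norm (z0 + h - a) \<le> norm (z0 - a) + s" by (simp add: h)
    have "?g z0 \<le> ?g (z0 + h)"
      by (rule min) (use 2 s in \<open>simp add: dist_norm norm_minus_commute\<close>)
    also have "\<dots> \<le> norm v - norm D * s + \<kappa> * s + m * (norm (z0 - a) + s)"
      by (intro add_mono 1 mult_left_mono 2) (use \<open>m > 0\<close> in auto)
    also have "\<dots> = ?g z0 - \<kappa> * s" by (simp add: v_def \<kappa>_def field_simps)
    also have "\<dots> < ?g z0" using \<open>\<kappa> > 0\<close> s by simp
    finally show False by simp
  qed
  then show ?thesis using in_ball by (intro bexI[of _ z0]) (auto simp: dist_norm norm_minus_commute)
qed

text \<open>On $|\mathrm{Im}\,\<tau>| < \pi/6$ the energy estimates bound the derivative of $\Psi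
  = \log(I/K)$ from below by $\<nu> + e^{\mathrm{Re}\,\<tau>}/2$. A real point with the right
  modulus of $I/K$ exists because $\mathrm{Re}\,\Psi$ grows at least linearly; from there a disc
  so small that $e^\<tau>$ stays close to the real axis suffices to reach every argument.\<close>

lemma logI_div_logK_surj:
  assumes \<nu>: "\<nu> > 32" and c: "c \<noteq> 0"
  shows "\<exists>\<tau>\<in>right_strip. \<bar>Im (exp \<tau>)\<bar> < \<nu> \<and> logI (of_real \<nu>) \<tau> = c * logK (of_real \<nu>) \<tau>"
proof -
  let ?I = "logI (of_real \<nu>)" and ?K = "logK (of_real \<nu>)"
  define T where "T = {\<tau>. Im \<tau> < pi / 6} \<inter> {\<tau>. Im \<tau> > - (pi / 6)}"
  have T: "convex T" "open T"
    unfolding T_def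
    by (intro convex_Int convex_halfspace_Im_lt convex_halfspace_Im_gt
        open_Int open_halfspace_Im_lt open_halfspace_Im_gt)+
  have TR: "\<tau> \<in> right_strip" and cosT: "cos (2 * Im \<tau>) \<ge> 1 / 2" if "\<tau> \<in> T" for \<tau>
  proof -
    show "\<tau> \<in> right_strip" using that by (auto simp: T_def right_strip_def)
    have "cos (pi / 3) \<le> cos \<bar>2 * Im \<tau>\<bar>"
      using that by (intro cos_monotone_0_pi_le) (auto simp: T_def)
    then show "cos (2 * Im \<tau>) \<ge> 1 / 2" by (simp add: cos_60)
  qed
  have I0: "?I \<tau> \<noteq> 0" if "\<tau> \<in> T" for \<tau>
    using cosT[OF that] \<nu> by (intro logI_nonzero) (auto intro!: add_nonneg_nonneg)
  have K0: "?K \<tau> \<noteq> 0" if "\<tau> \<in> T" for \<tau>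
    by (rule logK_nonzero[OF TR[OF that]])
  have dI: "(?I has_field_derivative deriv ?I \<tau>) (at \<tau>)" and dK: "(?K has_field_derivative deriv ?K \<tau>) (at \<tau>)" for \<tau>
    using log_solution_derivs(1)[OF log_solution_logI[of UNIV]] log_solution_derivs(1)[OF log_solution_logK] by auto
  have hol: "(\<lambda>\<tau>. ?I \<tau> / ?K \<tau>) holomorphic_on T"
    using K0 by (intro holomorphic_on_divide holomorphic_logI)
      (auto intro: holomorphic_on_subset[OF log_solution_holomorphic[OF log_solution_logK]])
  have nz: "?I \<tau> / ?K \<tau> \<noteq> 0" if "\<tau> \<in> T" for \<tau>
    using I0[OF that] K0[OF that] by simp
  obtain \<Psi> where \<Psi>: "\<Psi> holomorphic_on T" "\<And>\<tau>. \<tau> \<in> T \<Longrightarrow> ?I \<tau> / ?K \<tau> = exp (\<Psi> \<tau>)"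
    using contractible_imp_holomorphic_log[OF hol convex_imp_contractible[OF T(1)] nz] by blast
  define \<Psi>' where "\<Psi>' = deriv \<Psi>"
  have d\<Psi>: "(\<Psi> has_field_derivative \<Psi>' \<tau>) (at \<tau>)" if "\<tau> \<in> T" for \<tau>
    unfolding \<Psi>'_def by (rule holomorphic_derivI[OF \<Psi>(1) T(2) that])
  have \<Psi>'_eq: "\<Psi>' \<tau> = deriv ?I \<tau> / ?I \<tau> - deriv ?K \<tau> / ?K \<tau>" if "\<tau> \<in> T" for \<tau>
  proof -
    have I_eq: "?I t = ?K t * exp (\<Psi> t)" if "t \<in> T" for t
      using \<Psi>(2)[OF that] K0[OF that] by (simp add: field_simps)
    have "((\<lambda>t. ?K t * exp (\<Psi> t)) has_field_derivative deriv ?K \<tau> * exp (\<Psi> \<tau>) + exp (\<Psi> \<tau>) * \<Psi>' \<tau> * ?K \<tau>) (at \<tau>)"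
      by (intro DERIV_mult DERIV_chain2[OF DERIV_exp] dK d\<Psi> that)
    then have "(?I has_field_derivative deriv ?K \<tau> * exp (\<Psi> \<tau>) + exp (\<Psi> \<tau>) * \<Psi>' \<tau> * ?K \<tau>) (at \<tau>)"
      by (rule has_field_derivative_transform_within_open[OF _ T(2) that]) (simp add: I_eq)
    then have "deriv ?I \<tau> = deriv ?K \<tau> * exp (\<Psi> \<tau>) + exp (\<Psi> \<tau>) * \<Psi>' \<tau> * ?K \<tau>" by (rule DERIV_imp_deriv)
    then show ?thesis using K0[OF that] by (simp add: I_eq[OF that] field_simps)
  qed
  have Re\<Psi>': "Re (\<Psi>' \<tau>) \<ge> \<nu> + exp (Re \<tau>) / 2" if "\<tau> \<in> T" for \<tau>
    using Re_logderiv_logI_ge[of \<nu> \<tau>] Re_logderiv_logK_le[OF TR[OF that], of \<nu>] cosT[OF that] \<nu>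
    unfolding \<Psi>'_eq[OF that] by simp
  have realT: "of_real t \<in> T" for t by (simp add: T_def)
  \<comment> \<open>A real base point \<open>a\<close> at which the quotient has the modulus of
      \<open>c\<close>; only the argument is left to correct, by at most
      \<open>pi\<close>.\<close>
  define \<phi> where "\<phi> = (\<lambda>t::real. Re (\<Psi> (of_real t)))"
  have d\<phi>: "(\<phi> has_real_derivative Re (\<Psi>' (of_real t))) (at t)" for t
  proof -
    have "((\<lambda>t. complex_of_real t) has_vector_derivative 1) (at t)"
      by (auto intro!: derivative_eq_intros has_vector_derivative_of_real)
    from bounded_linear.has_vector_derivative[OF bounded_linear_Re field_vector_diff_chain_at[OF this d\<Psi>[OF realT]]]
    show ?thesis unfolding \<phi>_def has_real_derivative_iff_has_vector_derivative by (simp add: o_def)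
  qed
  have grow: "\<phi> s + \<nu> * (t - s) \<le> \<phi> t" if "s \<le> t" for s t
  proof -
    have "\<phi> s - \<nu> * s \<le> \<phi> t - \<nu> * t"
      using that
    proof (rule DERIV_nonneg_imp_nondecreasing)
      fix x
      have "((\<lambda>t. \<phi> t - \<nu> * t) has_real_derivative Re (\<Psi>' (of_real x)) - \<nu> * 1) (at x)"
        by (intro DERIV_diff d\<phi> DERIV_cmult DERIV_ident)
      moreover have "Re (\<Psi>' (of_real x)) - \<nu> * 1 \<ge> 0"
      proof -
        have "\<nu> + exp x / 2 \<le> Re (\<Psi>' (of_real x))" using Re\<Psi>'[OF realT, of x] by simp
        then show ?thesis using exp_gt_zero[of x] by linarith
      qed
      ultimately show "\<exists>y. ((\<lambda>t. \<phi> t - \<nu> * t) has_real_derivative y) (at x) \<and> 0 \<le> y" by blast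
    qed
    then show ?thesis by (simp add: algebra_simps)
  qed
  obtain a where a: "\<phi> a = ln (norm c)"
  proof -
    define d where "d = \<bar>ln (norm c) - \<phi> 0\<bar>"
    have "d \<le> \<nu> * d" using \<nu> mult_right_mono[of 1 \<nu> d] by (simp add: d_def)
    then have "\<phi> (- d) \<le> ln (norm c)" "ln (norm c) \<le> \<phi> d"
    proof -
      have "d \<ge> 0" "ln (norm c) \<le> \<phi> 0 + d" "\<phi> 0 - d \<le> ln (norm c)" by (auto simp: d_def)
      then show "\<phi> (- d) \<le> ln (norm c)" "ln (norm c) \<le> \<phi> d"
        using grow[of "- d" 0] grow[of 0 d] \<open>d \<le> \<nu> * d\<close> by auto
    qed
    moreover have "isCont \<phi> x" for x using d\<phi> by (rule DERIV_isCont)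
    ultimately have "\<exists>x\<ge>- d. x \<le> d \<and> \<phi> x = ln (norm c)"
      by (intro IVT) (auto simp: d_def)
    then show ?thesis using that by blast
  qed
  \<comment> \<open>On the disc of radius \<open>r\<close> around \<open>a\<close> the derivative
      exceeds \<open>m\<close>, because \<open>Re \<tau>\<close> drops by less than \<open>ln
      2\<close> there; and \<open>m * r = 4 > pi\<close>.\<close>
  define m where "m = \<nu> + exp a / 4"
  define r where "r = 4 / m"
  have m: "m > 32" "m \<ge> \<nu>" using \<nu> exp_gt_zero[of a] unfolding m_def by linarith+
  then have r: "0 < r" "r < 1 / 8" by (auto simp: r_def field_simps)
  have exp_r: "exp (- r) > 1 / 2" "exp r < 2"
  proof -
    show 1: "exp (- r) > 1 / 2" using exp_ge_add_one_self[of "- r"] r by linarith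
    then show "exp r < 2" by (simp add: exp_minus field_simps)
  qed
  have near: "\<tau> \<in> T \<and> a - r \<le> Re \<tau> \<and> Re \<tau> \<le> a + r \<and> \<bar>Im \<tau>\<bar> \<le> r" if "\<tau> \<in> cball (of_real a) r" for \<tau>
  proof -
    have "norm (\<tau> - of_real a) \<le> r" using that by (simp add: dist_norm norm_minus_commute)
    then have "\<bar>Re (\<tau> - of_real a)\<bar> \<le> r" "\<bar>Im (\<tau> - of_real a)\<bar> \<le> r"
      using abs_Re_le_cmod[of "\<tau> - of_real a"] abs_Im_le_cmod[of "\<tau> - of_real a"] by linarith+
    moreover have "r < pi / 6" using r pi_gt3 by linarith
    ultimately show ?thesis by (auto simp: T_def abs_le_iff)
  qed
  \<comment> \<open>The logarithm of \<open>c\<close> nearest to the value at the base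
      point.\<close>
  define p where "p = \<Psi> (of_real a) + Ln (c / exp (\<Psi> (of_real a)))"
  have p: "exp p = c" using c by (simp add: p_def exp_add exp_Ln)
  have "norm (\<Psi> (of_real a) - p) = norm (Ln (c / exp (\<Psi> (of_real a))))" by (simp add: p_def norm_minus_cancel)
  also have "\<dots> \<le> pi"
  proof -
    let ?q = "c / exp (\<Psi> (of_real a))"
    have q: "?q \<noteq> 0" using c by simp
    have "norm ?q = 1" using a c by (simp add: \<phi>_def norm_divide)
    then have "Re (Ln ?q) = 0" using Re_Ln[OF q] by simp
    moreover have "\<bar>Im (Ln ?q)\<bar> \<le> pi" using mpi_less_Im_Ln[OF q] Im_Ln_le_pi[OF q] by simp
    ultimately show ?thesis using cmod_eq_Im by simp
  qed
  also have "pi < m * r" using m pi_less_4 by (simp add: r_def)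
  finally have "norm (\<Psi> (of_real a) - p) < m * r" .
  then have "\<exists>\<tau>\<in>ball (of_real a) r. \<Psi> \<tau> = p"
  proof (rule ball_subset_image_if_deriv_large[rotated 3])
    fix \<tau> assume \<tau>: "\<tau> \<in> cball (complex_of_real a) r"
    note n = near[OF \<tau>]
    show "(\<Psi> has_field_derivative \<Psi>' \<tau>) (at \<tau>)" using n by (intro d\<Psi>) auto
    have "exp a / 2 < exp (a - r)" using exp_r(1) by (simp add: exp_diff exp_minus field_simps)
    also have "\<dots> \<le> exp (Re \<tau>)" using n by simp
    finally have "m < Re (\<Psi>' \<tau>)" using Re\<Psi>'[of \<tau>] n by (auto simp: m_def)
    then show "m < norm (\<Psi>' \<tau>)" using complex_Re_le_cmod[of "\<Psi>' \<tau>"] by linarith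
  qed (use m in auto)
  then obtain \<tau> where \<tau>: "\<tau> \<in> cball (of_real a) r" "\<Psi> \<tau> = p"
    by (meson ball_subset_cball subsetD)
  note n = near[OF \<tau>(1)]
  have "?I \<tau> / ?K \<tau> = c" using \<Psi>(2)[of \<tau>] n \<tau>(2) p by simp
  then have "?I \<tau> = c * ?K \<tau>" using K0[of \<tau>] n by (simp add: field_simps)
  moreover have "\<bar>Im (exp \<tau>)\<bar> < \<nu>"
  proof -
    have "\<bar>Im (exp \<tau>)\<bar> = exp (Re \<tau>) * \<bar>sin (Im \<tau>)\<bar>" by (simp add: Im_exp abs_mult)
    also have "\<dots> \<le> exp (a + r) * r"
      using n abs_sin_x_le_abs_x[of "Im \<tau>"] by (intro mult_mono) auto
    also have "\<dots> \<le> (exp a * 2) * r"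
      using exp_r r by (intro mult_right_mono) (auto simp: exp_add)
    also have "\<dots> \<le> 32"
    proof -
      have "exp a * 8 \<le> 32 * m" using \<nu> by (simp add: m_def)
      then show ?thesis using m by (simp add: r_def field_simps)
    qed
    finally show ?thesis using \<nu> by linarith
  qed
  ultimately show ?thesis using TR n by blast
qed

section \<open>Transfer to the principal sheet\<close>

definition log_coord :: "complex \<Rightarrow> complex" where
  "log_coord z = Ln z - \<i> * of_real (pi / 2)"

lemma exp_i_half_pi: "exp (\<i> * of_real (pi / 2)) = \<i>"
  by (metis cis_conv_exp cis_pi_half)

lemma exp_log_coord: "z \<noteq> 0 \<Longrightarrow> exp (log_coord z) = - \<i> * z"
  unfolding log_coord_def exp_diff exp_i_half_pi by (simp add: divide_inverse)

lemma exp_2_log_coord: "z \<noteq> 0 \<Longrightarrow> exp (2 * log_coord z) = - z\<^sup>2"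
  unfolding exp_double_mult by (simp add: exp_log_coord power2_eq_square algebra_simps)

lemma Im_log_coord: "Im (log_coord z) = Im (Ln z) - pi / 2"
  by (simp add: log_coord_def)

lemma log_coord_right_strip: "Im z > 0 \<Longrightarrow> log_coord z \<in> right_strip"
  using Im_Ln_pos_lt_imp[of z] unfolding right_strip_def mem_Collect_eq Im_log_coord abs_less_iff
  by linarith

lemma log_coord_i_exp: "\<tau> \<in> right_strip \<Longrightarrow> log_coord (\<i> * exp \<tau>) = \<tau>"
proof -
  assume "\<tau> \<in> right_strip"
  then have "\<bar>Im \<tau>\<bar> < pi / 2" by (simp add: right_strip_def)
  moreover have "\<i> * exp \<tau> = exp (\<tau> + \<i> * of_real (pi / 2))"
    unfolding exp_add exp_i_half_pi by simp
  ultimately have "Ln (\<i> * exp \<tau>) = \<tau> + \<i> * of_real (pi / 2)"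
    by (simp only:) (intro Ln_exp, auto)
  then show ?thesis by (simp add: log_coord_def)
qed

text \<open>On the closed upper half plane the coordinate is the logarithm of a number in the
  closed right half plane, away from the cut. So it is continuous up to the negative real axis
  from above.\<close>

lemma log_coord_upper:
  assumes "Im z \<ge> 0" "z \<noteq> 0" shows "log_coord z = Ln (- \<i> * z)"
proof (rule sym, rule Ln_unique)
  show "exp (log_coord z) = - \<i> * z" by (rule exp_log_coord[OF assms(2)])
  show "- pi < Im (log_coord z)" "Im (log_coord z) \<le> pi"
    using Im_Ln_pos_le[OF assms(2)] assms(1) pi_gt_zero unfolding Im_log_coord by linarith+
qed

lemma continuous_log_coord: "continuous_on {z. Im z \<ge> 0 \<and> z \<noteq> 0} log_coord"
proof -
  have "continuous_on {z. Im z \<ge> 0 \<and> z \<noteq> 0} (\<lambda>z. Ln (- \<i> * z))"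
    by (intro continuous_intros) (auto simp: complex_nonpos_Reals_iff complex_eq_iff)
  then show ?thesis by (rule continuous_on_eq) (auto simp: log_coord_upper)
qed

lemma bessel_J_eq_logI:
  assumes "z \<noteq> 0"
  shows "bessel_J b z = exp (\<i> * of_real (pi / 2) * b) * logI b (log_coord z)"
proof -
  have "(-1) ^ k * rGamma (b + of_nat k + 1) / fact k * (z / 2) ^ (2 * k)
      = rGamma (b + of_nat k + 1) / fact k * (- (z / 2)\<^sup>2) ^ k" for k
    by (subst power_minus) (simp add: power_mult)
  then have "bessel_J b z = (z / 2) powr b * reg0F1 b (- (z / 2)\<^sup>2)"
    unfolding bessel_J_def reg0F1_def by (simp only:)
  also have "- (z / 2)\<^sup>2 = exp (2 * log_coord z) / 4"
    using assms by (simp add: exp_2_log_coord power_divide)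
  also have "(z / 2) powr b = exp (b * (Ln z - of_real (ln 2)))"
    using assms Ln_divide_of_real[of 2 z] by (simp add: powr_def)
  also have "\<dots> = exp (\<i> * of_real (pi / 2) * b) * exp (b * (log_coord z - of_real (ln 2)))"
    unfolding exp_add[symmetric] by (simp add: log_coord_def algebra_simps)
  finally show ?thesis by (simp add: logI_def)
qed

definition bessel_Y_quotient :: "complex \<Rightarrow> complex \<Rightarrow> complex" where
  "bessel_Y_quotient b z = (bessel_J b z * cos (b * of_real pi) - bessel_J (- b) z) / sin (b * of_real pi)"

text \<open>Euler's formula turns $J_b \cos \pi b - J_{-b}$ into a combination of $I_b$ and
  $I_{-b} - I_b$. The result is arranged so that each summand has a limit as \<open>b\<close>
  tends to an integer.\<close>

lemma bessel_Y_quotient_eq: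
  assumes "z \<noteq> 0" "sin (of_real pi * b) \<noteq> 0"
  shows "bessel_Y_quotient b z =
     - (2 / of_real pi) * exp (- (\<i> * of_real (pi / 2) * b)) * (of_real pi * logI_gap b (log_coord z) / (2 * sin (of_real pi * b)))
     + \<i> * exp (\<i> * of_real (pi / 2) * b) * logI b (log_coord z)"
proof -
  define E E' where "E = exp (\<i> * of_real (pi / 2) * b)" and "E' = exp (- (\<i> * of_real (pi / 2) * b))"
  define s c where "s = sin (of_real pi * b)" and "c = cos (of_real pi * b)"
  have s: "s \<noteq> 0" using assms(2) by (simp add: s_def)
  have EE: "E * E' = 1" by (simp add: E_def E'_def flip: exp_add)
  have "E * E = exp (\<i> * (of_real pi * b))"
    unfolding E_def exp_add[symmetric] by (rule arg_cong[of _ _ exp]) (simp add: algebra_simps)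
  then have cs: "E * E = c + \<i> * s" by (simp add: exp_Euler c_def s_def)
  have E2: "E' = E * (c - \<i> * s)"
  proof -
    have "(c + \<i> * s) * (c - \<i> * s) = 1"
      using sin_cos_squared_add[of "of_real pi * b"] by (simp add: c_def s_def power2_eq_square algebra_simps)
    then have "E' * (E * E * (c - \<i> * s)) = E'" by (simp add: cs)
    moreover have "E' * (E * E * (c - \<i> * s)) = (E * E') * (E * (c - \<i> * s))" by (simp add: mult_ac)
    ultimately show ?thesis by (simp add: EE)
  qed
  let ?I = "logI b (log_coord z)" and ?I' = "logI (- b) (log_coord z)"
  have "bessel_Y_quotient b z = (E * ?I * c - E' * ?I') / s"
    unfolding bessel_Y_quotient_def bessel_J_eq_logI[OF assms(1)] E_def E'_def s_def c_def
    by (simp add: mult.commute)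
  also have "\<dots> = - E' * (?I' - ?I) / s + \<i> * E * ?I"
    using s unfolding E2 by (simp add: field_simps)
  finally show ?thesis
    using pi_neq_zero by (simp add: E_def E'_def s_def logI_gap_def)
qed

lemma eventually_not_Ints: 
  assumes "b \<in> \<int>" shows "\<forall>\<^sub>F c in at (b::complex). c \<notin> \<int>"
proof -
  obtain n where n: "b = of_int n" using assms by (elim Ints_cases)
  have "\<forall>\<^sub>F c in at b. c \<noteq> b \<and> dist c b < 1"
    using eventually_at_ball[OF zero_less_one, of b UNIV] eventually_neq_at_within[of b b UNIV]
    by eventually_elim (auto simp: dist_commute)
  then show ?thesis
  proof eventually_elim
    case (elim c)
    show ?case
    proof
      assume "c \<in> \<int>"
      then obtain m where m: "c = of_int m" by (elim Ints_cases)
      have "dist c b = \<bar>real_of_int (m - n)\<bar>"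
        unfolding m n dist_norm of_int_diff[symmetric] by (rule norm_of_int)
      then have "\<bar>m - n\<bar> < 1" using elim by linarith
      then show False using elim m n by simp
    qed
  qed
qed

lemma tendsto_bessel_Y_quotient:
  assumes "z \<noteq> 0" "b \<in> \<int>"
  shows "((\<lambda>c. bessel_Y_quotient c z) \<longlongrightarrow>
     - (2 / of_real pi) * exp (- (\<i> * of_real (pi / 2) * b)) * logK b (log_coord z)
     + \<i> * exp (\<i> * of_real (pi / 2) * b) * logI b (log_coord z)) (at b)"
proof -
  have "isCont (\<lambda>c. logI c (log_coord z)) b"
    using holomorphic_logI_param[of "log_coord z" UNIV]
    by (meson UNIV_I continuous_on_eq_continuous_at holomorphic_on_imp_continuous_on open_UNIV)
  then have "((\<lambda>c. logI c (log_coord z)) \<longlongrightarrow> logI b (log_coord z)) (at b)" by (simp add: isCont_def)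
  then have "((\<lambda>c. - (2 / of_real pi) * exp (- (\<i> * of_real (pi / 2) * c)) * (of_real pi * logI_gap c (log_coord z) / (2 * sin (of_real pi * c)))
     + \<i> * exp (\<i> * of_real (pi / 2) * c) * logI c (log_coord z)) \<longlongrightarrow>
     - (2 / of_real pi) * exp (- (\<i> * of_real (pi / 2) * b)) * logK b (log_coord z)
     + \<i> * exp (\<i> * of_real (pi / 2) * b) * logI b (log_coord z)) (at b)"
    by (intro tendsto_intros tendsto_logK_int assms(2))
  then show ?thesis
  proof (rule Lim_transform_eventually)
    show "\<forall>\<^sub>F c in at b. - (2 / of_real pi) * exp (- (\<i> * of_real (pi / 2) * c)) * (of_real pi * logI_gap c (log_coord z) / (2 * sin (of_real pi * c)))
     + \<i> * exp (\<i> * of_real (pi / 2) * c) * logI c (log_coord z) = bessel_Y_quotient c z"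
      using eventually_not_Ints[OF assms(2)]
      by eventually_elim (rule bessel_Y_quotient_eq[OF assms(1) sin_pi_nonzero, symmetric])
  qed
qed

lemma tendsto_bessel_Y: "b \<in> \<int> \<Longrightarrow> z \<noteq> 0 \<Longrightarrow> ((\<lambda>c. bessel_Y_quotient c z) \<longlongrightarrow> bessel_Y b z) (at b)"
  using tendsto_bessel_Y_quotient[of z b] tendsto_Lim[OF _ tendsto_bessel_Y_quotient[of z b]]
  unfolding bessel_Y_def Let_def bessel_Y_quotient_def by simp

lemma bessel_Y_eq_quotient: "b \<notin> \<int> \<Longrightarrow> bessel_Y b z = bessel_Y_quotient b z"
  by (simp add: bessel_Y_def Let_def bessel_Y_quotient_def)

lemma bessel_Y_eq:
  assumes "z \<noteq> 0"
  shows "bessel_Y b z = - (2 / of_real pi) * exp (- (\<i> * of_real (pi / 2) * b)) * logK b (log_coord z)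
     + \<i> * exp (\<i> * of_real (pi / 2) * b) * logI b (log_coord z)"
proof (cases "b \<in> \<int>")
  case True
  show ?thesis
    by (rule tendsto_unique[OF _ tendsto_bessel_Y[OF True assms] tendsto_bessel_Y_quotient[OF assms True]]) simp
next
  case False
  then show ?thesis
    unfolding bessel_Y_eq_quotient[OF False] bessel_Y_quotient_eq[OF assms sin_pi_nonzero[OF False]]
    by (simp add: logK_def)
qed

text \<open>The two multiples of $I_b$ in $J_b$ and in $i Y_b$ cancel. This is the reason why
  $H^{(1)}$ is the solution that decays upwards.\<close>

lemma hankel_H1_eq_logK:
  assumes "z \<noteq> 0"
  shows "hankel_H1 b z = - \<i> * (2 / of_real pi) * exp (- (\<i> * of_real (pi / 2) * b)) * logK b (log_coord z)"
  unfolding hankel_H1_def bessel_Y_eq[OF assms] bessel_J_eq_logI[OF assms] by (simp add: algebra_simps)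

lemma hankel_H2_eq: "hankel_H2 b z = 2 * bessel_J b z - hankel_H1 b z"
  by (simp add: hankel_H1_def hankel_H2_def)

lemma bessel_solution_log_coord:
  assumes f: "log_solution UNIV a f" and w: "\<And>z. z \<noteq> 0 \<Longrightarrow> w z = f (log_coord z)"
  shows "bessel_solution a w"
proof -
  let ?S = "- \<real>\<^sub>\<le>\<^sub>0 :: complex set"
  have oS: "open ?S" by (simp add: open_Compl)
  note df = log_solution_derivs[OF f open_UNIV UNIV_I]
  have dl: "(log_coord has_field_derivative 1 / z) (at z)" if "z \<in> ?S" for z
  proof -
    have "(Ln has_field_derivative inverse z) (at z)"
      by (rule has_field_derivative_Ln) (use that in simp)
    from DERIV_diff[OF this DERIV_const]
    have "((\<lambda>z. Ln z - \<i> * of_real (pi / 2)) has_field_derivative 1 / z) (at z)"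
      by (simp only: diff_0_right inverse_eq_divide)
    then show ?thesis by (simp only: log_coord_def[abs_def])
  qed
  have n0: "z \<noteq> 0" if "z \<in> ?S" for z using that by auto
  have dw: "(w has_field_derivative deriv f (log_coord z) / z) (at z)" if "z \<in> ?S" for z
  proof -
    have "((\<lambda>z. f (log_coord z)) has_field_derivative deriv f (log_coord z) * (1 / z)) (at z)"
      by (rule DERIV_chain2[OF df(1) dl[OF that]])
    then have "(w has_field_derivative deriv f (log_coord z) * (1 / z)) (at z)"
      by (rule has_field_derivative_transform_within_open[OF _ oS that]) (simp add: w n0)
    then show ?thesis by simp
  qed
  have ddw: "deriv (deriv w) z = ((a\<^sup>2 - z\<^sup>2) * w z - deriv f (log_coord z)) / z\<^sup>2" if "z \<in> ?S" for z
  proof -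
    note n = n0[OF that]
    have "((\<lambda>z. deriv f (log_coord z)) has_field_derivative ((a\<^sup>2 + exp (2 * log_coord z)) * f (log_coord z)) * (1 / z)) (at z)"
      by (rule DERIV_chain2[OF df(2) dl[OF that]])
    from DERIV_divide[OF this DERIV_ident n]
    have "((\<lambda>z. deriv f (log_coord z) / z) has_field_derivative ((a\<^sup>2 - z\<^sup>2) * w z - deriv f (log_coord z)) / z\<^sup>2) (at z)"
      using n by (simp add: exp_2_log_coord w power2_eq_square)
    then have "(deriv w has_field_derivative ((a\<^sup>2 - z\<^sup>2) * w z - deriv f (log_coord z)) / z\<^sup>2) (at z)"
      by (rule has_field_derivative_transform_within_open[OF _ oS that]) (simp add: DERIV_imp_deriv[OF dw])
    then show ?thesis by (rule DERIV_imp_deriv)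
  qed
  have "w holomorphic_on ?S"
    using dw oS by (auto simp: holomorphic_on_open)
  moreover have "continuous_on {z. Im z \<ge> 0 \<and> z \<noteq> 0} w"
  proof -
    have "continuous_on UNIV f" by (rule holomorphic_on_imp_continuous_on[OF log_solution_holomorphic[OF f open_UNIV]])
    then have "continuous_on {z. Im z \<ge> 0 \<and> z \<noteq> 0} (\<lambda>z. f (log_coord z))"
      by (rule continuous_on_compose2[OF _ continuous_log_coord]) auto
    then show ?thesis by (rule continuous_on_eq) (auto simp: w)
  qed
  moreover have "z\<^sup>2 * deriv (deriv w) z + z * deriv w z + (z\<^sup>2 - a\<^sup>2) * w z = 0" if "z \<in> ?S" for z
    unfolding ddw[OF that] DERIV_imp_deriv[OF dw[OF that]] using n0[OF that]
    by simp (simp add: algebra_simps)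
  ultimately show ?thesis unfolding bessel_solution_def by blast
qed

text \<open>With constant Wronskians the identity $f\,(K I' - K' I) = K\,(f I' - f' I) - I\,(f K'
  - f' K)$ expresses \<open>f\<close> through $K$ and $I$ away from the cut; on the cut both sides
  are the continuous extension from above.\<close>

lemma bessel_solution_J_H1_combination:
  assumes "bessel_solution (of_real \<nu>) w"
  obtains A B where "\<And>z. z \<noteq> 0 \<Longrightarrow> w z = A * bessel_J (of_real \<nu>) z + B * hankel_H1 (of_real \<nu>) z"
proof -
  let ?S = "- \<real>\<^sub>\<le>\<^sub>0 :: complex set"
  have oS: "open ?S" by (simp add: open_Compl)
  from assms have hol: "w holomorphic_on ?S" and cont: "continuous_on {z. Im z \<ge> 0 \<and> z \<noteq> 0} w"
    and ode: "\<And>z. z \<in> ?S \<Longrightarrow> z\<^sup>2 * deriv (deriv w) z + z * deriv w z + (z\<^sup>2 - (of_real \<nu>)\<^sup>2) * w z = 0"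
    unfolding bessel_solution_def by auto
  define T where "T = {\<tau>. Im \<tau> < pi / 2} \<inter> {\<tau>. Im \<tau> > - (3 * pi / 2)}"
  have T: "convex T" "open T"
    unfolding T_def
    by (intro convex_Int convex_halfspace_Im_lt convex_halfspace_Im_gt
        open_Int open_halfspace_Im_lt open_halfspace_Im_gt)+
  define f where "f = (\<lambda>\<tau>. w (\<i> * exp \<tau>))"
  have inS: "\<i> * exp \<tau> \<in> ?S" if "\<tau> \<in> T" for \<tau>
  proof -
    have e: "\<i> * exp \<tau> = exp (\<tau> + \<i> * of_real (pi / 2))" unfolding exp_add exp_i_half_pi by simp
    have "Ln (exp (\<tau> + \<i> * of_real (pi / 2))) = \<tau> + \<i> * of_real (pi / 2)"
      by (rule Ln_exp) (use that in \<open>auto simp: T_def\<close>)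
    then have "Im (Ln (\<i> * exp \<tau>)) \<noteq> pi" using that unfolding e by (simp add: T_def)
    then have "\<not> (Re (\<i> * exp \<tau>) < 0 \<and> Im (\<i> * exp \<tau>) = 0)"
      using Im_Ln_eq_pi[of "\<i> * exp \<tau>"] by simp
    moreover have "\<i> * exp \<tau> \<noteq> 0" by simp
    ultimately show ?thesis unfolding Compl_iff complex_nonpos_Reals_iff complex_eq_iff
      by (metis less_le zero_complex.sel)
  qed
  have sol: "log_solution T (of_real \<nu>) f"
  proof (rule log_solutionI[where f' = "\<lambda>\<tau>. deriv w (\<i> * exp \<tau>) * (\<i> * exp \<tau>)"])
    fix \<tau> assume \<tau>: "\<tau> \<in> T"
    let ?z = "\<i> * exp \<tau>"
    have d: "((\<lambda>\<tau>. \<i> * exp \<tau>) has_field_derivative ?z) (at \<tau>)" by (intro DERIV_cmult DERIV_exp)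
    show "(f has_field_derivative deriv w ?z * ?z) (at \<tau>)"
      unfolding f_def by (rule DERIV_chain2[OF holomorphic_derivI[OF hol oS inS[OF \<tau>]] d])
    have "((\<lambda>\<tau>. deriv w (\<i> * exp \<tau>) * (\<i> * exp \<tau>)) has_field_derivative
        deriv (deriv w) ?z * ?z * ?z + ?z * deriv w ?z) (at \<tau>)"
      by (intro DERIV_mult d DERIV_chain2[OF holomorphic_derivI[OF holomorphic_deriv[OF hol oS] oS inS[OF \<tau>]] d])
    moreover have "deriv (deriv w) ?z * ?z * ?z + ?z * deriv w ?z = ((of_real \<nu>)\<^sup>2 - ?z\<^sup>2) * w ?z"
      using ode[OF inS[OF \<tau>]] by (simp add: power2_eq_square algebra_simps)
    moreover have "?z\<^sup>2 = - exp (2 * \<tau>)" by (simp add: exp_double power_mult_distrib)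
    ultimately show "((\<lambda>\<tau>. deriv w (\<i> * exp \<tau>) * (\<i> * exp \<tau>)) has_field_derivative
        ((of_real \<nu>)\<^sup>2 + exp (2 * \<tau>)) * f \<tau>) (at \<tau>)" by (simp add: f_def)
  qed
  let ?I = "logI (of_real \<nu>)" and ?K = "logK (of_real \<nu>)"
  obtain p where p: "\<And>\<tau>. \<tau> \<in> T \<Longrightarrow> f \<tau> * deriv ?I \<tau> - deriv f \<tau> * ?I \<tau> = p"
    using log_solution_wronskian_constant[OF sol log_solution_logI T(2,1)] by blast
  obtain q where q: "\<And>\<tau>. \<tau> \<in> T \<Longrightarrow> f \<tau> * deriv ?K \<tau> - deriv f \<tau> * ?K \<tau> = q"
    using log_solution_wronskian_constant[OF sol log_solution_subset[OF log_solution_logK] T(2,1)] by blast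
  have f_eq: "f \<tau> = p * ?K \<tau> - q * ?I \<tau>" if "\<tau> \<in> T" for \<tau>
  proof -
    have "f \<tau> = f \<tau> * (?K \<tau> * deriv ?I \<tau> - deriv ?K \<tau> * ?I \<tau>)"
      unfolding logK_logI_wronskian by simp
    also have "\<dots> = p * ?K \<tau> - q * ?I \<tau>"
      unfolding p[OF that, symmetric] q[OF that, symmetric] by (simp add: algebra_simps)
    finally show ?thesis .
  qed
  define E where "E = exp (\<i> * of_real (pi / 2) * of_real \<nu>)"
  define k where "k = - \<i> * (2 / of_real pi) * exp (- (\<i> * of_real (pi / 2) * of_real \<nu>))"
  have E: "E \<noteq> 0" and k: "k \<noteq> 0" by (simp_all add: E_def k_def)
  define g where "g = (\<lambda>z. (- q / E) * bessel_J (of_real \<nu>) z + (p / k) * hankel_H1 (of_real \<nu>) z)"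
  have g: "g z = p * ?K (log_coord z) - q * ?I (log_coord z)" if "z \<noteq> 0" for z
    unfolding g_def bessel_J_eq_logI[OF that] hankel_H1_eq_logK[OF that] E_def[symmetric] k_def[symmetric]
    using E k by simp
  have wg: "w z = g z" if "z \<in> ?S" for z
  proof -
    have n: "z \<noteq> 0" using that by auto
    have "Im (Ln z) \<noteq> pi" using Im_Ln_eq_pi[OF n] that by (auto simp: complex_nonpos_Reals_iff)
    then have "log_coord z \<in> T"
      using mpi_less_Im_Ln[OF n] Im_Ln_le_pi[OF n] by (simp add: T_def log_coord_def)
    from f_eq[OF this] show ?thesis unfolding g[OF n] by (simp add: f_def exp_log_coord n)
  qed
  have "w z = g z" if n: "z \<noteq> 0" for z
  proof (cases "z \<in> ?S")
    case False
    then have z: "Im z = 0" by (simp add: complex_nonpos_Reals_iff)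
    let ?U = "{z. Im z \<ge> 0 \<and> z \<noteq> 0}"
    \<comment> \<open>A point of the cut is approached from the upper half plane, where both sides
        are continuous.\<close>
    define s where "s = (\<lambda>k. z + \<i> * of_real (1 / real (Suc k)))"
    have "s \<longlonglongrightarrow> z + \<i> * of_real 0"
      unfolding s_def by (intro tendsto_intros LIMSEQ_Suc lim_inverse_n')
    then have lim: "s \<longlonglongrightarrow> z" by simp
    have Im_s: "Im (s k) > 0" for k by (simp add: s_def z)
    have sU: "s k \<in> ?U" for k
      using Im_s[of k] by (cases "s k = 0") (auto simp: less_imp_le)
    have sS: "s k \<in> ?S" for k
      using Im_s[of k] by (simp add: complex_nonpos_Reals_iff)
    have gcont: "continuous_on ?U g"
    proof -
      have "continuous_on UNIV ?K" "continuous_on UNIV ?I"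
        by (auto intro!: holomorphic_on_imp_continuous_on log_solution_holomorphic log_solution_logK holomorphic_logI)
      then have "continuous_on ?U (\<lambda>z. p * ?K (log_coord z) - q * ?I (log_coord z))"
        by (intro continuous_intros continuous_on_compose2[OF _ continuous_log_coord]) auto
      then show ?thesis by (rule continuous_on_eq) (auto simp: g)
    qed
    have "(\<lambda>k. w (s k)) \<longlonglongrightarrow> w z" "(\<lambda>k. g (s k)) \<longlonglongrightarrow> g z"
      using cont gcont lim sU z n unfolding continuous_on_sequentially by (auto simp: o_def)
    then show ?thesis using LIMSEQ_unique wg[OF sS] by simp
  qed (rule wg)
  then show ?thesis using that unfolding g_def by blast
qed

lemma bessel_J_reflect:
  assumes "z \<notin> \<real>\<^sub>\<le>\<^sub>0"
  shows "bessel_J (cnj b) (cnj z) = cnj (bessel_J b z)"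
proof -
  have n: "z \<noteq> 0" using assms by auto
  have J: "bessel_J b z = exp (b * (Ln z - of_real (ln 2))) * reg0F1 b (- z\<^sup>2 / 4)" if "z \<noteq> 0" for b z
  proof -
    have "exp (\<i> * of_real (pi / 2) * b) * exp (b * (log_coord z - of_real (ln 2))) = exp (b * (Ln z - of_real (ln 2)))"
      unfolding exp_add[symmetric] by (simp add: log_coord_def algebra_simps)
    then show ?thesis
      unfolding bessel_J_eq_logI[OF that] logI_def exp_2_log_coord[OF that] by (simp flip: mult.assoc)
  qed
  show ?thesis
    using n by (simp add: J exp_cnj cnj_reg0F1 cnj_Ln[OF assms])
qed

text \<open>For a real order the defining quotient commutes with conjugation; at an integer order
  the limit may be taken along real orders.\<close>

lemma bessel_Y_reflect:
  assumes "z \<notin> \<real>\<^sub>\<le>\<^sub>0"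
  shows "bessel_Y (of_real \<nu>) (cnj z) = cnj (bessel_Y (of_real \<nu>) z)"
proof -
  have n: "z \<noteq> 0" using assms by auto
  have q: "bessel_Y_quotient (of_real c) (cnj z) = cnj (bessel_Y_quotient (of_real c) z)" for c :: real
    using bessel_J_reflect[OF assms, of "of_real c"] bessel_J_reflect[OF assms, of "- of_real c"]
    unfolding bessel_Y_quotient_def of_real_mult[symmetric] cos_of_real sin_of_real
    by simp
  show ?thesis
  proof (cases "complex_of_real \<nu> \<in> \<int>")
    case False
    then show ?thesis by (simp add: bessel_Y_eq_quotient q)
  next
    case True
    then obtain m where "complex_of_real \<nu> = of_int m" by (elim Ints_cases)
    then have m: "\<nu> = real_of_int m" by (metis of_real_eq_iff of_real_of_int_eq)
    let ?c = "\<lambda>k. complex_of_real (real_of_int m + 1 / (real k + 2))"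
    note hs = harmonic_shift_sequence[of m]
    have "?c k \<noteq> of_real \<nu>" for k using hs(4)[of k] unfolding m of_real_eq_iff .
    moreover have "?c \<longlonglongrightarrow> of_real \<nu>" unfolding m by (rule tendsto_of_real[OF hs(1)])
    ultimately have c: "filterlim ?c (at (of_real \<nu>)) sequentially"
      by (intro filterlim_atI always_eventually allI)
    have "(\<lambda>k. bessel_Y_quotient (?c k) (cnj z)) \<longlonglongrightarrow> bessel_Y (of_real \<nu>) (cnj z)"
      by (rule filterlim_compose[OF tendsto_bessel_Y[OF True] c]) (use n in simp)
    moreover have "(\<lambda>k. cnj (bessel_Y_quotient (?c k) z)) \<longlonglongrightarrow> cnj (bessel_Y (of_real \<nu>) z)"
      by (intro tendsto_cnj filterlim_compose[OF tendsto_bessel_Y[OF True n] c])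
    ultimately show ?thesis unfolding q by (rule LIMSEQ_unique)
  qed
qed

lemma hankel_H2_reflect:
  assumes "z \<notin> \<real>\<^sub>\<le>\<^sub>0"
  shows "hankel_H2 (of_real \<nu>) (cnj z) = cnj (hankel_H1 (of_real \<nu>) z)"
  using bessel_J_reflect[OF assms, of "of_real \<nu>"] bessel_Y_reflect[OF assms, of \<nu>]
  by (simp add: hankel_H1_def hankel_H2_def)

section \<open>Zeros in the strip\<close>

text \<open>In the logarithmic variable the condition of the energy estimate reads $\<nu>^2 -
  \mathrm{Re}(z^2) \ge 0$, which holds in the strip.\<close>

lemma bessel_J_nonzero_strip:
  assumes "\<nu> > 0" "z \<noteq> 0" "Re z \<in> {-\<nu><..<\<nu>}"
  shows "bessel_J (of_real \<nu>) z \<noteq> 0"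
proof -
  have "exp (2 * Re (log_coord z)) * cos (2 * Im (log_coord z)) = Re (exp (2 * log_coord z))"
    by (simp add: Re_exp)
  also have "\<dots> = (Im z)\<^sup>2 - (Re z)\<^sup>2"
    using assms(2) by (simp add: exp_2_log_coord Re_power2)
  also have "(Re z)\<^sup>2 \<le> \<nu>\<^sup>2" using assms(3) by (intro abs_le_square_iff[THEN iffD1]) auto
  then have "\<nu>\<^sup>2 + ((Im z)\<^sup>2 - (Re z)\<^sup>2) \<ge> 0" using zero_le_power2[of "Im z"] by linarith
  finally have "logI (of_real \<nu>) (log_coord z) \<noteq> 0" by (intro logI_nonzero assms)
  then show ?thesis using assms(2) by (simp add: bessel_J_eq_logI)
qed

lemma hankel_H1_nonzero_upper: "Im z > 0 \<Longrightarrow> hankel_H1 (of_real \<nu>) z \<noteq> 0"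
  using logK_nonzero[OF log_coord_right_strip[of z], of \<nu>] hankel_H1_eq_logK[of z "of_real \<nu>"]
  by (cases "z = 0") auto

lemma hankel_H2_nonzero_lower: "Im z < 0 \<Longrightarrow> hankel_H2 (of_real \<nu>) z \<noteq> 0"
  using hankel_H1_nonzero_upper[of "cnj z" \<nu>] hankel_H2_reflect[of "cnj z" \<nu>]
  by (auto simp: complex_nonpos_Reals_iff)

lemma J_H1_combination_has_upper_zero:
  assumes \<nu>: "\<nu> > 32" and "A \<noteq> 0" "B \<noteq> 0"
  obtains z where "A * bessel_J (of_real \<nu>) z + B * hankel_H1 (of_real \<nu>) z = 0" "\<bar>Re z\<bar> < \<nu>" "Im z > 0"
proof -
  define E where "E = exp (\<i> * of_real (pi / 2) * of_real \<nu>)"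
  define k where "k = - \<i> * (2 / of_real pi) * exp (- (\<i> * of_real (pi / 2) * of_real \<nu>))"
  have E: "E \<noteq> 0" and k: "k \<noteq> 0" by (simp_all add: E_def k_def)
  then have "- B * k / (A * E) \<noteq> 0" using assms by simp
  from logI_div_logK_surj[OF \<nu> this] obtain \<tau> where \<tau>: "\<tau> \<in> right_strip" "\<bar>Im (exp \<tau>)\<bar> < \<nu>"
    "logI (of_real \<nu>) \<tau> = (- B * k / (A * E)) * logK (of_real \<nu>) \<tau>" by blast
  let ?z = "\<i> * exp \<tau>"
  have n: "?z \<noteq> 0" by simp
  have "A * bessel_J (of_real \<nu>) ?z + B * hankel_H1 (of_real \<nu>) ?z = 0"
    unfolding bessel_J_eq_logI[OF n] hankel_H1_eq_logK[OF n] log_coord_i_exp[OF \<tau>(1)] \<tau>(3)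
      E_def[symmetric] k_def[symmetric]
    using E assms by simp
  moreover have "Im ?z > 0" using Re_exp_right_strip[OF \<tau>(1)] by simp
  moreover have "\<bar>Re ?z\<bar> < \<nu>" using \<tau>(2) by simp
  ultimately show ?thesis using that by blast
qed

text \<open>Reflect a zero of the combination with conjugate coefficients.\<close>

lemma J_H2_combination_has_lower_zero:
  assumes \<nu>: "\<nu> > 32" and "A \<noteq> 0" "B \<noteq> 0"
  obtains z where "A * bessel_J (of_real \<nu>) z + B * hankel_H2 (of_real \<nu>) z = 0" "\<bar>Re z\<bar> < \<nu>" "Im z < 0"
proof -
  obtain z where z: "cnj A * bessel_J (of_real \<nu>) z + cnj B * hankel_H1 (of_real \<nu>) z = 0" "\<bar>Re z\<bar> < \<nu>" "Im z > 0"
    using J_H1_combination_has_upper_zero[OF \<nu>, of "cnj A" "cnj B"] assms by auto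
  have n: "z \<notin> \<real>\<^sub>\<le>\<^sub>0" using z(3) by (auto simp: complex_nonpos_Reals_iff)
  have "A * bessel_J (of_real \<nu>) (cnj z) + B * hankel_H2 (of_real \<nu>) (cnj z)
      = cnj (cnj A * bessel_J (of_real \<nu>) z + cnj B * hankel_H1 (of_real \<nu>) z)"
    using bessel_J_reflect[OF n, of "of_real \<nu>"] by (simp add: hankel_H2_reflect[OF n])
  then show ?thesis using that[of "cnj z"] z by simp
qed

lemma nontrivial_constant_multiple:
  assumes "nontrivial_bessel_solution a w" "constant_multiple_of w f"
  obtains c where "c \<noteq> 0" "\<And>z. z \<noteq> 0 \<Longrightarrow> w z = c * f z"
proof -
  obtain c where c: "\<And>z. z \<noteq> 0 \<Longrightarrow> w z = c * f z" using assms(2) unfolding constant_multiple_of_def by blast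
  obtain z where "z \<noteq> 0" "w z \<noteq> 0" using assms(1) unfolding nontrivial_bessel_solution_def by blast
  then have "c \<noteq> 0" using c by auto
  then show ?thesis using c that by blast
qed

lemma bessel_solutions_nontrivial:
  assumes "\<nu> > 0"
  shows "nontrivial_bessel_solution (of_real \<nu>) (bessel_J (of_real \<nu>))"
    and "nontrivial_bessel_solution (of_real \<nu>) (hankel_H1 (of_real \<nu>))"
    and "nontrivial_bessel_solution (of_real \<nu>) (hankel_H2 (of_real \<nu>))"
proof -
  let ?E = "exp (\<i> * of_real (pi / 2) * of_real \<nu>)"
  let ?k = "- \<i> * (2 / of_real pi) * exp (- (\<i> * of_real (pi / 2) * of_real \<nu>))"
  have sol: "log_solution UNIV (of_real \<nu>) (\<lambda>\<tau>. p * logI (of_real \<nu>) \<tau> + q * logK (of_real \<nu>) \<tau>)" for p q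
    by (rule log_solution_lincomb[OF log_solution_logI log_solution_logK open_UNIV])
  have "bessel_solution (of_real \<nu>) (bessel_J (of_real \<nu>))"
    by (rule bessel_solution_log_coord[OF sol[of ?E 0]]) (simp add: bessel_J_eq_logI)
  moreover have "bessel_J (of_real \<nu>) \<i> \<noteq> 0" using bessel_J_nonzero_strip[of \<nu> \<i>] assms by simp
  ultimately show "nontrivial_bessel_solution (of_real \<nu>) (bessel_J (of_real \<nu>))"
    unfolding nontrivial_bessel_solution_def using complex_i_not_zero by blast
  have "bessel_solution (of_real \<nu>) (hankel_H1 (of_real \<nu>))"
    by (rule bessel_solution_log_coord[OF sol[of 0 ?k]]) (simp add: hankel_H1_eq_logK)
  moreover have "hankel_H1 (of_real \<nu>) \<i> \<noteq> 0" using hankel_H1_nonzero_upper[of \<i> \<nu>] by simp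
  ultimately show "nontrivial_bessel_solution (of_real \<nu>) (hankel_H1 (of_real \<nu>))"
    unfolding nontrivial_bessel_solution_def using complex_i_not_zero by blast
  have "bessel_solution (of_real \<nu>) (hankel_H2 (of_real \<nu>))"
    by (rule bessel_solution_log_coord[OF sol[of "2 * ?E" "- ?k"]])
       (simp add: hankel_H2_eq hankel_H1_eq_logK bessel_J_eq_logI)
  moreover have "hankel_H2 (of_real \<nu>) (- \<i>) \<noteq> 0" using hankel_H2_nonzero_lower[of "- \<i>" \<nu>] by simp
  ultimately show "nontrivial_bessel_solution (of_real \<nu>) (hankel_H2 (of_real \<nu>))"
    unfolding nontrivial_bessel_solution_def by (metis complex_i_not_zero neg_equal_0_iff_equal)
qed

lemma zero_strips_iff_constant_multiple:
  assumes \<nu>: "\<nu> > 32" and w: "nontrivial_bessel_solution (of_real \<nu>) w"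
  shows "\<not> ((\<exists>z. w z = 0 \<and> Re z \<in> {-\<nu><..<\<nu>} \<and> Im z > 0) \<and>
             (\<exists>z. w z = 0 \<and> Re z \<in> {-\<nu><..<\<nu>} \<and> Im z < 0))
          \<longleftrightarrow>
          constant_multiple_of w (bessel_J (of_real \<nu>)) \<or>
          constant_multiple_of w (hankel_H1 (of_real \<nu>)) \<or>
          constant_multiple_of w (hankel_H2 (of_real \<nu>))" (is "\<not> (?up \<and> ?low) \<longleftrightarrow> ?mult")
proof
  let ?J = "bessel_J (of_real \<nu>)" and ?H1 = "hankel_H1 (of_real \<nu>)" and ?H2 = "hankel_H2 (of_real \<nu>)"
  have \<nu>0: "\<nu> > 0" using \<nu> by simp
  show "?mult" if none: "\<not> (?up \<and> ?low)"
  proof (rule ccontr)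
    assume no: "\<not> ?mult"
    obtain A B where AB: "\<And>z. z \<noteq> 0 \<Longrightarrow> w z = A * ?J z + B * ?H1 z"
      using bessel_solution_J_H1_combination w unfolding nontrivial_bessel_solution_def by metis
    \<comment> \<open>The same solution in the basis adapted to the lower half plane.\<close>
    have AB': "w z = (A + 2 * B) * ?J z + (- B) * ?H2 z" if "z \<noteq> 0" for z
      using AB[OF that] by (simp add: hankel_H2_eq algebra_simps)
    have "A \<noteq> 0" using no AB by (auto simp: constant_multiple_of_def)
    moreover have "B \<noteq> 0" using no AB by (auto simp: constant_multiple_of_def)
    moreover have "A + 2 * B \<noteq> 0"
    proof
      assume "A + 2 * B = 0"
      then have "\<And>z. z \<noteq> 0 \<Longrightarrow> w z = (- B) * ?H2 z" using AB' by simp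
      then show False using no unfolding constant_multiple_of_def by blast
    qed
    ultimately obtain z1 z2 where z1: "A * ?J z1 + B * ?H1 z1 = 0" "\<bar>Re z1\<bar> < \<nu>" "Im z1 > 0"
      and z2: "(A + 2 * B) * ?J z2 + (- B) * ?H2 z2 = 0" "\<bar>Re z2\<bar> < \<nu>" "Im z2 < 0"
      using J_H1_combination_has_upper_zero[OF \<nu>, of A B] J_H2_combination_has_lower_zero[OF \<nu>, of "A + 2 * B" "- B"] by (metis neg_equal_0_iff_equal)
    have "z1 \<noteq> 0" "z2 \<noteq> 0" using z1(3) z2(3) by auto
    then have "w z1 = 0" "w z2 = 0" using AB[of z1] AB'[of z2] z1(1) z2(1) by simp_all
    then show False using none z1 z2 by (auto simp: abs_less_iff)
  qed
  show "\<not> (?up \<and> ?low)" if ?mult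
    using that
  proof (elim disjE)
    assume "constant_multiple_of w ?J"
    from nontrivial_constant_multiple[OF w this] obtain c where "c \<noteq> 0" "\<And>z. z \<noteq> 0 \<Longrightarrow> w z = c * ?J z" by blast
    then show ?thesis using bessel_J_nonzero_strip[OF \<nu>0] by (metis mult_eq_0_iff less_irrefl zero_complex.sel(2))
  next
    assume "constant_multiple_of w ?H1"
    from nontrivial_constant_multiple[OF w this] obtain c where "c \<noteq> 0" "\<And>z. z \<noteq> 0 \<Longrightarrow> w z = c * ?H1 z" by blast
    then show ?thesis using hankel_H1_nonzero_upper by (metis mult_eq_0_iff less_irrefl zero_complex.sel(2))
  next
    assume "constant_multiple_of w ?H2"
    from nontrivial_constant_multiple[OF w this] obtain c where "c \<noteq> 0" "\<And>z. z \<noteq> 0 \<Longrightarrow> w z = c * ?H2 z" by blast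
    then show ?thesis using hankel_H2_nonzero_lower by (metis mult_eq_0_iff less_irrefl zero_complex.sel(2))
  qed
qed

theorem theorem7:
  "\<exists>\<nu>0::real. \<nu>0 > 0 \<and> (\<forall>\<nu>::real. \<nu> \<ge> \<nu>0 \<longrightarrow>
     (nontrivial_bessel_solution (of_real \<nu>) (bessel_J (of_real \<nu>)) \<and>
      nontrivial_bessel_solution (of_real \<nu>) (hankel_H1 (of_real \<nu>)) \<and>
      nontrivial_bessel_solution (of_real \<nu>) (hankel_H2 (of_real \<nu>)) \<and>
      (\<forall>w. nontrivial_bessel_solution (of_real \<nu>) w \<longrightarrow>
         (\<not> ((\<exists>z. w z = 0 \<and> Re (z / of_real \<nu>) \<in> {-1<..<1} \<and> Im z > 0) \<and>
             (\<exists>z. w z = 0 \<and> Re (z / of_real \<nu>) \<in> {-1<..<1} \<and> Im z < 0))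
          \<longleftrightarrow>
          constant_multiple_of w (bessel_J (of_real \<nu>)) \<or>
          constant_multiple_of w (hankel_H1 (of_real \<nu>)) \<or>
          constant_multiple_of w (hankel_H2 (of_real \<nu>))))) \<and>
     (\<forall>z. z \<noteq> 0 \<and> Re z \<in> {-\<nu><..<\<nu>} \<longrightarrow> bessel_J (of_real \<nu>) z \<noteq> 0) \<and>
     (\<exists>z. hankel_H1 (of_real \<nu>) z = 0 \<and> Re z \<in> {-\<nu><..<\<nu>} \<and> Im z < 0) \<and>
     (\<exists>z. hankel_H2 (of_real \<nu>) z = 0 \<and> Re z \<in> {-\<nu><..<\<nu>} \<and> Im z > 0))"
\<comment> \<open>Any bound above 32 will do: the constructed zeros satisfy \<open>\<bar>Re
    z\<bar> \<le> 32\<close>.\<close>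
proof (rule exI[of _ "33::real"], intro conjI allI impI)
  fix \<nu> :: real assume "\<nu> \<ge> 33"
  then have \<nu>: "\<nu> > 32" "\<nu> > 0" by auto
  have scale: "Re (z / of_real \<nu>) \<in> {-1<..<1} \<longleftrightarrow> Re z \<in> {-\<nu><..<\<nu>}" for z
    using \<nu>(2) by (auto simp: field_simps)
  show "nontrivial_bessel_solution (of_real \<nu>) (bessel_J (of_real \<nu>))"
    "nontrivial_bessel_solution (of_real \<nu>) (hankel_H1 (of_real \<nu>))"
    "nontrivial_bessel_solution (of_real \<nu>) (hankel_H2 (of_real \<nu>))"
    using bessel_solutions_nontrivial[OF \<nu>(2)] by auto
  show "\<not> ((\<exists>z. w z = 0 \<and> Re (z / of_real \<nu>) \<in> {-1<..<1} \<and> Im z > 0) \<and>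
             (\<exists>z. w z = 0 \<and> Re (z / of_real \<nu>) \<in> {-1<..<1} \<and> Im z < 0))
          \<longleftrightarrow>
          constant_multiple_of w (bessel_J (of_real \<nu>)) \<or>
          constant_multiple_of w (hankel_H1 (of_real \<nu>)) \<or>
          constant_multiple_of w (hankel_H2 (of_real \<nu>))"
    if "nontrivial_bessel_solution (of_real \<nu>) w" for w
    unfolding scale by (rule zero_strips_iff_constant_multiple[OF \<nu>(1) that])
  show "bessel_J (of_real \<nu>) z \<noteq> 0" if "z \<noteq> 0 \<and> Re z \<in> {-\<nu><..<\<nu>}" for z
    using bessel_J_nonzero_strip[OF \<nu>(2)] that by blast
  show "\<exists>z. hankel_H1 (of_real \<nu>) z = 0 \<and> Re z \<in> {-\<nu><..<\<nu>} \<and> Im z < 0"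
  proof -
    obtain z where "2 * bessel_J (of_real \<nu>) z + (- 1) * hankel_H2 (of_real \<nu>) z = 0" "\<bar>Re z\<bar> < \<nu>" "Im z < 0"
      using J_H2_combination_has_lower_zero[OF \<nu>(1), of 2 "- 1"] by auto
    then show ?thesis by (intro exI[of _ z]) (auto simp: hankel_H2_eq)
  qed
  show "\<exists>z. hankel_H2 (of_real \<nu>) z = 0 \<and> Re z \<in> {-\<nu><..<\<nu>} \<and> Im z > 0"
  proof -
    obtain z where "2 * bessel_J (of_real \<nu>) z + (- 1) * hankel_H1 (of_real \<nu>) z = 0" "\<bar>Re z\<bar> < \<nu>" "Im z > 0"
      using J_H1_combination_has_upper_zero[OF \<nu>(1), of 2 "- 1"] by auto
    then show ?thesis by (intro exI[of _ z]) (auto simp: hankel_H2_eq)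
  qed
qed auto

end
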